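(* Let $U$ and $W$ be bounded-degree akernels. Then the random rooted trees $\mathfrak{X}_U$ and $\mathfrak{X}_W$ have the same distribution if and only if $U$ and $W$ are fractionally isomorphic.
   Context: **Kernels and akernels.** A ground space is a standard Borel space $(X,\mathcal{B})$ with a Borel probability measure $\mu$; each akernel comes with a ground space. An akernel is a measurable function $W:X^2\to[0,\infty)$ (not necessarily symmetric). The degree of $x\in X$ is $\deg_W(x)=\int_X W(x,y)\,d\mu(y)$ and $\deg^{\max}(W)=\operatorname{ess\,sup}_x \deg_W(x)$. $W$ is a bounded-degree akernel if $\deg^{\max}(W)<\infty$. **Random rooted tree $\mathfrak{X}_W$.** It is the (possibly infinite) rooted tree of the following multitype branching process. The root has a random type in $X$ with distribution $\mu$. Independently for each particle, a particle of type $x\in X$ has children whose number and types are given by a Poisson point process on $X$ with intensity measure $W(x,y)\,d\mu(y)$. After the construction the types are forgotten, so that $\mathfrak{X}_W$ is a probability distribution on isomorphism classes of rooted trees. For $k\in\mathbb{N}$, $(\mathfrak{X}_W)_{\restriction k}$ is the ball of radius $k$ around the root. $\mathfrak{X}_U$ and $\mathfrak{X}_W$ have the same distribution if for every $k\in\mathbb{N}$ the random (isomorphism classes of) rooted trees $(\mathfrak{X}_U)_{\restriction k}$ and $(\mathfrak{X}_W)_{\restriction k}$ have the same distribution. **Fractional isomorphism.** Fix $c>0$. For a compact metric space $K$, $\mathcal{M}_{\le c}(K)$ is the set of Borel measures on $K$ of total mass at most $c$, with the topology of weak convergence; $f_*\alpha$ denotes pushforward of a measure. Recursively, let $L_0^c=\{\star\}$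 be a one-point space and for $k\ge 0$ let $$\mathbb{P}_k^c=\Big\{\alpha\in\prod_{i=0}^k L_i^c : \alpha(\ell)=(p^c_{\ell-1,\ell})_*\alpha(\ell+1)\ \text{for all } 1\le \ell\le k-1\Big\},\qquad L_{k+1}^c=\mathcal{M}_{\le c}(\mathbb{P}_k^c),$$ where $p^c_{h,k}:\mathbb{P}_k^c\to\mathbb{P}_h^c$ ($h\le k$) is the canonical coordinate projection. Let $$\mathbb{P}^c=\Big\{\alpha\in\prod_{i=0}^\infty L_i^c : \alpha(k)=(p^c_{k-1,k})_*\alpha(k+1)\ \text{for all } k\ge 1\Big\}.$$ All these spaces (with product topologies) are compact metrizable and carry their Borel sigma-algebras. For an akernel $W$ with $\deg^{\max}(W)\le c$ (modified on a null set so that $\deg_W(x)\le c$ for all $x$), let $i_{W,0}:X\to\mathbb{P}_0^c$ be the constant map, and recursively let $i_{W,k+1}:X\to\mathbb{P}_{k+1}^c$ be given by $i_{W,k+1}(x)(j)=i_{W,k}(x)(j)$ for $0\le j\le k$ and $i_{W,k+1}(x)(k+1)(A)=\int_{i_{W,k}^{-1}(A)}W(x,y)\,d\mu(y)$ for Borel $A\subset\mathbb{P}_k^c$. Let $i_W:X\to\mathbb{P}^c$, $i_W(x)(k)=i_{W,k}(x)(k)$, and let $\nu_W=(i_W)_*\mu$, a probability measure on $\mathbb{P}^c$. Two bounded-degree akernels $U,W$ are fractionally isomorphic if $\nu_U=\nu_W$ (where $c$ is any constant with $\deg^{\max}(U),\deg^{\max}(W)\le c$). *)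

theory Defs
  imports "HOL-Probability.Probability"
begin

section \<open>Ground spaces and akernels\<close>

definition borel_of :: "'a topology \<Rightarrow> 'a measure" where
  "borel_of X = sigma (topspace X) {S. openin X S}"

definition standard_borel :: "'a measure \<Rightarrow> bool" where
  "standard_borel M \<longleftrightarrow>
     (\<exists>X. completely_metrizable_space X \<and> second_countable X \<and>
          space M = topspace X \<and> sets M = sets (borel_of X))"

definition ground_space :: "'a measure \<Rightarrow> bool" where
  "ground_space M \<longleftrightarrow> standard_borel M \<and> prob_space M"

definition akernel :: "'a measure \<Rightarrow> ('a \<Rightarrow> 'a \<Rightarrow> real) \<Rightarrow> bool" where
  "akernel M W \<longleftrightarrow> ground_space M \<and>
     (\<lambda>(x, y). W x y) \<in> borel_measurable (M \<Otimes>\<^sub>M M) \<and>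
     (\<forall>x\<in>space M. \<forall>y\<in>space M. 0 \<le> W x y)"

definition degree :: "'a measure \<Rightarrow> ('a \<Rightarrow> 'a \<Rightarrow> real) \<Rightarrow> 'a \<Rightarrow> ennreal" where
  "degree M W x = (\<integral>\<^sup>+ y. ennreal (W x y) \<partial>M)"

definition max_degree :: "'a measure \<Rightarrow> ('a \<Rightarrow> 'a \<Rightarrow> real) \<Rightarrow> ennreal" where
  "max_degree M W = esssup M (degree M W)"

definition bounded_degree_akernel :: "'a measure \<Rightarrow> ('a \<Rightarrow> 'a \<Rightarrow> real) \<Rightarrow> bool" where
  "bounded_degree_akernel M W \<longleftrightarrow> akernel M W \<and> max_degree M W < \<infinity>"

definition intensity :: "'a measure \<Rightarrow> ('a \<Rightarrow> 'a \<Rightarrow> real) \<Rightarrow> 'a \<Rightarrow> 'a measure" where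
  "intensity M W x = density M (\<lambda>y. ennreal (W x y))"


section \<open>The random rooted tree\<close>

text \<open>Isomorphism classes of finite rooted trees: such a class is determined by the multiset of
  the classes of the subtrees hanging off the root.\<close>

datatype rtree = Node "rtree multiset"

text \<open>The Poisson point process with intensity \<open>L\<close>, for \<open>0 < L(X) < \<infinity>\<close>: a Poisson(\<open>L(X)\<close>) number
  of independent points, each with law \<open>L / L(X)\<close>. An outcome \<open>(n, y)\<close> stands for the points
  \<open>y 0, \<dots>, y (n - 1)\<close>; the further entries of \<open>y\<close> are dummies. If \<open>L(X) = 0\<close> there are no points.
  The value for \<open>L(X) = \<infinity>\<close> is immaterial: for a bounded-degree akernel only a null set of types
  has infinite degree, and almost surely no particle has such a type.\<close>

definition poisson_process :: "'a measure \<Rightarrow> (nat \<times> (nat \<Rightarrow> 'a)) measure" where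
  "poisson_process L =
     (if 0 < emeasure L (space L) \<and> emeasure L (space L) < \<infinity>
      then measure_pmf (poisson_pmf (measure L (space L))) \<Otimes>\<^sub>M
             (\<Pi>\<^sub>M i\<in>UNIV. uniform_measure L (space L))
      else return (count_space UNIV \<Otimes>\<^sub>M (\<Pi>\<^sub>M i\<in>UNIV. L)) (0, \<lambda>i. SOME x. x \<in> space L))"

text \<open>The law of the first \<open>k\<close> generations, types forgotten, of the branching process started from
  one particle of type \<open>x\<close>. In the recursive step the children of the root are the points of a
  Poisson process and, given their types, start independent copies of the process.\<close>

primrec tree_ball_from :: "'a measure \<Rightarrow> ('a \<Rightarrow> 'a \<Rightarrow> real) \<Rightarrow> nat \<Rightarrow> 'a \<Rightarrow> rtree measure" where
  "tree_ball_from M W 0 x = return (count_space UNIV) (Node {#})"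
| "tree_ball_from M W (Suc k) x =
     poisson_process (intensity M W x) \<bind> (\<lambda>(n, y).
       distr (\<Pi>\<^sub>M i\<in>{..<n}. tree_ball_from M W k (y i)) (count_space UNIV)
         (\<lambda>t. Node (image_mset t (mset_set {..<n}))))"

text \<open>The law of the ball of radius \<open>k\<close> around the root; the root has type with law \<open>\<mu>\<close>.\<close>

definition tree_ball :: "'a measure \<Rightarrow> ('a \<Rightarrow> 'a \<Rightarrow> real) \<Rightarrow> nat \<Rightarrow> rtree measure" where
  "tree_ball M W k = M \<bind> tree_ball_from M W k"

definition same_tree_distribution ::
  "'a measure \<Rightarrow> ('a \<Rightarrow> 'a \<Rightarrow> real) \<Rightarrow> 'b measure \<Rightarrow> ('b \<Rightarrow> 'b \<Rightarrow> real) \<Rightarrow> bool" where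
  "same_tree_distribution M U N W \<longleftrightarrow> (\<forall>k. tree_ball M U k = tree_ball N W k)"


section \<open>Spaces of measures\<close>

definition measures_le :: "real \<Rightarrow> 'a topology \<Rightarrow> 'a measure set" where
  "measures_le c X =
     {\<alpha>. sets \<alpha> = sets (borel_of X) \<and> emeasure \<alpha> (space \<alpha>) \<le> ennreal c}"

text \<open>The topology of weak convergence, as initial topology of the maps \<open>\<alpha> \<mapsto> \<integral>f d\<alpha>\<close>.\<close>

definition weak_topology :: "real \<Rightarrow> 'a topology \<Rightarrow> 'a measure topology" where
  "weak_topology c X = topology_generated_by
     {{\<alpha> \<in> measures_le c X. (\<integral>x. f x \<partial>\<alpha>) \<in> V} | f V.
        continuous_map X euclideanreal f \<and> bounded (f ` topspace X) \<and> open V}"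

text \<open>HOL has no sequence of types each of which depends on the previous one. So the points of all
  the spaces \<open>L\<^sub>k\<close> are coded as elements of one type of cardinality continuum. \<open>encode c X\<close> is
  an arbitrary injection on \<open>\<M>\<^sub>\<le>\<^sub>c(X)\<close>; one exists whenever \<open>X\<close> is second countable, in particular
  if \<open>X\<close> is compact metrizable (see \<open>inj_on_encode\<close>). The topology of the coded space is the weak
  topology transported along the injection, so no property of the injection matters.\<close>

type_synonym point = "nat \<Rightarrow> real"

definition encode :: "real \<Rightarrow> 'a topology \<Rightarrow> 'a measure \<Rightarrow> point" where
  "encode c X = (SOME e. inj_on e (measures_le c X))"

lemma inj_on_encode:
  fixes X :: "'a topology"
  assumes "second_countable X"
  shows "inj_on (encode c X) (measures_le c X)"
proof -
  obtain B where B: "countable B" "\<And>V. V \<in> B \<Longrightarrow> openin X V"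
    "\<And>U x. openin X U \<Longrightarrow> x \<in> U \<Longrightarrow> \<exists>V\<in>B. x \<in> V \<and> V \<subseteq> U"
    using assms unfolding second_countable_def by metis
  define G where "G = (\<lambda>F. topspace X \<inter> \<Inter>F) ` {F. F \<subseteq> B \<and> finite F}"
  have cG: "countable G" unfolding G_def using countable_Collect_finite_subset[OF B(1)] by (simp add: conj_commute)
  have neG: "topspace X \<in> G" unfolding G_def by (force intro: image_eqI[of _ _ "{}"])
  have sub: "B \<subseteq> G"
  proof
    fix V assume "V \<in> B"
    then have "V = topspace X \<inter> \<Inter>{V}" using B(2) openin_subset by fastforce
    then show "V \<in> G" unfolding G_def using \<open>V \<in> B\<close> by blast
  qed
  have GO: "openin X V" if V: "V \<in> G" for V
  proof -
    obtain F where F: "F \<subseteq> B" "finite F" "V = topspace X \<inter> \<Inter>F" using V unfolding G_def by auto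
    have "openin X (topspace X \<inter> \<Inter>F)" using F(2,1)
    proof (induction F rule: finite_induct)
      case (insert W F)
      have "topspace X \<inter> \<Inter>(insert W F) = W \<inter> (topspace X \<inter> \<Inter>F)" by auto
      then show ?case using insert B(2) by auto
    qed simp
    then show ?thesis using F by simp
  qed
  have GP: "G \<subseteq> Pow (topspace X)" using GO openin_subset by blast
  have stable: "Int_stable G"
  proof (rule Int_stableI)
    fix a b assume "a \<in> G" "b \<in> G"
    then obtain F H where FH: "F \<subseteq> B" "finite F" "a = topspace X \<inter> \<Inter>F"
      "H \<subseteq> B" "finite H" "b = topspace X \<inter> \<Inter>H" unfolding G_def by auto
    then have "a \<inter> b = topspace X \<inter> \<Inter>(F \<union> H)" by auto
    moreover have "F \<union> H \<in> {F. F \<subseteq> B \<and> finite F}" using FH by auto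
    ultimately show "a \<inter> b \<in> G" unfolding G_def by (rule image_eqI)
  qed
  have OP: "{S. openin X S} \<subseteq> Pow (topspace X)" using openin_subset by blast
  have sets_eq: "sets (borel_of X) = sigma_sets (topspace X) G"
    unfolding borel_of_def sets_measure_of[OF OP]
  proof (rule sigma_sets_eqI)
    fix U assume "U \<in> {S. openin X S}"
    then have U: "openin X U" by simp
    have "U = \<Union>{V \<in> B. V \<subseteq> U}" using B(3)[OF U] by blast
    moreover have "\<Union>{V \<in> B. V \<subseteq> U} \<in> sigma_sets (topspace X) G"
      using B(1) sub GP
      by (intro sigma_algebra.countable_Union[OF sigma_algebra_sigma_sets]) (auto intro: countable_subset)
    ultimately show "U \<in> sigma_sets (topspace X) G" by simp
  next
    fix V assume "V \<in> G" then show "V \<in> sigma_sets (topspace X) {S. openin X S}"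
      using GO by auto
  qed
  define e :: "'a measure \<Rightarrow> point" where "e = (\<lambda>\<alpha> n. measure \<alpha> (from_nat_into G n))"
  have "inj_on e (measures_le c X)"
  proof (rule inj_onI)
    fix \<alpha> \<beta> assume ab: "\<alpha> \<in> measures_le c X" "\<beta> \<in> measures_le c X" "e \<alpha> = e \<beta>"
    have fin: "emeasure \<alpha> (space \<alpha>) \<noteq> \<infinity>" "emeasure \<beta> (space \<beta>) \<noteq> \<infinity>"
      using ab unfolding measures_le_def by (auto simp: top_unique)
    interpret a: finite_measure \<alpha> by (rule finite_measureI) (use fin in auto)
    interpret b: finite_measure \<beta> by (rule finite_measureI) (use fin in auto)
    have s: "sets \<alpha> = sigma_sets (topspace X) G" "sets \<beta> = sigma_sets (topspace X) G"
      using ab sets_eq unfolding measures_le_def by auto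
    have "emeasure \<alpha> V = emeasure \<beta> V" if V: "V \<in> G" for V
    proof -
      obtain n where "V = from_nat_into G n" using from_nat_into_surj[OF cG V] by metis
      then have "measure \<alpha> V = measure \<beta> V" using fun_cong[OF ab(3), of n] by (simp add: e_def)
      then show ?thesis by (simp add: a.emeasure_eq_measure b.emeasure_eq_measure)
    qed
    then show "\<alpha> = \<beta>"
      using neG fin by (intro measure_eqI_generator_eq[OF stable GP _ s, where A = "\<lambda>_. topspace X"])
        (auto simp: a.emeasure_eq_measure)
  qed
  then show ?thesis
    unfolding encode_def by (rule someI[where P = "\<lambda>e. inj_on e (measures_le c X)"])
qed

definition decode :: "real \<Rightarrow> 'a topology \<Rightarrow> point \<Rightarrow> 'a measure" where
  "decode c X = inv_into (measures_le c X) (encode c X)"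

definition coded_measures :: "real \<Rightarrow> 'a topology \<Rightarrow> point topology" where
  "coded_measures c X =
     pullback_topology (encode c X ` measures_le c X) (decode c X) (weak_topology c X)"


section \<open>Fractional isomorphism\<close>

definition star :: point where "star = (\<lambda>_. 0)"

text \<open>\<open>L_space c k\<close> and \<open>P_space c k\<close> are \<open>L\<^sub>k\<^sup>c\<close> and \<open>\<bbbP>\<^sub>k\<^sup>c\<close>. Elements of \<open>\<bbbP>\<^sub>k\<^sup>c\<close> are functions that
  are \<open>undefined\<close> outside \<open>{..k}\<close>, so the projection \<open>p\<^sup>c\<^sub>h\<^sub>,\<^sub>k\<close> is the restriction to \<open>{..h}\<close>.\<close>

lemma product_topology_cong [fundef_cong]:
  assumes "I = J" "\<And>i. i \<in> J \<Longrightarrow> T i = S i"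
  shows "product_topology T I = product_topology S J"
proof -
  have "openin (product_topology T I) U = openin (product_topology S J) U" for U
    unfolding openin_product_topology_alt using assms by (smt (verit, best) Collect_cong)
  then show ?thesis by (simp add: topology_eq)
qed

function L_space :: "real \<Rightarrow> nat \<Rightarrow> point topology"
  and P_space :: "real \<Rightarrow> nat \<Rightarrow> (nat \<Rightarrow> point) topology" where
  "L_space c 0 = discrete_topology {star}"
| "L_space c (Suc k) = coded_measures c (P_space c k)"
| "P_space c k = subtopology (product_topology (\<lambda>i. L_space c i) {..k})
     {\<alpha>. \<forall>l\<in>{1..<k}. decode c (P_space c (l - 1)) (\<alpha> l) =
           distr (decode c (P_space c l) (\<alpha> (Suc l))) (borel_of (P_space c (l - 1)))
             (\<lambda>\<beta>. restrict \<beta> {..l - 1})}"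
  by pat_completeness auto
termination
  by (relation "Wellfounded.measure (\<lambda>s. case s of Inl (c, k) \<Rightarrow> 2 * k | Inr (c, k) \<Rightarrow> 2 * k + 1)")
     auto

definition P_limit :: "real \<Rightarrow> (nat \<Rightarrow> point) topology" where
  "P_limit c = subtopology (product_topology (\<lambda>i. L_space c i) UNIV)
     {\<alpha>. \<forall>k\<ge>1. decode c (P_space c (k - 1)) (\<alpha> k) =
           distr (decode c (P_space c k) (\<alpha> (Suc k))) (borel_of (P_space c (k - 1)))
             (\<lambda>\<beta>. restrict \<beta> {..k - 1})}"

text \<open>The modification of \<open>W\<close> that makes all degrees at most \<open>c\<close>; if \<open>max_degree M W \<le> c\<close>, it
  changes \<open>W x\<close> only for a null set of \<open>x\<close>.\<close>

definition cap_degree ::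
  "real \<Rightarrow> 'a measure \<Rightarrow> ('a \<Rightarrow> 'a \<Rightarrow> real) \<Rightarrow> 'a \<Rightarrow> 'a \<Rightarrow> real" where
  "cap_degree c M W x y = (if degree M W x \<le> ennreal c then W x y else 0)"

text \<open>\<open>i_map c M W k\<close> is \<open>i\<^sub>W\<^sub>,\<^sub>k\<close>, and \<open>i_limit c M W\<close> is \<open>i\<^sub>W\<close>.\<close>

primrec i_map ::
  "real \<Rightarrow> 'a measure \<Rightarrow> ('a \<Rightarrow> 'a \<Rightarrow> real) \<Rightarrow> nat \<Rightarrow> 'a \<Rightarrow> (nat \<Rightarrow> point)" where
  "i_map c M W 0 x = restrict (\<lambda>_. star) {..0}"
| "i_map c M W (Suc k) x = (i_map c M W k x)
     (Suc k := encode c (P_space c k)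
        (distr (intensity M W x) (borel_of (P_space c k)) (i_map c M W k)))"

definition i_limit ::
  "real \<Rightarrow> 'a measure \<Rightarrow> ('a \<Rightarrow> 'a \<Rightarrow> real) \<Rightarrow> 'a \<Rightarrow> (nat \<Rightarrow> point)" where
  "i_limit c M W x = (\<lambda>k. i_map c M W k x k)"

definition nu :: "real \<Rightarrow> 'a measure \<Rightarrow> ('a \<Rightarrow> 'a \<Rightarrow> real) \<Rightarrow> (nat \<Rightarrow> point) measure" where
  "nu c M W = distr M (borel_of (P_limit c)) (i_limit c M (cap_degree c M W))"

definition fractionally_isomorphic ::
  "real \<Rightarrow> 'a measure \<Rightarrow> ('a \<Rightarrow> 'a \<Rightarrow> real) \<Rightarrow> 'b measure \<Rightarrow> ('b \<Rightarrow> 'b \<Rightarrow> real) \<Rightarrow> bool" where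
  "fractionally_isomorphic c M U N W \<longleftrightarrow> nu c M U = nu c N W"

end

theory Submission
  imports Defs
begin

text \<open>Let \<open>p\<^sub>k(x)\<close> be the law of the first \<open>k\<close> generations started from a particle of type \<open>x\<close>. By the
  marking theorem the numbers of children of the root whose subtrees have shape \<open>S\<close> are independent
  Poisson variables with means \<open>\<lambda>\<^sub>S(x) = \<integral> p\<^sub>k(y){S} W(x,y) d\<mu>(y)\<close>, so \<open>p\<^sub>k\<^sub>+\<^sub>1(x)\<close> is an explicit function of
  these means. Hence \<open>p\<^sub>k(x)\<close> depends only on \<open>i\<^sub>W\<^sub>,\<^sub>k(x)\<close>, and \<open>\<nu>\<^sub>W\<close> determines the law of the tree.

  For the converse, the mixture over \<open>x\<close> of these Poisson laws yields all moments of the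
  bounded family \<open>(\<lambda>\<^sub>S)\<^sub>S\<close>, weighted with the density \<open>exp (- deg x)\<close>. By a multiplicative class argument
  they determine the mixing measure on the \<open>\<sigma>\<close>-algebra generated by the \<open>\<lambda>\<^sub>S\<close>, and by induction on \<open>k\<close>
  this is the Borel \<open>\<sigma>\<close>-algebra of \<open>\<bbbP>\<^sub>k\<close>. Compactness of the spaces \<open>\<bbbP>\<^sub>k\<close> is not needed: it suffices that their
  topologies are generated by countably many real functions.\<close>

section \<open>Topologies generated by countably many real functions\<close>

text \<open>The inductive step of the converse needs that the means \<open>\<lambda>\<^sub>S\<close>
  generate the Borel sets of the next space; uniqueness of a measure with given tree probabilities
  would only show that they separate points. So the induction carries a parametric statement: if the
  tree probabilities of a kernel are measurable in the parameter, for whatever sigma-algebra, then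
  so is the kernel. For the kernel coded by a point of
  \<open>\<bbbP>\<^sub>k\<^sub>+\<^sub>1\<close> and a sigma-algebra making all
  \<open>\<lambda>\<^sub>S\<close> measurable this is generation; for the trivial sigma-algebra it
  is uniqueness. The weight \<open>exp (- deg x)\<close> arises because the exponents of the
  independent Poisson weights sum to the mean number of children. The rest of a tree probability is
  a positive constant times a monomial in the \<open>\<lambda>\<^sub>S\<close>, and monomials are
  closed under products. Being positive, the weight can be divided out at the end. Countably many
  generating functions make \<open>encode\<close> injective and let measurability be tested
  coordinate by coordinate; the property passes to subspaces, countable products and spaces of
  measures, hence up the whole tower.\<close>

declare L_space.simps [simp del] P_space.simps [simp del]

text \<open>The map \<open>\<phi>\<close> need not be injective. Every open set is the trace on the
  carrier of the preimage of an open set of real sequences, which reduces topology and measurability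
  to the coordinates of \<open>\<phi>\<close>.\<close>

definition real_generated :: "'a topology \<Rightarrow> bool" where
  "real_generated X \<longleftrightarrow> (\<exists>\<phi> :: 'a \<Rightarrow> nat \<Rightarrow> real. X = pullback_topology (topspace X) \<phi> euclidean)"

lemma real_generatedI:
  fixes \<phi> :: "'a \<Rightarrow> nat \<Rightarrow> real"
  assumes "X = pullback_topology S \<phi> euclidean"
  shows "real_generated X"
  unfolding real_generated_def
  using assms topspace_pullback_topology[of S \<phi> euclidean] by auto

lemma space_borel_of [simp]: "space (borel_of X) = topspace X"
  unfolding borel_of_def by (simp add: space_measure_of_conv)

lemma sets_borel_of: "sets (borel_of X) = sigma_sets (topspace X) {S. openin X S}"
  unfolding borel_of_def by (rule sets_measure_of) (use openin_subset in blast)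

lemma openin_sets_borel_of: "openin X S \<Longrightarrow> S \<in> sets (borel_of X)"
  by (auto simp: sets_borel_of)

lemma measurable_borel_ofI:
  assumes "f \<in> space M \<rightarrow> topspace Y" "\<And>V. openin Y V \<Longrightarrow> f -` V \<inter> space M \<in> sets M"
  shows "f \<in> measurable M (borel_of Y)"
  unfolding borel_of_def
  by (rule measurable_measure_of) (use assms openin_subset in blast)+

lemma continuous_map_measurable:
  assumes "continuous_map X Y f"
  shows "f \<in> measurable (borel_of X) (borel_of Y)"
proof (rule measurable_borel_ofI)
  show "f \<in> space (borel_of X) \<rightarrow> topspace Y"
    using assms by (auto simp: continuous_map_def)
  fix V assume "openin Y V"
  then have "openin X (f -` V \<inter> topspace X)"
    using assms unfolding continuous_map_alt by auto
  then show "f -` V \<inter> space (borel_of X) \<in> sets (borel_of X)"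
    by (auto intro: openin_sets_borel_of)
qed

lemma borel_of_euclidean: "borel_of (euclidean :: 'a::topological_space topology) = borel"
  by (simp add: borel_of_def borel_def)

lemma continuous_map_borel_measurable:
  fixes f :: "'a \<Rightarrow> 'b::topological_space"
  assumes "continuous_map X euclidean f"
  shows "f \<in> borel_measurable (borel_of X)"
  using continuous_map_measurable[OF assms] by (simp add: borel_of_euclidean)

lemma continuous_map_into_pointwise:
  fixes f :: "'a \<Rightarrow> nat \<Rightarrow> real"
  shows "continuous_map X euclidean f \<longleftrightarrow> (\<forall>n. continuous_map X euclideanreal (\<lambda>x. f x n))"
  by (simp add: euclidean_product_topology[symmetric] continuous_map_componentwise_UNIV)

lemma continuous_map_pullback_coordinate:
  fixes \<phi> :: "'a \<Rightarrow> nat \<Rightarrow> real"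
  assumes "X = pullback_topology S \<phi> euclidean"
  shows "continuous_map X euclideanreal (\<lambda>x. \<phi> x n)"
proof -
  have "continuous_map X euclidean (id \<circ> \<phi>)"
    unfolding assms by (intro continuous_map_pullback) auto
  then show ?thesis by (simp add: continuous_map_into_pointwise)
qed

text \<open>The Borel sets of the sequence space are generated by the coordinates, so measurable
  coordinates make \<open>\<lambda>x. \<phi> (f x)\<close> measurable, and the open sets of
  \<open>X\<close> are pulled back from open sets of sequences.\<close>

lemma measurable_borel_of_pullback:
  fixes \<phi> :: "'a \<Rightarrow> nat \<Rightarrow> real"
  assumes X: "X = pullback_topology S \<phi> euclidean"
    and f: "f \<in> space M \<rightarrow> S" "\<And>n. (\<lambda>x. \<phi> (f x) n) \<in> borel_measurable M"
  shows "f \<in> measurable M (borel_of X)"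
proof (rule measurable_borel_ofI)
  show "f \<in> space M \<rightarrow> topspace X" using f(1) by (simp add: X topspace_pullback_topology)
  fix V assume "openin X V"
  then obtain G where G: "open G" "V = \<phi> -` G \<inter> S"
    by (auto simp: X openin_pullback_topology)
  have [measurable]: "(\<lambda>x. \<phi> (f x)) \<in> borel_measurable M"
    by (rule measurable_coordinatewise_then_product) (use f in auto)
  have "f -` V \<inter> space M = (\<lambda>x. \<phi> (f x)) -` G \<inter> space M" using f(1) G by auto
  then show "f -` V \<inter> space M \<in> sets M" using G by simp
qed

text \<open>The first hypothesis makes the pullback topology coarser than \<open>X\<close>, the
  second makes it finer.\<close>

lemma pullback_topology_eqI:
  fixes \<phi> :: "'a \<Rightarrow> nat \<Rightarrow> real"
  assumes "\<And>n. continuous_map X euclideanreal (\<lambda>x. \<phi> x n)"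
    and "continuous_map (pullback_topology (topspace X) \<phi> euclidean) X id"
  shows "X = pullback_topology (topspace X) \<phi> euclidean" (is "X = ?Y")
proof -
  have tY: "topspace ?Y = topspace X" by (simp add: topspace_pullback_topology)
  have c: "continuous_map X euclidean (\<phi> \<circ> id)" using assms(1) by (simp add: continuous_map_into_pointwise)
  have "continuous_map X ?Y id" by (rule continuous_map_pullback'[OF c]) auto
  then have *: "openin ?Y U \<Longrightarrow> openin X (U \<inter> topspace X)" for U
    unfolding continuous_map_alt by auto
  from assms(2) tY have **: "openin X U \<Longrightarrow> openin ?Y (U \<inter> topspace X)" for U
    unfolding continuous_map_alt by auto
  have "openin X U = openin ?Y U" for U
  proof
    assume U: "openin X U"
    then have "U \<inter> topspace X = U" using openin_subset by blast
    with **[OF U] show "openin ?Y U" by simp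
  next
    assume U: "openin ?Y U"
    then have "U \<inter> topspace X = U" using openin_subset tY by blast
    with *[OF U] show "openin X U" by simp
  qed
  then show ?thesis by (simp add: topology_eq)
qed

lemma real_generated_subtopology:
  assumes "real_generated X" shows "real_generated (subtopology X C)"
proof -
  obtain \<phi> :: "'a \<Rightarrow> nat \<Rightarrow> real" where \<phi>: "X = pullback_topology (topspace X) \<phi> euclidean"
    using assms unfolding real_generated_def by blast
  have o: "openin X S \<longleftrightarrow> (\<exists>U. openin euclidean U \<and> S = \<phi> -` U \<inter> topspace X)" for S
    by (subst \<phi>) (rule openin_pullback_topology)
  have "subtopology X C = pullback_topology (topspace X \<inter> C) \<phi> euclidean"
    unfolding topology_eq openin_subtopology openin_pullback_topology o
    by (auto simp: Int_assoc)
  then show ?thesis by (rule real_generatedI)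
qed

text \<open>Merges the coordinate sequences of all factors into one sequence through the pairing of
  naturals; pairs whose first entry lies outside \<open>I\<close> give the constant 0.\<close>

definition product_coordinates :: "nat set \<Rightarrow> (nat \<Rightarrow> 'a \<Rightarrow> nat \<Rightarrow> real) \<Rightarrow> (nat \<Rightarrow> 'a) \<Rightarrow> nat \<Rightarrow> real" where
  "product_coordinates I \<phi> \<alpha> n = (case prod_decode n of (i, m) \<Rightarrow> if i \<in> I then \<phi> i (\<alpha> i) m else 0)"

lemma product_topology_pullback:
  fixes L :: "nat \<Rightarrow> 'a topology" and \<phi> :: "nat \<Rightarrow> 'a \<Rightarrow> nat \<Rightarrow> real"
  assumes \<phi>: "\<And>i. i \<in> I \<Longrightarrow> L i = pullback_topology (topspace (L i)) (\<phi> i) euclidean"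
  shows "product_topology L I =
    pullback_topology (topspace (product_topology L I)) (product_coordinates I \<phi>) euclidean"
    (is "?X = ?Y")
proof (rule pullback_topology_eqI)
  have tY: "topspace ?Y = topspace ?X" by (simp add: topspace_pullback_topology)
  show "continuous_map ?X euclideanreal (\<lambda>\<alpha>. product_coordinates I \<phi> \<alpha> n)" for n
  proof (cases "prod_decode n")
    case (Pair i m)
    show ?thesis
    proof (cases "i \<in> I")
      case True
      have "continuous_map ?X euclideanreal ((\<lambda>x. \<phi> i x m) \<circ> (\<lambda>\<alpha>. \<alpha> i))"
        by (rule continuous_map_compose[OF continuous_map_product_projection[OF True]])
          (rule continuous_map_pullback_coordinate[OF \<phi>[OF True]])
      then show ?thesis using True Pair by (simp add: product_coordinates_def o_def)
    qed (simp add: product_coordinates_def Pair)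
  qed
  show "continuous_map ?Y ?X id"
    unfolding continuous_map_componentwise
  proof (intro conjI ballI)
    show "id ` topspace ?Y \<subseteq> extensional I" unfolding tY by (auto simp: PiE_def)
    fix i assume i: "i \<in> I"
    have "continuous_map ?Y euclideanreal (\<lambda>\<alpha>. \<phi> i (\<alpha> i) m)" for m
    proof -
      have "(\<lambda>\<alpha>. \<phi> i (\<alpha> i) m) = (\<lambda>\<alpha>. product_coordinates I \<phi> \<alpha> (prod_encode (i, m)))"
        using i by (simp add: product_coordinates_def)
      then show ?thesis using continuous_map_pullback_coordinate[OF refl] by metis
    qed
    then have "continuous_map ?Y euclidean (\<phi> i \<circ> (\<lambda>\<alpha>. \<alpha> i))"
      by (simp add: continuous_map_into_pointwise)
    moreover have "topspace ?Y \<subseteq> (\<lambda>\<alpha>. \<alpha> i) -` topspace (L i)" unfolding tY using i by auto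
    ultimately have "continuous_map ?Y (pullback_topology (topspace (L i)) (\<phi> i) euclidean) (\<lambda>\<alpha>. \<alpha> i)"
      by (rule continuous_map_pullback')
    then show "continuous_map ?Y (L i) (\<lambda>\<alpha>. id \<alpha> i)" using \<phi>[OF i] by simp
  qed
qed

lemma real_generated_product:
  fixes L :: "nat \<Rightarrow> 'a topology"
  assumes "\<And>i. i \<in> I \<Longrightarrow> real_generated (L i)"
  shows "real_generated (product_topology L I)"
proof -
  obtain \<phi> :: "nat \<Rightarrow> 'a \<Rightarrow> nat \<Rightarrow> real"
    where \<phi>: "\<And>i. i \<in> I \<Longrightarrow> L i = pullback_topology (topspace (L i)) (\<phi> i) euclidean"
    using assms unfolding real_generated_def by metis
  show ?thesis by (rule real_generatedI[OF product_topology_pullback[OF \<phi>]])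
qed

lemma real_generated_discrete_singleton: "real_generated (discrete_topology {a})"
proof (rule real_generatedI)
  show "discrete_topology {a} = pullback_topology {a} (\<lambda>_. (\<lambda>_. 0) :: nat \<Rightarrow> real) euclidean"
    unfolding topology_eq openin_pullback_topology
  proof
    fix S show "openin (discrete_topology {a}) S = (\<exists>U. openin euclidean U \<and> S = (\<lambda>_. (\<lambda>_. 0) :: nat \<Rightarrow> real) -` U \<inter> {a})"
      by (auto intro: exI[of _ "{}"] exI[of _ UNIV] simp: subset_singleton_iff)
  qed
qed

text \<open>Borel and product sigma-algebra agree for countable products of second countable spaces;
  here this follows from the merged coordinates. The criterion serves \<open>P_space\<close> and
  \<open>P_limit\<close> alike.\<close>

lemma measurable_borel_of_product_iff:
  fixes L :: "nat \<Rightarrow> 'a topology"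
  assumes "\<And>i. i \<in> I \<Longrightarrow> real_generated (L i)"
    and X: "X = subtopology (product_topology L I) C"
  shows "f \<in> measurable M (borel_of X) \<longleftrightarrow>
    (\<forall>x\<in>space M. f x \<in> topspace X) \<and> (\<forall>i\<in>I. (\<lambda>x. f x i) \<in> measurable M (borel_of (L i)))"
    (is "?l \<longleftrightarrow> ?r")
proof
  assume f: ?l
  have "(\<lambda>x. f x i) \<in> measurable M (borel_of (L i))" if "i \<in> I" for i
  proof -
    have "(\<lambda>\<alpha>. \<alpha> i) \<in> measurable (borel_of X) (borel_of (L i))"
      unfolding X by (intro continuous_map_measurable continuous_map_from_subtopology continuous_map_product_projection that)
    from measurable_compose[OF f this] show ?thesis .
  qed
  then show ?r using measurable_space[OF f] by auto
next
  assume r: ?r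
  obtain \<phi> :: "nat \<Rightarrow> 'a \<Rightarrow> nat \<Rightarrow> real"
    where \<phi>: "\<And>i. i \<in> I \<Longrightarrow> L i = pullback_topology (topspace (L i)) (\<phi> i) euclidean"
    using assms unfolding real_generated_def by metis
  have "(\<lambda>x. product_coordinates I \<phi> (f x) n) \<in> borel_measurable M" for n
  proof (cases "prod_decode n")
    case (Pair i m)
    show ?thesis
    proof (cases "i \<in> I")
      case True
      have "(\<lambda>y. \<phi> i y m) \<in> borel_measurable (borel_of (L i))"
        by (intro continuous_map_borel_measurable continuous_map_pullback_coordinate[OF \<phi>[OF True]])
      moreover have "(\<lambda>x. f x i) \<in> measurable M (borel_of (L i))" using r True by blast
      ultimately have "(\<lambda>x. \<phi> i (f x i) m) \<in> borel_measurable M" by (rule measurable_compose[rotated])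
      with True show ?thesis by (simp add: product_coordinates_def Pair)
    qed (simp add: product_coordinates_def Pair)
  qed
  then have f: "f \<in> measurable M (borel_of (product_topology L I))"
    using r by (intro measurable_borel_of_pullback[OF product_topology_pullback[OF \<phi>]]) (auto simp: X)
  show ?l
  proof (rule measurable_borel_ofI)
    show "f \<in> space M \<rightarrow> topspace X" using r by auto
    fix V assume "openin X V"
    then obtain G where G: "openin (product_topology L I) G" "V = G \<inter> C"
      unfolding X openin_subtopology by auto
    have "f -` V \<inter> space M = f -` G \<inter> space M" using G(2) r by (auto simp: X)
    then show "f -` V \<inter> space M \<in> sets M"
      using measurable_sets[OF f openin_sets_borel_of[OF G(1)]] by simp
  qed
qed

lemma openin_pullback_iff:
  assumes "X = pullback_topology (topspace X) \<phi> euclidean"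
  shows "openin X S \<longleftrightarrow> (\<exists>U. open U \<and> S = \<phi> -` U \<inter> topspace X)"
  by (subst assms) (simp add: openin_pullback_topology)

lemma continuous_map_pullback_compose:
  assumes X: "X = pullback_topology S \<phi> euclidean" and g: "continuous_on UNIV g"
  shows "continuous_map X euclidean (\<lambda>x. g (\<phi> x))"
  using continuous_map_pullback[of euclidean euclidean g S \<phi>] g unfolding X by (simp add: o_def)

text \<open>This is the premise of \<open>inj_on_encode\<close>: measures on such a space are coded
  faithfully.\<close>

lemma real_generated_second_countable:
  assumes "real_generated X" shows "second_countable X"
proof -
  obtain \<phi> :: "'a \<Rightarrow> nat \<Rightarrow> real" where X: "X = pullback_topology (topspace X) \<phi> euclidean"
    using assms unfolding real_generated_def by blast
  note o = openin_pullback_iff[OF X]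
  obtain B :: "(nat \<Rightarrow> real) set set" where B: "countable B" "topological_basis B"
    using ex_countable_basis by auto
  let ?B = "(\<lambda>V. \<phi> -` V \<inter> topspace X) ` B"
  have "\<exists>V\<in>?B. x \<in> V \<and> V \<subseteq> U" if "openin X U" "x \<in> U" for U x
  proof -
    from that obtain G where G: "open G" "U = \<phi> -` G \<inter> topspace X" by (auto simp: o)
    then obtain V where "V \<in> B" "\<phi> x \<in> V" "V \<subseteq> G"
      using topological_basisE[OF B(2) G(1), of "\<phi> x"] \<open>x \<in> U\<close> by auto
    then show ?thesis using G that(2) by auto
  qed
  moreover have "openin X V" if "V \<in> ?B" for V
    using that topological_basis_open[OF B(2)] unfolding o by blast
  moreover have "countable ?B" using B(1) by simp
  ultimately show ?thesis
    unfolding second_countable_def by blast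
qed

section \<open>Finite kernels\<close>

lemma measurable_transfer:
  "(\<And>x. x \<in> space M \<Longrightarrow> f x = g x) \<Longrightarrow> g \<in> measurable M N \<Longrightarrow> f \<in> measurable M N"
  using measurable_cong[of M f g N] by blast

lemma nn_integral_kernel_measurable:
  assumes K: "\<And>\<omega>. \<omega> \<in> space \<Omega> \<Longrightarrow> sets (\<kappa> \<omega>) = sets N"
    and m: "\<And>A. A \<in> sets N \<Longrightarrow> (\<lambda>\<omega>. emeasure (\<kappa> \<omega>) A) \<in> borel_measurable \<Omega>"
    and f: "f \<in> borel_measurable N"
  shows "(\<lambda>\<omega>. \<integral>\<^sup>+ x. f x \<partial>\<kappa> \<omega>) \<in> borel_measurable \<Omega>"
proof -
  have mK: "g \<in> borel_measurable (\<kappa> \<omega>)" if "\<omega> \<in> space \<Omega>" "g \<in> borel_measurable N" for g :: "_ \<Rightarrow> ennreal" and \<omega>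
    using that measurable_cong_sets[OF K refl] by blast
  have sp: "space (\<kappa> \<omega>) = space N" if "\<omega> \<in> space \<Omega>" for \<omega>
    using sets_eq_imp_space_eq[OF K[OF that]] .
  show ?thesis
    using f
  proof induct
    case (cong f g)
    have "(\<integral>\<^sup>+ x. f x \<partial>\<kappa> \<omega>) = (\<integral>\<^sup>+ x. g x \<partial>\<kappa> \<omega>)" if "\<omega> \<in> space \<Omega>" for \<omega>
      using cong(3) sp[OF that] by (intro nn_integral_cong) auto
    from this cong(4) show ?case by (rule measurable_transfer)
  next
    case (set B)
    have "(\<integral>\<^sup>+ x. indicator B x \<partial>\<kappa> \<omega>) = emeasure (\<kappa> \<omega>) B" if "\<omega> \<in> space \<Omega>" for \<omega>
      using set K[OF that] by (intro nn_integral_indicator) auto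
    from this m[OF set] show ?case by (rule measurable_transfer)
  next
    case (mult u c)
    have "(\<integral>\<^sup>+ x. c * u x \<partial>\<kappa> \<omega>) = c * (\<integral>\<^sup>+ x. u x \<partial>\<kappa> \<omega>)" if "\<omega> \<in> space \<Omega>" for \<omega>
      using mK[OF that mult(2)] by (intro nn_integral_cmult)
    from this show ?case by (rule measurable_transfer) (use mult in auto)
  next
    case (add u v)
    have "(\<integral>\<^sup>+ x. v x + u x \<partial>\<kappa> \<omega>) = (\<integral>\<^sup>+ x. v x \<partial>\<kappa> \<omega>) + (\<integral>\<^sup>+ x. u x \<partial>\<kappa> \<omega>)" if "\<omega> \<in> space \<Omega>" for \<omega>
      using mK[OF that add(1)] mK[OF that add(4)] by (intro nn_integral_add)
    from this show ?case by (rule measurable_transfer) (assumption, intro borel_measurable_add add)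
  next
    case (seq F)
    have "(\<integral>\<^sup>+ x. (SUP i. F i) x \<partial>\<kappa> \<omega>) = (SUP i. \<integral>\<^sup>+ x. F i x \<partial>\<kappa> \<omega>)" if "\<omega> \<in> space \<Omega>" for \<omega>
      unfolding SUP_apply using mK[OF that seq(1)] seq by (intro nn_integral_monotone_convergence_SUP)
    from this show ?case by (rule measurable_transfer) (assumption, intro borel_measurable_SUP seq, auto)
  qed
qed

lemma integral_kernel_measurable:
  fixes f :: "'b \<Rightarrow> real"
  assumes K: "\<And>\<omega>. \<omega> \<in> space \<Omega> \<Longrightarrow> sets (\<kappa> \<omega>) = sets N"
    and m: "\<And>A. A \<in> sets N \<Longrightarrow> (\<lambda>\<omega>. emeasure (\<kappa> \<omega>) A) \<in> borel_measurable \<Omega>"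
    and f: "f \<in> borel_measurable N" "\<And>x. x \<in> space N \<Longrightarrow> 0 \<le> f x"
  shows "(\<lambda>\<omega>. \<integral>x. f x \<partial>\<kappa> \<omega>) \<in> borel_measurable \<Omega>"
proof -
  have sp: "space (\<kappa> \<omega>) = space N" if "\<omega> \<in> space \<Omega>" for \<omega>
    using sets_eq_imp_space_eq[OF K[OF that]] .
  \<comment> \<open>The identity also holds when the nonnegative integral is infinite: both sides
    are then 0.\<close>
  have "(\<integral>x. f x \<partial>\<kappa> \<omega>) = enn2real (\<integral>\<^sup>+ x. ennreal (f x) \<partial>\<kappa> \<omega>)" if "\<omega> \<in> space \<Omega>" for \<omega>
    using f measurable_cong_sets[OF K[OF that] refl] sp[OF that]
    by (intro integral_eq_nn_integral) (auto intro!: AE_I2)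
  moreover have "(\<lambda>\<omega>. enn2real (\<integral>\<^sup>+ x. ennreal (f x) \<partial>\<kappa> \<omega>)) \<in> borel_measurable \<Omega>"
    using nn_integral_kernel_measurable[OF K m, of "\<lambda>x. ennreal (f x)"] f by auto
  ultimately show ?thesis by (rule measurable_transfer)
qed

section \<open>The weak topology\<close>

text \<open>Increases with \<open>n\<close> to the indicator of the open set \<open>V\<close>. The
  case \<open>UNIV\<close> is separate because the distance to the empty set is 0 by convention,
  which would yield 0 instead of 1.\<close>

definition open_approx :: "'b::metric_space set \<Rightarrow> nat \<Rightarrow> 'b \<Rightarrow> real" where
  "open_approx V n y = (if V = UNIV then 1 else min 1 (real n * infdist y (- V)))"

lemma continuous_open_approx: "continuous_on UNIV (open_approx V n)"
  unfolding open_approx_def by (cases "V = UNIV") (auto intro!: continuous_intros)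

lemma open_approx_bounds: "0 \<le> open_approx V n y" "open_approx V n y \<le> 1"
  by (auto simp: open_approx_def infdist_nonneg)

lemma open_approx_outside: "y \<notin> V \<Longrightarrow> open_approx V n y = 0"
  by (auto simp: open_approx_def infdist_zero)

lemma open_approx_mono: "m \<le> n \<Longrightarrow> open_approx V m y \<le> open_approx V n y"
  using mult_right_mono[of "real m" "real n" "infdist y (- V)"] infdist_nonneg[of y "- V"]
  by (auto simp: open_approx_def)

lemma open_approx_reaches:
  assumes "open V" "y \<in> V"
  shows "\<exists>n. \<forall>m\<ge>n. open_approx V m y = 1"
proof (cases "V = UNIV")
  case True
  then show ?thesis by (auto simp: open_approx_def)
next
  case False
  then have p: "0 < infdist y (- V)"
    using assms by (intro infdist_pos_not_in_closed) auto
  obtain n where n: "1 / infdist y (- V) < real n" using reals_Archimedean2 by blast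
  have "open_approx V n y = 1" using p n False by (auto simp: open_approx_def field_simps)
  then have "open_approx V m y = 1" if "n \<le> m" for m
    using open_approx_mono[OF that, of V y] open_approx_bounds(2)[of V m y] by simp
  then show ?thesis by blast
qed

lemma open_approx_limit:
  assumes "open V" shows "(\<lambda>n. open_approx V n y) \<longlonglongrightarrow> indicator V y"
proof (cases "y \<in> V")
  case True
  obtain n where "\<forall>m\<ge>n. open_approx V m y = 1" using open_approx_reaches[OF assms True] by blast
  then show ?thesis using True by (intro tendsto_eventually) (auto simp: eventually_sequentially)
qed (simp add: open_approx_outside)

text \<open>Starting from 0 keeps all values nonnegative. Lists over a countable index type are
  countable, so the resulting family is enumerated by \<open>from_nat\<close>.\<close>

primrec list_max :: "('i \<Rightarrow> 'b \<Rightarrow> real) \<Rightarrow> 'i list \<Rightarrow> 'b \<Rightarrow> real" where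
  "list_max d [] y = 0"
| "list_max d (i # L) y = max (d i y) (list_max d L y)"

lemma list_max_le_iff: "list_max d L y \<le> a \<longleftrightarrow> 0 \<le> a \<and> (\<forall>i\<in>set L. d i y \<le> a)"
  by (induction L) auto

lemma continuous_list_max:
  "(\<And>i. continuous_on UNIV (d i)) \<Longrightarrow> continuous_on UNIV (list_max d L)"
  by (induction L) (auto intro!: continuous_intros)

lemma list_max_ge: "0 \<le> list_max d L y" "i \<in> set L \<Longrightarrow> d i y \<le> list_max d L y"
  using list_max_le_iff[of d L y "list_max d L y"] by auto

lemma list_max_bounded:
  assumes "\<And>i. \<exists>b. \<forall>y. d i y \<le> b" shows "\<exists>b. \<forall>y. \<bar>list_max d L y\<bar> \<le> b"
proof -
  have "\<exists>b. \<forall>y. list_max d L y \<le> b"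
  proof (induction L)
    case (Cons i L)
    obtain b where "\<forall>y. list_max d L y \<le> b" using Cons by blast
    moreover obtain b' where "\<forall>y. d i y \<le> b'" using assms by blast
    ultimately have "\<forall>y. list_max d (i # L) y \<le> max b' b" by (simp add: max.coboundedI1 max.coboundedI2)
    then show ?case ..
  qed auto
  then show ?thesis using list_max_ge(1)[of d L] by (metis abs_of_nonneg)
qed

section \<open>Bounded measures and integrals in the weak topology\<close>

lemma measures_le_finite:
  assumes "\<alpha> \<in> measures_le c X" shows "finite_measure \<alpha>"
  using assms unfolding measures_le_def
  by (intro finite_measureI) (auto simp: top_unique)

lemma measures_leD:
  assumes "\<alpha> \<in> measures_le c X"
  shows "sets \<alpha> = sets (borel_of X)" "space \<alpha> = topspace X" "emeasure \<alpha> (space \<alpha>) \<le> ennreal c"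
proof -
  show s: "sets \<alpha> = sets (borel_of X)" using assms by (simp add: measures_le_def)
  show "space \<alpha> = topspace X" using sets_eq_imp_space_eq[OF s] by simp
  show "emeasure \<alpha> (space \<alpha>) \<le> ennreal c" using assms by (simp add: measures_le_def)
qed

lemma measures_le_integrable:
  fixes f :: "'a \<Rightarrow> real"
  assumes "\<alpha> \<in> measures_le c X" "f \<in> borel_measurable (borel_of X)"
    and "\<And>x. x \<in> topspace X \<Longrightarrow> \<bar>f x\<bar> \<le> b"
  shows "integrable \<alpha> f"
proof -
  interpret finite_measure \<alpha> by (rule measures_le_finite[OF assms(1)])
  show ?thesis
    using assms(2,3) measures_leD(2)[OF assms(1)]
    by (intro integrable_const_bound[of _ b])
      (auto intro!: AE_I2 simp: measurable_cong_sets[OF measures_leD(1)[OF assms(1)] refl])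
qed

lemma topspace_weak_topology [simp]: "topspace (weak_topology c X) = measures_le c X"
proof -
  have "measures_le c X \<in> {{\<alpha> \<in> measures_le c X. (\<integral>x. f x \<partial>\<alpha>) \<in> V} | f V.
        continuous_map X euclideanreal f \<and> bounded (f ` topspace X) \<and> open V}"
    by (intro CollectI exI[of _ "\<lambda>_. 0"] exI[of _ UNIV]) (auto simp: image_constant_conv)
  then show ?thesis unfolding weak_topology_def topology_generated_by_topspace
    by (intro equalityI Union_least Union_upper) blast+
qed

lemma continuous_map_weak_integral:
  assumes "continuous_map X euclideanreal f" "bounded (f ` topspace X)"
  shows "continuous_map (weak_topology c X) euclideanreal (\<lambda>\<alpha>. \<integral>x. f x \<partial>\<alpha>)"
  unfolding continuous_map_alt
proof (intro conjI strip)
  fix V :: "real set" assume "openin euclideanreal V"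
  then have "openin (weak_topology c X) {\<alpha> \<in> measures_le c X. (\<integral>x. f x \<partial>\<alpha>) \<in> V}"
    unfolding weak_topology_def using assms by (intro topology_generated_by_Basis) auto
  then show "openin (weak_topology c X) ((\<lambda>\<alpha>. \<integral>x. f x \<partial>\<alpha>) -` V \<inter> topspace (weak_topology c X))"
    by (rule back_subst[of "openin _"]) auto
qed auto

text \<open>A plateau of rational height \<open>q\<close> over the basic open set
  \<open>G v\<close>, approximated from inside at level \<open>n\<close>. Negative heights do no
  harm, since \<open>list_max\<close> cuts off at 0.\<close>

definition weak_test :: "(nat \<Rightarrow> 'b::metric_space set) \<Rightarrow> rat \<times> nat \<times> nat \<Rightarrow> 'b \<Rightarrow> real" where
  "weak_test G = (\<lambda>(q, v, n) y. of_rat q * open_approx (G v) n y)"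

text \<open>A nonnegative continuous function is an increasing limit of finite maxima of countably many
  test functions, so its integral is lower semicontinuous for the topology these maxima induce.\<close>

lemma increasing_test_functions:
  fixes \<phi> :: "'a \<Rightarrow> nat \<Rightarrow> real" and f :: "'a \<Rightarrow> real"
  assumes X: "X = pullback_topology (topspace X) \<phi> euclidean"
    and G: "topological_basis (range G)"
    and f: "continuous_map X euclideanreal f" "\<And>x. x \<in> topspace X \<Longrightarrow> 0 \<le> f x"
  obtains L :: "nat \<Rightarrow> (rat \<times> nat \<times> nat) list" where
    "\<And>x n. x \<in> topspace X \<Longrightarrow> list_max (weak_test G) (L n) (\<phi> x) \<le> f x"
    "\<And>x. x \<in> topspace X \<Longrightarrow> (\<lambda>n. list_max (weak_test G) (L n) (\<phi> x)) \<longlonglongrightarrow> f x"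
proof -
  define J where "J = {j. \<forall>x\<in>topspace X. weak_test G j (\<phi> x) \<le> f x}"
  define L :: "nat \<Rightarrow> (rat \<times> nat \<times> nat) list"
    where "L n = filter (\<lambda>j. j \<in> J) (map from_nat [0..<n])" for n
  have le: "list_max (weak_test G) (L n) (\<phi> x) \<le> f x" if "x \<in> topspace X" for x n
    using that f(2) by (auto simp: list_max_le_iff L_def J_def)
  moreover have "(\<lambda>n. list_max (weak_test G) (L n) (\<phi> x)) \<longlonglongrightarrow> f x" if x: "x \<in> topspace X" for x
  proof (rule order_tendstoI)
    fix a assume "f x < a"
    then show "eventually (\<lambda>n. list_max (weak_test G) (L n) (\<phi> x) < a) sequentially"
      using le[OF x] by (intro always_eventually allI) (rule order.strict_trans1)
  next
    fix a assume a: "a < f x"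
    show "eventually (\<lambda>n. a < list_max (weak_test G) (L n) (\<phi> x)) sequentially"
    proof (cases "a < 0")
      case True
      then have "a < list_max (weak_test G) (L n) (\<phi> x)" for n
        using list_max_ge(1)[of "weak_test G" "L n" "\<phi> x"] by linarith
      then show ?thesis by (intro always_eventually allI)
    next
      case False
      \<comment> \<open>Since \<open>a\<close> is nonnegative, \<open>q\<close> is positive. The
        plateau of height \<open>q\<close> is placed over a basic set inside the region where
        \<open>f\<close> exceeds \<open>q\<close>; outside it vanishes, so it stays below
        \<open>f\<close> everywhere.\<close>
      obtain q where q: "a < of_rat q" "of_rat q < f x" using of_rat_dense[OF a] by blast
      have "openin X {z \<in> topspace X. f z > of_rat q}"
        using f(1) unfolding continuous_map_upper_lower_semicontinuous_lt by blast
      then obtain V where V: "open V" "{z \<in> topspace X. f z > of_rat q} = \<phi> -` V \<inter> topspace X"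
        unfolding openin_pullback_iff[OF X] by blast
      have "\<phi> x \<in> V" using V(2) q(2) x by auto
      from topological_basisE[OF G V(1) this]
      obtain v where v: "\<phi> x \<in> G v" "G v \<subseteq> V" by auto
      obtain n where n: "open_approx (G v) n (\<phi> x) = 1"
        using open_approx_reaches[OF topological_basis_open[OF G rangeI] v(1)] by blast
      have j: "(q, v, n) \<in> J"
        unfolding J_def
      proof (intro CollectI ballI)
        fix z assume z: "z \<in> topspace X"
        have q0: "0 \<le> (of_rat q :: real)" using q(1) False by linarith
        show "weak_test G (q, v, n) (\<phi> z) \<le> f z"
        proof (cases "\<phi> z \<in> G v")
          case True
          then have "of_rat q < f z" using V(2) v(2) z by auto
          moreover have "of_rat q * open_approx (G v) n (\<phi> z) \<le> of_rat q * 1"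
            by (intro mult_left_mono open_approx_bounds q0)
          ultimately show ?thesis by (simp add: weak_test_def)
        next
          case False
          then show ?thesis using f(2)[OF z] by (simp add: weak_test_def open_approx_outside)
        qed
      qed
      \<comment> \<open>\<open>L m\<close> holds the admissible indices with code strictly below
        \<open>m\<close>, hence the successor.\<close>
      have "a < list_max (weak_test G) (L m) (\<phi> x)" if "Suc (to_nat (q, v, n)) \<le> m" for m
      proof -
        have "(q, v, n) \<in> set (L m)"
          using j that by (auto simp: L_def image_iff intro!: bexI[of _ "to_nat (q, v, n)"])
        then have "weak_test G (q, v, n) (\<phi> x) \<le> list_max (weak_test G) (L m) (\<phi> x)" by (rule list_max_ge)
        then show ?thesis using q(1) n by (simp add: weak_test_def)
      qed
      then show ?thesis unfolding eventually_sequentially by blast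
    qed
  qed
  ultimately show ?thesis using that by blast
qed

text \<open>Integrals of nonnegative bounded continuous functions are suprema of integrals of list
  maxima, hence lower semicontinuous for the topology that these countably many integrals induce.
  Applied to \<open>f + b\<close> and \<open>b - f\<close> this gives continuity of the integral of
  any bounded continuous \<open>f\<close>, so nothing is lost by testing with countably many
  functions.\<close>

lemma weak_topology_pullback:
  fixes \<phi> :: "'a \<Rightarrow> nat \<Rightarrow> real"
  assumes X: "X = pullback_topology (topspace X) \<phi> euclidean"
    and G: "topological_basis (range G)" "\<exists>v. G v = UNIV"
  shows "weak_topology c X = pullback_topology (measures_le c X)
    (\<lambda>\<alpha> m. \<integral>x. list_max (weak_test G) (from_nat m) (\<phi> x) \<partial>\<alpha>) euclidean"
    (is "_ = pullback_topology _ ?\<Phi> _")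
proof -
  let ?h = "\<lambda>L x. list_max (weak_test G) L (\<phi> x)"
  let ?Y = "pullback_topology (measures_le c X) ?\<Phi> euclidean"
  have tY: "topspace ?Y = measures_le c X" by (simp add: topspace_pullback_topology)
  have d: "continuous_on UNIV (weak_test G j)" for j
    by (cases j) (auto simp: weak_test_def intro!: continuous_intros continuous_open_approx)
  have db: "\<exists>b. \<forall>y. weak_test G j y \<le> b" for j
  proof (cases j)
    case (fields q v n)
    have "of_rat q * open_approx (G v) n y \<le> \<bar>of_rat q :: real\<bar> * 1" for y
      using open_approx_bounds[of "G v" n y]
      by (metis abs_ge_self abs_mult abs_of_nonneg abs_ge_zero mult_left_mono order_trans)
    then show ?thesis unfolding fields weak_test_def by auto
  qed
  have hc: "continuous_map X euclideanreal (?h L)" for L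
    by (intro continuous_map_pullback_compose[OF X] continuous_list_max d)
  have hb: "\<exists>b. \<forall>x. \<bar>?h L x\<bar> \<le> b" for L using list_max_bounded[of "weak_test G" L] db by blast
  have cL: "continuous_map ?Y euclideanreal (\<lambda>\<alpha>. \<integral>x. ?h L x \<partial>\<alpha>)" for L
    using continuous_map_pullback_coordinate[of ?Y _ ?\<Phi> "to_nat L", OF refl] by simp
  \<comment> \<open>As \<open>UNIV\<close> is a basic set, the constant 1 is among the test
    functions, so the total mass is continuous.\<close>
  obtain v where v: "G v = UNIV" using G by blast
  have "?h [(1, v, 0)] x = 1" for x by (simp add: weak_test_def open_approx_def v)
  then have mass: "continuous_map ?Y euclideanreal (\<lambda>\<alpha>. measure \<alpha> (space \<alpha>))"
    using cL[of "[(1, v, 0)]"] by simp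
  \<comment> \<open>The threshold \<open>s\<close> varies with the measure because shifting
    \<open>f\<close> by the constant \<open>b\<close> adds a multiple of the total mass, which
    differs from measure to measure.\<close>
  have lsc: "openin ?Y {\<alpha> \<in> measures_le c X. s \<alpha> < (\<integral>x. f x \<partial>\<alpha>)}"
    if f: "continuous_map X euclideanreal f" "\<And>x. x \<in> topspace X \<Longrightarrow> 0 \<le> f x" "\<And>x. x \<in> topspace X \<Longrightarrow> f x \<le> b"
      and s: "continuous_map ?Y euclideanreal s" for f b s
  proof -
    obtain L :: "nat \<Rightarrow> (rat \<times> nat \<times> nat) list" where L:
      "\<And>x n. x \<in> topspace X \<Longrightarrow> ?h (L n) x \<le> f x"
      "\<And>x. x \<in> topspace X \<Longrightarrow> (\<lambda>n. ?h (L n) x) \<longlonglongrightarrow> f x"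
      using increasing_test_functions[OF X G(1) f(1,2)] by blast
    \<comment> \<open>The integrals of the approximants converge from below, so a strict inequality
      for the limit is already attained by one of them; the set becomes a union of open
      sets.\<close>
    have "s \<alpha> < (\<integral>x. f x \<partial>\<alpha>) \<longleftrightarrow> (\<exists>n. 0 < (\<integral>x. ?h (L n) x \<partial>\<alpha>) - s \<alpha>)" if \<alpha>: "\<alpha> \<in> measures_le c X" for \<alpha>
    proof -
      interpret finite_measure \<alpha> by (rule measures_le_finite[OF \<alpha>])
      note S = measures_leD[OF \<alpha>]
      have mf: "f \<in> borel_measurable \<alpha>" "?h (L n) \<in> borel_measurable \<alpha>" for n
        using continuous_map_borel_measurable[OF f(1)] continuous_map_borel_measurable[OF hc]
        by (simp_all add: measurable_cong_sets[OF S(1) refl])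
      have "(\<lambda>n. \<integral>x. ?h (L n) x \<partial>\<alpha>) \<longlonglongrightarrow> (\<integral>x. f x \<partial>\<alpha>)"
      proof (rule integral_dominated_convergence[where w = "\<lambda>_. b"])
        show "AE x in \<alpha>. norm (?h (L n) x) \<le> b" for n
        proof (rule AE_I2)
          fix x assume "x \<in> space \<alpha>"
          then show "norm (?h (L n) x) \<le> b"
            using L(1)[of x n] f(3)[of x] list_max_ge(1)[of "weak_test G" "L n" "\<phi> x"] S by auto
        qed
      qed (use mf L S in auto)
      moreover have "(\<integral>x. ?h (L n) x \<partial>\<alpha>) \<le> (\<integral>x. f x \<partial>\<alpha>)" for n
      proof (rule integral_mono)
        obtain b' where "\<forall>x. \<bar>?h (L n) x\<bar> \<le> b'" using hb by blast
        then show "integrable \<alpha> (?h (L n))" using mf by (intro integrable_const_bound[of _ b']) auto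
        show "integrable \<alpha> f"
          using mf f S by (intro integrable_const_bound[of _ b]) (auto intro!: AE_I2)
      qed (use L S in auto)
      ultimately show ?thesis
        using eventually_happens'[OF sequentially_bot order_tendstoD(1)[of _ "\<integral>x. f x \<partial>\<alpha>" sequentially "s \<alpha>"]]
        by (auto simp: algebra_simps intro: order.strict_trans2)
    qed
    then have "{\<alpha> \<in> measures_le c X. s \<alpha> < (\<integral>x. f x \<partial>\<alpha>)} =
      (\<Union>n. {\<alpha> \<in> topspace ?Y. 0 < (\<integral>x. ?h (L n) x \<partial>\<alpha>) - s \<alpha>})" unfolding tY by auto
    moreover have "openin ?Y {\<alpha> \<in> topspace ?Y. 0 < (\<integral>x. ?h (L n) x \<partial>\<alpha>) - s \<alpha>}" for n
    proof -
      have "continuous_map ?Y euclideanreal (\<lambda>\<alpha>. (\<integral>x. ?h (L n) x \<partial>\<alpha>) - s \<alpha>)"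
        by (intro continuous_map_diff cL s)
      then show ?thesis unfolding continuous_map_upper_lower_semicontinuous_lt by blast
    qed
    ultimately show ?thesis by auto
  qed
  have ci: "continuous_map ?Y euclideanreal (\<lambda>\<alpha>. \<integral>x. f x \<partial>\<alpha>)"
    if f: "continuous_map X euclideanreal f" "bounded (f ` topspace X)" for f
  proof -
    obtain b where b: "\<And>x. x \<in> topspace X \<Longrightarrow> \<bar>f x\<bar> \<le> b" using f(2) unfolding bounded_iff by auto
    have bb: "0 \<le> f x + b" "f x + b \<le> 2 * b" "0 \<le> b - f x" "b - f x \<le> 2 * b" if "x \<in> topspace X" for x
      using b[OF that] by linarith+
    have i: "integrable \<alpha> f" if "\<alpha> \<in> measures_le c X" for \<alpha>
      by (rule measures_le_integrable[OF that continuous_map_borel_measurable[OF f(1)] b])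
    have e: "(\<integral>x. f x + b \<partial>\<alpha>) = (\<integral>x. f x \<partial>\<alpha>) + measure \<alpha> (space \<alpha>) * b"
      "(\<integral>x. b - f x \<partial>\<alpha>) = measure \<alpha> (space \<alpha>) * b - (\<integral>x. f x \<partial>\<alpha>)" if \<alpha>: "\<alpha> \<in> measures_le c X" for \<alpha>
    proof -
      interpret finite_measure \<alpha> by (rule measures_le_finite[OF \<alpha>])
      show "(\<integral>x. f x + b \<partial>\<alpha>) = (\<integral>x. f x \<partial>\<alpha>) + measure \<alpha> (space \<alpha>) * b"
        "(\<integral>x. b - f x \<partial>\<alpha>) = measure \<alpha> (space \<alpha>) * b - (\<integral>x. f x \<partial>\<alpha>)"
        using i[OF \<alpha>] by simp_all
    qed
    \<comment> \<open>The function \<open>f + b\<close> yields openness of the lower bounds on the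
      integral of \<open>f\<close>, the function \<open>b - f\<close> that of the upper
      bounds.\<close>
    have "openin ?Y {\<alpha> \<in> measures_le c X. a + measure \<alpha> (space \<alpha>) * b < (\<integral>x. f x + b \<partial>\<alpha>)}" for a
      by (intro lsc[OF _ bb(1,2)] continuous_map_add f continuous_map_real_mult mass) auto
    moreover have "openin ?Y {\<alpha> \<in> measures_le c X. measure \<alpha> (space \<alpha>) * b - a < (\<integral>x. b - f x \<partial>\<alpha>)}" for a
      by (intro lsc[OF _ bb(3,4)] continuous_map_diff f continuous_map_real_mult mass) auto
    ultimately show ?thesis
      unfolding continuous_map_upper_lower_semicontinuous_lt tY using e
      by (auto cong: conj_cong)
  qed
  have "weak_topology c X = pullback_topology (topspace (weak_topology c X)) ?\<Phi> euclidean"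
  proof (rule pullback_topology_eqI)
    fix n
    obtain b where "\<forall>x. \<bar>?h (from_nat n) x\<bar> \<le> b" using hb by blast
    then have "bounded (?h (from_nat n) ` topspace X)" unfolding bounded_iff by auto
    then show "continuous_map (weak_topology c X) euclideanreal (\<lambda>\<alpha>. ?\<Phi> \<alpha> n)"
      by (intro continuous_map_weak_integral hc)
  next
    show "continuous_map (pullback_topology (topspace (weak_topology c X)) ?\<Phi> euclidean) (weak_topology c X) id"
      unfolding topspace_weak_topology
      unfolding weak_topology_def
    proof (rule continuous_on_generated_topo)
      fix U assume "U \<in> {{\<alpha> \<in> measures_le c X. (\<integral>x. f x \<partial>\<alpha>) \<in> V} | f V.
        continuous_map X euclideanreal f \<and> bounded (f ` topspace X) \<and> open V}"
      then obtain f V where fV: "U = {\<alpha> \<in> measures_le c X. (\<integral>x. f x \<partial>\<alpha>) \<in> V}"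
        "continuous_map X euclideanreal f" "bounded (f ` topspace X)" "open V" by blast
      have "openin ?Y ((\<lambda>\<alpha>. \<integral>x. f x \<partial>\<alpha>) -` V \<inter> topspace ?Y)"
        using ci[OF fV(2,3)] fV(4) unfolding continuous_map_alt by auto
      then show "openin ?Y (id -` U \<inter> topspace ?Y)"
        by (rule back_subst[of "openin _"]) (auto simp: fV(1) tY)
    next
      show "id ` topspace ?Y \<subseteq> \<Union> {{\<alpha> \<in> measures_le c X. (\<integral>x. f x \<partial>\<alpha>) \<in> V} | f V.
        continuous_map X euclideanreal f \<and> bounded (f ` topspace X) \<and> open V}"
        using topspace_weak_topology[of c X] unfolding weak_topology_def topology_generated_by_topspace tY by simp
    qed
  qed
  then show ?thesis by simp
qed

lemma countable_basis_with_UNIV: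
  obtains G :: "nat \<Rightarrow> 'b::second_countable_topology set"
  where "topological_basis (range G)" "\<exists>v. G v = UNIV"
proof -
  obtain B :: "'b set set" where B: "countable B" "topological_basis B" using ex_countable_basis by auto
  let ?G = "from_nat_into (insert UNIV B)"
  have r: "range ?G = insert UNIV B" using B by (intro range_from_nat_into) auto
  have "topological_basis (insert UNIV B)"
    using B(2) unfolding topological_basis_def by (metis insert_iff open_UNIV subset_insertI2)
  moreover have "\<exists>v. ?G v = UNIV" using r by (metis insertI1 rangeE)
  ultimately show ?thesis using that r by metis
qed

section \<open>Coded spaces of measures and their Borel sets\<close>

lemma decode_encode:
  assumes "real_generated X" "\<alpha> \<in> measures_le c X"
  shows "decode c X (encode c X \<alpha>) = \<alpha>"
  unfolding decode_def
  using inj_on_encode[OF real_generated_second_countable[OF assms(1)]] assms(2) by (rule inv_into_f_f)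

lemma topspace_coded_measures:
  assumes "real_generated X"
  shows "topspace (coded_measures c X) = encode c X ` measures_le c X"
  using decode_encode[OF assms]
  by (auto simp: coded_measures_def topspace_pullback_topology)

lemma decode_in_measures_le:
  assumes "real_generated X" "p \<in> topspace (coded_measures c X)"
  shows "decode c X p \<in> measures_le c X"
  using assms topspace_coded_measures[OF assms(1)] decode_encode[OF assms(1)] by auto

lemma coded_measures_pullback:
  fixes \<phi> :: "'a \<Rightarrow> nat \<Rightarrow> real"
  assumes X: "X = pullback_topology (topspace X) \<phi> euclidean"
    and G: "topological_basis (range G)" "\<exists>v. G v = UNIV"
  shows "coded_measures c X = pullback_topology (topspace (coded_measures c X))
    (\<lambda>p m. \<integral>x. list_max (weak_test G) (from_nat m) (\<phi> x) \<partial>(decode c X p)) euclidean"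
proof -
  have r: "real_generated X" using X by (rule real_generatedI)
  let ?\<Phi> = "\<lambda>\<alpha> m. \<integral>x. list_max (weak_test G) (from_nat m) (\<phi> x) \<partial>\<alpha>"
  let ?S = "topspace (coded_measures c X)"
  have "openin (coded_measures c X) U \<longleftrightarrow> (\<exists>T. open T \<and> U = (\<lambda>p. ?\<Phi> (decode c X p)) -` T \<inter> ?S)" for U
  proof -
    have "openin (coded_measures c X) U \<longleftrightarrow>
      (\<exists>T. open T \<and> U = decode c X -` (?\<Phi> -` T \<inter> measures_le c X) \<inter> ?S)"
      unfolding topspace_coded_measures[OF r] unfolding coded_measures_def weak_topology_pullback[OF X G]
        openin_pullback_topology by auto
    moreover have "decode c X -` (?\<Phi> -` T \<inter> measures_le c X) \<inter> ?S = (\<lambda>p. ?\<Phi> (decode c X p)) -` T \<inter> ?S" for T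
      using decode_in_measures_le[OF r] by auto
    ultimately show ?thesis by simp
  qed
  then show ?thesis unfolding topology_eq openin_pullback_topology by simp
qed

lemma real_generated_coded_measures:
  assumes "real_generated X" shows "real_generated (coded_measures c X)"
proof -
  obtain \<phi> :: "'a \<Rightarrow> nat \<Rightarrow> real" where X: "X = pullback_topology (topspace X) \<phi> euclidean"
    using assms unfolding real_generated_def by blast
  obtain G :: "nat \<Rightarrow> (nat \<Rightarrow> real) set" where G: "topological_basis (range G)" "\<exists>v. G v = UNIV"
    by (rule countable_basis_with_UNIV)
  show ?thesis by (rule real_generatedI[OF coded_measures_pullback[OF X G]])
qed

lemma Dynkin_kernel_measurable:
  assumes fin: "\<And>\<omega>. \<omega> \<in> space \<Omega> \<Longrightarrow> finite_measure (\<kappa> \<omega>)"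
    and s: "\<And>\<omega>. \<omega> \<in> space \<Omega> \<Longrightarrow> sets (\<kappa> \<omega>) = sigma_sets S E"
    and E: "Int_stable E" "E \<subseteq> Pow S" "S \<in> E"
    and m: "\<And>A. A \<in> E \<Longrightarrow> (\<lambda>\<omega>. emeasure (\<kappa> \<omega>) A) \<in> borel_measurable \<Omega>"
    and A: "A \<in> sigma_sets S E"
  shows "(\<lambda>\<omega>. emeasure (\<kappa> \<omega>) A) \<in> borel_measurable \<Omega>"
  using E(1,2) A
proof (induct rule: sigma_sets_induct_disjoint)
  case (compl A)
  have sp: "space (\<kappa> \<omega>) = S" if "\<omega> \<in> space \<Omega>" for \<omega>
    using sets_eq_imp_space_eq[of "\<kappa> \<omega>" "sigma S E"] s[OF that] E(2) by simp
  have "emeasure (\<kappa> \<omega>) (S - A) = emeasure (\<kappa> \<omega>) S - emeasure (\<kappa> \<omega>) A" if \<omega>: "\<omega> \<in> space \<Omega>" for \<omega>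
  proof -
    interpret finite_measure "\<kappa> \<omega>" by (rule fin[OF \<omega>])
    show ?thesis using emeasure_compl[of A "\<kappa> \<omega>"] compl(1) s[OF \<omega>] sp[OF \<omega>] by simp
  qed
  moreover have "(\<lambda>\<omega>. emeasure (\<kappa> \<omega>) S - emeasure (\<kappa> \<omega>) A) \<in> borel_measurable \<Omega>"
    using compl m[OF E(3)] by simp
  ultimately show ?case by (rule measurable_transfer)
next
  case (union A)
  have "emeasure (\<kappa> \<omega>) (\<Union> (range A)) = (\<Sum>i. emeasure (\<kappa> \<omega>) (A i))" if \<omega>: "\<omega> \<in> space \<Omega>" for \<omega>
    using union(1,2) s[OF \<omega>] by (intro suminf_emeasure[symmetric]) auto
  moreover have "(\<lambda>\<omega>. \<Sum>i. emeasure (\<kappa> \<omega>) (A i)) \<in> borel_measurable \<Omega>" using union(3) by simp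
  ultimately show ?case by (rule measurable_transfer)
qed (use m in auto)

lemma Int_stable_openin: "Int_stable {S. openin X S}"
  by (auto intro: Int_stableI)

text \<open>At an open set the evaluation is a pointwise limit of the weakly continuous integrals of
  \<open>open_approx\<close>; the open sets are stable under intersection, so Dynkin's argument
  extends this to Borel sets.\<close>

lemma emeasure_decode_measurable:
  assumes r: "real_generated X" and A: "A \<in> sets (borel_of X)"
  shows "(\<lambda>p. emeasure (decode c X p) A) \<in> borel_measurable (borel_of (coded_measures c X))"
proof (rule Dynkin_kernel_measurable[OF _ _ Int_stable_openin])
  let ?C = "borel_of (coded_measures c X)"
  fix p assume p: "p \<in> space ?C"
  then have D: "decode c X p \<in> measures_le c X" using decode_in_measures_le[OF r] by simp
  show "finite_measure (decode c X p)" by (rule measures_le_finite[OF D])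
  show "sets (decode c X p) = sigma_sets (topspace X) {S. openin X S}"
    using measures_leD[OF D] by (simp add: sets_borel_of)
next
  show "{S. openin X S} \<subseteq> Pow (topspace X)" using openin_subset by blast
  show "topspace X \<in> {S. openin X S}" by simp
  show "A \<in> sigma_sets (topspace X) {S. openin X S}" using A by (simp add: sets_borel_of)
next
  fix A assume "A \<in> {S. openin X S}"
  then have A: "openin X A" by simp
  obtain \<phi> :: "'a \<Rightarrow> nat \<Rightarrow> real" where X: "X = pullback_topology (topspace X) \<phi> euclidean"
    using r unfolding real_generated_def by blast
  obtain V where V: "open V" "A = \<phi> -` V \<inter> topspace X"
    using A unfolding openin_pullback_iff[OF X] by blast
  have gc: "continuous_map X euclideanreal (\<lambda>x. open_approx V n (\<phi> x))" for n
    by (intro continuous_map_pullback_compose[OF X] continuous_open_approx)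
  have "continuous_map (coded_measures c X) euclideanreal (\<lambda>p. \<integral>x. open_approx V n (\<phi> x) \<partial>decode c X p)" for n
  proof -
    have "bounded ((\<lambda>x. open_approx V n (\<phi> x)) ` topspace X)"
      unfolding bounded_iff using open_approx_bounds[of V n] by (intro exI[of _ 1]) auto
    from continuous_map_pullback[OF continuous_map_weak_integral[OF gc this]]
    show ?thesis unfolding coded_measures_def o_def .
  qed
  then have m: "(\<lambda>p. \<integral>x. open_approx V n (\<phi> x) \<partial>decode c X p) \<in> borel_measurable (borel_of (coded_measures c X))" for n
    by (rule continuous_map_borel_measurable)
  have lim: "(\<lambda>n. \<integral>x. open_approx V n (\<phi> x) \<partial>decode c X p) \<longlonglongrightarrow> measure (decode c X p) A"
    if p: "p \<in> topspace (coded_measures c X)" for p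
  proof -
    have D: "decode c X p \<in> measures_le c X" using decode_in_measures_le[OF r p] .
    note S = measures_leD[OF D]
    interpret finite_measure "decode c X p" by (rule measures_le_finite[OF D])
    have AS: "A \<in> sets (decode c X p)" using S openin_sets_borel_of[OF A] by simp
    have "(\<lambda>n. \<integral>x. open_approx V n (\<phi> x) \<partial>decode c X p) \<longlonglongrightarrow> (\<integral>x. indicator A x \<partial>decode c X p)"
    proof (rule integral_dominated_convergence[where w = "\<lambda>_. 1"])
      show "AE x in decode c X p. (\<lambda>n. open_approx V n (\<phi> x)) \<longlonglongrightarrow> indicator A x"
        using open_approx_limit[OF V(1)] by (intro AE_I2) (auto simp: V(2) S indicator_def split: if_splits)
      show "(\<lambda>x. open_approx V n (\<phi> x)) \<in> borel_measurable (decode c X p)" for n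
        using continuous_map_borel_measurable[OF gc] by (simp add: measurable_cong_sets[OF S(1) refl])
    qed (use AS open_approx_bounds[of V] in \<open>auto intro!: AE_I2\<close>)
    then show ?thesis using AS by simp
  qed
  have "(\<lambda>p. measure (decode c X p) A) \<in> borel_measurable (borel_of (coded_measures c X))"
    using lim by (intro borel_measurable_LIMSEQ_real[OF _ m]) auto
  then have "(\<lambda>p. ennreal (measure (decode c X p) A)) \<in> borel_measurable (borel_of (coded_measures c X))"
    by measurable
  moreover have "emeasure (decode c X p) A = ennreal (measure (decode c X p) A)"
    if "p \<in> space (borel_of (coded_measures c X))" for p
  proof -
    interpret finite_measure "decode c X p"
      using measures_le_finite[OF decode_in_measures_le[OF r, of p]] that by simp
    show ?thesis by (rule emeasure_eq_measure)
  qed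
  ultimately show "(\<lambda>p. emeasure (decode c X p) A) \<in> borel_measurable (borel_of (coded_measures c X))"
    by (rule measurable_transfer[rotated])
qed

text \<open>The coordinates of the coded space are integrals of measurable functions, hence
  measurable once the evaluations are. With \<open>emeasure_decode_measurable\<close>, the Borel
  sigma-algebra is the one generated by the evaluations.\<close>

lemma measurable_coded_measuresI:
  assumes r: "real_generated X"
    and f: "\<And>\<omega>. \<omega> \<in> space \<Omega> \<Longrightarrow> f \<omega> \<in> topspace (coded_measures c X)"
    and m: "\<And>A. A \<in> sets (borel_of X) \<Longrightarrow> (\<lambda>\<omega>. emeasure (decode c X (f \<omega>)) A) \<in> borel_measurable \<Omega>"
  shows "f \<in> measurable \<Omega> (borel_of (coded_measures c X))"
proof -
  obtain \<phi> :: "'a \<Rightarrow> nat \<Rightarrow> real" where X: "X = pullback_topology (topspace X) \<phi> euclidean"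
    using r unfolding real_generated_def by blast
  obtain G :: "nat \<Rightarrow> (nat \<Rightarrow> real) set" where G: "topological_basis (range G)" "\<exists>v. G v = UNIV"
    by (rule countable_basis_with_UNIV)
  show ?thesis
  proof (rule measurable_borel_of_pullback[OF coded_measures_pullback[OF X G]])
    show "f \<in> space \<Omega> \<rightarrow> topspace (coded_measures c X)" using f by auto
    fix n
    have d: "continuous_on UNIV (weak_test G j)" for j
      by (cases j) (auto simp: weak_test_def intro!: continuous_intros continuous_open_approx)
    have "(\<lambda>x. list_max (weak_test G) (from_nat n) (\<phi> x)) \<in> borel_measurable (borel_of X)"
      by (intro continuous_map_borel_measurable continuous_map_pullback_compose[OF X] continuous_list_max d)
    then show "(\<lambda>\<omega>. \<integral>x. list_max (weak_test G) (from_nat n) (\<phi> x) \<partial>decode c X (f \<omega>)) \<in> borel_measurable \<Omega>"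
      using measures_leD(1)[OF decode_in_measures_le[OF r f]] m
      by (intro integral_kernel_measurable[where N = "borel_of X"]) (auto simp: list_max_ge)
  qed
qed

section \<open>The spaces \<open>\<bbbP>\<^sub>k\<close>\<close>

lemma real_generated_P_spaceI:
  assumes "\<And>i. i \<le> k \<Longrightarrow> real_generated (L_space c i)" shows "real_generated (P_space c k)"
  unfolding P_space.simps[of c k]
  using assms by (intro real_generated_subtopology real_generated_product) auto

lemma real_generated_L_space: "real_generated (L_space c k)"
proof (induction k rule: less_induct)
  case (less k)
  show ?case
  proof (cases k)
    case 0
    then show ?thesis by (simp add: L_space.simps real_generated_discrete_singleton)
  next
    case (Suc j)
    have "real_generated (P_space c j)" using less Suc by (intro real_generated_P_spaceI) auto
    then show ?thesis unfolding Suc L_space.simps by (rule real_generated_coded_measures)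
  qed
qed

lemma real_generated_P_space: "real_generated (P_space c k)"
  by (intro real_generated_P_spaceI real_generated_L_space)

text \<open>Absorbs the index shift: coordinate \<open>Suc k\<close> of a point codes a measure on
  \<open>P_space c k\<close>. It applies to points of every higher \<open>P_space\<close> and of
  \<open>P_limit\<close>.\<close>

definition law_at :: "real \<Rightarrow> nat \<Rightarrow> (nat \<Rightarrow> point) \<Rightarrow> (nat \<Rightarrow> point) measure" where
  "law_at c k \<alpha> = decode c (P_space c k) (\<alpha> (Suc k))"

lemma topspace_P_space:
  "\<alpha> \<in> topspace (P_space c k) \<longleftrightarrow> \<alpha> \<in> PiE {..k} (\<lambda>i. topspace (L_space c i)) \<and>
    (\<forall>j. Suc j < k \<longrightarrow> law_at c j \<alpha> =
      distr (law_at c (Suc j) \<alpha>) (borel_of (P_space c j)) (\<lambda>\<beta>. restrict \<beta> {..j}))"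
proof -
  have "(\<forall>l\<in>{1..<k}. Q l) \<longleftrightarrow> (\<forall>j. Suc j < k \<longrightarrow> Q (Suc j))" for Q
    by (metis One_nat_def Suc_le_mono atLeastLessThan_iff le0 not0_implies_Suc not_one_le_zero)
  then show ?thesis
    unfolding P_space.simps[of c k] topspace_subtopology topspace_product_topology law_at_def by auto
qed

lemma measurable_P_space_iff:
  "f \<in> measurable \<Omega> (borel_of (P_space c k)) \<longleftrightarrow>
    (\<forall>x\<in>space \<Omega>. f x \<in> topspace (P_space c k)) \<and>
    (\<forall>i\<le>k. (\<lambda>x. f x i) \<in> measurable \<Omega> (borel_of (L_space c i)))"
  by (subst measurable_borel_of_product_iff[of "{..k}" "L_space c", OF real_generated_L_space P_space.simps[of c k]])
    auto

lemma topspace_P_space_0: "topspace (P_space c 0) = {restrict (\<lambda>_. star) {..0}}"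
proof -
  have "PiE {..0::nat} (\<lambda>i. topspace (L_space c i)) = {restrict (\<lambda>_. star) {..0}}"
    by (auto simp: L_space.simps PiE_def extensional_def fun_eq_iff)
  then show ?thesis unfolding set_eq_iff topspace_P_space by auto
qed

lemma restrict_in_P_space:
  assumes "\<alpha> \<in> topspace (P_space c k)" "h \<le> k"
  shows "restrict \<alpha> {..h} \<in> topspace (P_space c h)"
  using assms unfolding topspace_P_space law_at_def by (auto simp: PiE_iff)

lemma measurable_restrict_P_space:
  assumes "h \<le> k"
  shows "(\<lambda>\<beta>. restrict \<beta> {..h}) \<in> measurable (borel_of (P_space c k)) (borel_of (P_space c h))"
  unfolding measurable_P_space_iff
proof (intro conjI allI impI ballI)
  fix i assume "i \<le> h"
  then show "(\<lambda>\<beta>. restrict \<beta> {..h} i) \<in> measurable (borel_of (P_space c k)) (borel_of (L_space c i))"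
    using assms measurable_ident[of "borel_of (P_space c k)"] unfolding id_def measurable_P_space_iff by simp
qed (use restrict_in_P_space assms in auto)

lemma law_at_measures_le:
  assumes "\<alpha> \<in> topspace (P_space c k)" "j < k"
  shows "law_at c j \<alpha> \<in> measures_le c (P_space c j)"
proof -
  have "\<alpha> (Suc j) \<in> topspace (L_space c (Suc j))" using assms unfolding topspace_P_space by auto
  then show ?thesis
    unfolding law_at_def L_space.simps by (rule decode_in_measures_le[OF real_generated_P_space])
qed

lemma measurable_P_space_coordinate:
  "i \<le> k \<Longrightarrow> (\<lambda>\<alpha>. \<alpha> i) \<in> measurable (borel_of (P_space c k)) (borel_of (L_space c i))"
  using measurable_ident[of "borel_of (P_space c k)"] unfolding id_def measurable_P_space_iff by simp

lemma emeasure_law_at_measurable: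
  assumes "A \<in> sets (borel_of (P_space c k))"
  shows "(\<lambda>\<alpha>. emeasure (law_at c k \<alpha>) A) \<in> borel_measurable (borel_of (P_space c (Suc k)))"
  unfolding law_at_def
  using measurable_compose[OF measurable_P_space_coordinate[OF order_refl]
    emeasure_decode_measurable[OF real_generated_P_space assms, of c, folded L_space.simps]] .

text \<open>By consistency all lower laws are images of the top one under restriction. A downward
  induction therefore transfers measurability of the evaluations from the top law to every
  coordinate.\<close>

lemma measurable_P_space_SucI:
  assumes f: "\<And>\<omega>. \<omega> \<in> space \<Omega> \<Longrightarrow> f \<omega> \<in> topspace (P_space c (Suc k))"
    and m: "\<And>A. A \<in> sets (borel_of (P_space c k)) \<Longrightarrow> (\<lambda>\<omega>. emeasure (law_at c k (f \<omega>)) A) \<in> borel_measurable \<Omega>"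
  shows "f \<in> measurable \<Omega> (borel_of (P_space c (Suc k)))"
  unfolding measurable_P_space_iff
proof (intro conjI ballI allI impI)
  have law: "\<forall>A\<in>sets (borel_of (P_space c j)). (\<lambda>\<omega>. emeasure (law_at c j (f \<omega>)) A) \<in> borel_measurable \<Omega>"
    if "j \<le> k" for j
    using that
  proof (induction j rule: inc_induct)
    case (step j)
    show ?case
    proof
      fix A assume A: "A \<in> sets (borel_of (P_space c j))"
      let ?B = "(\<lambda>\<beta>. restrict \<beta> {..j}) -` A \<inter> topspace (P_space c (Suc j))"
      note r = measurable_restrict_P_space[of j "Suc j" c]
      have B: "?B \<in> sets (borel_of (P_space c (Suc j)))"
        using measurable_sets[OF r A] by simp
      have "emeasure (law_at c j (f \<omega>)) A = emeasure (law_at c (Suc j) (f \<omega>)) ?B" if \<omega>: "\<omega> \<in> space \<Omega>" for \<omega>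
      proof -
        note S = measures_leD[OF law_at_measures_le[OF f[OF \<omega>], of "Suc j"]]
        have "law_at c j (f \<omega>) = distr (law_at c (Suc j) (f \<omega>)) (borel_of (P_space c j)) (\<lambda>\<beta>. restrict \<beta> {..j})"
          using f[OF \<omega>] step(2) unfolding topspace_P_space by simp
        moreover have "(\<lambda>\<beta>. restrict \<beta> {..j}) \<in> measurable (law_at c (Suc j) (f \<omega>)) (borel_of (P_space c j))"
          using r S step(2) by (simp add: measurable_cong_sets[OF S(1) refl])
        ultimately show ?thesis using A S step(2) by (simp add: emeasure_distr)
      qed
      moreover have "(\<lambda>\<omega>. emeasure (law_at c (Suc j) (f \<omega>)) ?B) \<in> borel_measurable \<Omega>"
        using step(3) B by blast
      ultimately show "(\<lambda>\<omega>. emeasure (law_at c j (f \<omega>)) A) \<in> borel_measurable \<Omega>"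
        by (rule measurable_transfer)
    qed
  qed (use m in auto)
  fix i assume i: "i \<le> Suc k"
  have fi: "f \<omega> i \<in> topspace (L_space c i)" if "\<omega> \<in> space \<Omega>" for \<omega>
    using f[OF that] i unfolding topspace_P_space by auto
  show "(\<lambda>\<omega>. f \<omega> i) \<in> measurable \<Omega> (borel_of (L_space c i))"
  proof (cases i)
    case 0
    then have "f \<omega> i = star" if "\<omega> \<in> space \<Omega>" for \<omega> using fi[OF that] by (simp add: L_space.simps)
    moreover have "(\<lambda>_. star) \<in> measurable \<Omega> (borel_of (L_space c i))"
      by (rule measurable_const) (simp add: 0 L_space.simps)
    ultimately show ?thesis by (rule measurable_transfer)
  next
    case (Suc j)
    show ?thesis
      using fi law[of j] i unfolding Suc L_space.simps law_at_def
      by (intro measurable_coded_measuresI real_generated_P_space) auto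
  qed
qed (use f in auto)

section \<open>A multiplicative class theorem\<close>

text \<open>The rules are operations that preserve measurability of weighted integrals in a
  parameter, so such a property of the whole closure follows by rule induction. Boundedness and
  convergence are required on \<open>S\<close> only.\<close>

inductive_set limit_closure :: "'a set \<Rightarrow> ('a \<Rightarrow> real) set \<Rightarrow> ('a \<Rightarrow> real) set"
  for S :: "'a set" and H :: "('a \<Rightarrow> real) set" where
  base: "h \<in> H \<Longrightarrow> h \<in> limit_closure S H"
| lin: "f \<in> limit_closure S H \<Longrightarrow> g \<in> limit_closure S H \<Longrightarrow> (\<lambda>x. a * f x + b * g x) \<in> limit_closure S H"
| lim: "(\<And>n::nat. f n \<in> limit_closure S H) \<Longrightarrow> (\<And>n x. x \<in> S \<Longrightarrow> \<bar>f n x\<bar> \<le> b) \<Longrightarrow>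
    (\<And>x. x \<in> S \<Longrightarrow> (\<lambda>n. f n x) \<longlonglongrightarrow> g x) \<Longrightarrow> g \<in> limit_closure S H"

locale multiplicative_class =
  fixes S :: "'a set" and H :: "('a \<Rightarrow> real) set"
  assumes bounded_H: "\<And>h. h \<in> H \<Longrightarrow> \<exists>b. \<forall>x\<in>S. \<bar>h x\<bar> \<le> b"
    and mult_H: "\<And>f g. f \<in> H \<Longrightarrow> g \<in> H \<Longrightarrow> (\<lambda>x. f x * g x) \<in> H"
    and one_H: "(\<lambda>_. 1) \<in> H"
begin

abbreviation "cl \<equiv> limit_closure S H"

lemma bounded_cl: "f \<in> cl \<Longrightarrow> \<exists>b. \<forall>x\<in>S. \<bar>f x\<bar> \<le> b"
proof (induction rule: limit_closure.induct)
  case (lin f g a b)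
  obtain u v where uv: "\<forall>x\<in>S. \<bar>f x\<bar> \<le> u" "\<forall>x\<in>S. \<bar>g x\<bar> \<le> v" using lin.IH by blast
  have "\<bar>a * f x + b * g x\<bar> \<le> \<bar>a\<bar> * u + \<bar>b\<bar> * v" if "x \<in> S" for x
  proof -
    have "\<bar>a * f x + b * g x\<bar> \<le> \<bar>a\<bar> * \<bar>f x\<bar> + \<bar>b\<bar> * \<bar>g x\<bar>" using abs_triangle_ineq[of "a * f x" "b * g x"] by (simp add: abs_mult)
    also have "\<dots> \<le> \<bar>a\<bar> * u + \<bar>b\<bar> * v" using uv that by (intro add_mono mult_left_mono) auto
    finally show ?thesis .
  qed
  then show ?case by blast
next
  case (lim f b g)
  have "\<bar>g x\<bar> \<le> b" if "x \<in> S" for x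
    by (rule LIMSEQ_le_const2[OF tendsto_rabs[OF lim.hyps(3)[OF that]]]) (use lim.hyps(2) that in auto)
  then show ?case by blast
qed (rule bounded_H)

text \<open>The rule \<open>lim\<close> for a constant sequence permits arbitrary changes outside
  \<open>S\<close>.\<close>

lemma cong_cl:
  assumes "f \<in> cl" "\<And>x. x \<in> S \<Longrightarrow> f x = g x" shows "g \<in> cl"
proof -
  obtain b where "\<forall>x\<in>S. \<bar>f x\<bar> \<le> b" using bounded_cl[OF assms(1)] by blast
  with assms show ?thesis by (intro limit_closure.lim[of "\<lambda>_. f" S H b g, OF _ _ tendsto_eq_rhs[OF tendsto_const]]) auto
qed

text \<open>Closure under products is bootstrapped: one factor is first kept in \<open>H\<close>,
  where products are given; \<open>mult_cl\<close> then repeats the induction with that factor in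
  the closure.\<close>

lemma mult_H_cl:
  assumes h: "h \<in> H" shows "f \<in> cl \<Longrightarrow> (\<lambda>x. h x * f x) \<in> cl"
proof (induction rule: limit_closure.induct)
  case (base g)
  then show ?case using mult_H[OF h] by (intro limit_closure.base)
next
  case (lin f g a b)
  from limit_closure.lin[OF lin.IH, of a b] show ?case by (simp add: algebra_simps)
next
  case (lim f b g)
  obtain u where u: "\<forall>x\<in>S. \<bar>h x\<bar> \<le> u" using bounded_H[OF h] by blast
  show ?case
  proof (rule limit_closure.lim)
    show "(\<lambda>x. h x * f n x) \<in> cl" for n by (rule lim.IH)
    show "\<bar>h x * f n x\<bar> \<le> u * b" if "x \<in> S" for n x
      using u lim.hyps(2)[OF that, of n] that unfolding abs_mult by (intro mult_mono') auto
    show "(\<lambda>n. h x * f n x) \<longlonglongrightarrow> h x * g x" if "x \<in> S" for x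
      using lim.hyps(3)[OF that] by (intro tendsto_intros)
  qed
qed

lemma mult_cl:
  assumes g: "g \<in> cl" shows "f \<in> cl \<Longrightarrow> (\<lambda>x. f x * g x) \<in> cl"
proof (induction rule: limit_closure.induct)
  case (base h)
  then show ?case using mult_H_cl[OF _ g] by simp
next
  case (lin f h a b)
  from limit_closure.lin[OF lin.IH, of a b] show ?case by (simp add: algebra_simps)
next
  case (lim f b h)
  obtain u where u: "\<forall>x\<in>S. \<bar>g x\<bar> \<le> u" using bounded_cl[OF g] by blast
  show ?case
  proof (rule limit_closure.lim)
    show "(\<lambda>x. f n x * g x) \<in> cl" for n by (rule lim.IH)
    show "\<bar>f n x * g x\<bar> \<le> b * u" if "x \<in> S" for n x
      using u lim.hyps(2)[OF that, of n] that unfolding abs_mult by (intro mult_mono') auto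
    show "(\<lambda>n. f n x * g x) \<longlonglongrightarrow> h x * g x" if "x \<in> S" for x
      using lim.hyps(3)[OF that] by (intro tendsto_intros)
  qed
qed

lemma const_cl: "(\<lambda>_. a) \<in> cl"
  using limit_closure.lin[OF limit_closure.base[OF one_H] limit_closure.base[OF one_H], of a 0] by simp

lemma add_cl: "f \<in> cl \<Longrightarrow> g \<in> cl \<Longrightarrow> (\<lambda>x. f x + g x) \<in> cl"
  using limit_closure.lin[of f S H g 1 1] by simp

lemma diff_cl: "f \<in> cl \<Longrightarrow> g \<in> cl \<Longrightarrow> (\<lambda>x. f x - g x) \<in> cl"
  using limit_closure.lin[of f S H g 1 "-1"] by simp

lemma polynomial_cl:
  fixes p :: "real \<Rightarrow> real"
  assumes f: "f \<in> cl" shows "real_polynomial_function p \<Longrightarrow> (\<lambda>x. p (f x)) \<in> cl"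
proof (induction rule: real_polynomial_function.induct)
  case (linear l)
  have "l y = y * l 1" for y using linear_scale[OF bounded_linear.linear[OF linear], of y 1] by simp
  then have "(\<lambda>x. l (f x)) = (\<lambda>x. f x * l 1)" by (intro ext)
  with mult_cl[OF const_cl[of "l 1"] f] show ?case by simp
next
  case (const a)
  show ?case by (rule const_cl)
next
  case (add p q)
  from add_cl[OF add.IH] show ?case .
next
  case (mult p q)
  from mult_cl[OF mult.IH(2,1)] show ?case .
qed

text \<open>On \<open>S\<close> the values of \<open>f\<close> stay in a compact interval, where
  \<open>\<psi>\<close> is a uniform limit of polynomials; polynomials in \<open>f\<close> are in
  the closure because it is an algebra.\<close>

lemma continuous_cl:
  fixes \<psi> :: "real \<Rightarrow> real"
  assumes f: "f \<in> cl" and \<psi>: "continuous_on UNIV \<psi>" shows "(\<lambda>x. \<psi> (f x)) \<in> cl"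
proof -
  obtain b where b: "\<forall>x\<in>S. \<bar>f x\<bar> \<le> b" using bounded_cl[OF f] by blast
  have c\<psi>: "continuous_on {-b..b} \<psi>" using \<psi> continuous_on_subset by blast
  have "\<exists>p. real_polynomial_function p \<and> (\<forall>y\<in>{-b..b}. \<bar>\<psi> y - p y\<bar> < 1 / real (Suc n))" for n
    by (rule Stone_Weierstrass_real_polynomial_function[OF compact_Icc c\<psi>, of "1 / real (Suc n)"]) auto
  then have "\<exists>p. \<forall>n. real_polynomial_function (p n) \<and> (\<forall>y\<in>{-b..b}. \<bar>\<psi> y - p n y\<bar> < 1 / real (Suc n))"
    by (intro choice allI)
  then obtain p where p: "\<And>n. real_polynomial_function (p n)"
    "\<And>n y. y \<in> {-b..b} \<Longrightarrow> \<bar>\<psi> y - p n y\<bar> < 1 / real (Suc n)" by blast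
  have "bounded (\<psi> ` {-b..b})" by (intro compact_imp_bounded compact_continuous_image c\<psi>) auto
  then obtain u where u: "\<forall>y\<in>{-b..b}. \<bar>\<psi> y\<bar> \<le> u" by (auto simp: bounded_iff)
  show ?thesis
  proof (rule limit_closure.lim)
    show "(\<lambda>x. p n (f x)) \<in> cl" for n by (rule polynomial_cl[OF f p(1)])
    show "\<bar>p n (f x)\<bar> \<le> u + 1" if "x \<in> S" for n x
    proof -
      have fx: "f x \<in> {-b..b}" using b that by (auto simp: abs_le_iff)
      have "1 / real (Suc n) \<le> 1" by simp
      then show ?thesis using p(2)[OF fx, of n] bspec[OF u fx] by linarith
    qed
    show "(\<lambda>n. p n (f x)) \<longlonglongrightarrow> \<psi> (f x)" if "x \<in> S" for x
    proof -
      have fx: "f x \<in> {-b..b}" using b that by (auto simp: abs_le_iff)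
      have "(\<lambda>n. p n (f x) - \<psi> (f x)) \<longlonglongrightarrow> 0"
      proof (rule Lim_null_comparison)
        show "\<forall>\<^sub>F n in sequentially. norm (p n (f x) - \<psi> (f x)) \<le> 1 / real (Suc n)"
        proof (intro always_eventually allI)
          fix n show "norm (p n (f x) - \<psi> (f x)) \<le> 1 / real (Suc n)"
            using p(2)[OF fx, of n] unfolding real_norm_def by linarith
        qed
        show "(\<lambda>n. 1 / real (Suc n)) \<longlonglongrightarrow> 0" using LIMSEQ_inverse_real_of_nat by (simp add: inverse_eq_divide)
      qed
      then show ?thesis by (simp add: LIM_zero_iff)
    qed
  qed
qed

lemma superlevel_cl:
  assumes f: "f \<in> cl" shows "indicator {x \<in> S. t < f x} \<in> cl"
proof (rule limit_closure.lim)
  show "(\<lambda>x. open_approx {t<..} n (f x)) \<in> cl" for n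
    by (rule continuous_cl[OF f continuous_open_approx])
  show "\<bar>open_approx {t<..} n (f x)\<bar> \<le> 1" for n x
    using open_approx_bounds[of "{t<..}" n "f x"] by simp
  show "(\<lambda>n. open_approx {t<..} n (f x)) \<longlonglongrightarrow> indicator {x \<in> S. t < f x} x" if "x \<in> S" for x
    using open_approx_limit[of "{t<..}" "f x"] that by (simp add: indicator_def)
qed

text \<open>Finite unions come from the algebra operations, as the sum of two indicators minus their
  product; countable unions are bounded limits of these.\<close>

lemma sigma_algebra_cl: "sigma_algebra S {A. A \<subseteq> S \<and> indicator A \<in> cl}"
  unfolding sigma_algebra_iff2
proof (intro conjI ballI allI impI)
  have "indicator {} \<in> cl" by (rule cong_cl[OF const_cl[of 0]]) simp
  then show "{} \<in> {A. A \<subseteq> S \<and> indicator A \<in> cl}" by simp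
  fix A assume A: "A \<in> {A. A \<subseteq> S \<and> indicator A \<in> cl}"
  have "indicator (S - A) \<in> cl"
    by (rule cong_cl[OF diff_cl[OF const_cl[of 1], of "indicator A"]]) (use A in \<open>auto simp: indicator_def\<close>)
  then show "S - A \<in> {A. A \<subseteq> S \<and> indicator A \<in> cl}" by auto
next
  fix A :: "nat \<Rightarrow> 'a set" assume A: "range A \<subseteq> {A. A \<subseteq> S \<and> indicator A \<in> cl}"
  have fin: "indicator (\<Union>i<n. A i) \<in> cl" for n
  proof (induction n)
    case 0 show ?case by (rule cong_cl[OF const_cl[of 0]]) simp
  next
    case (Suc n)
    have An: "indicator (A n) \<in> cl" using A by auto
    show ?case
      by (rule cong_cl[OF diff_cl[OF add_cl[OF An Suc] mult_cl[OF An Suc]]])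
        (auto simp: indicator_def lessThan_Suc)
  qed
  have "indicator (\<Union> (range A)) \<in> cl"
  proof (rule limit_closure.lim[OF fin, of _ 1])
    fix x
    show "(\<lambda>n. indicator (\<Union>i<n. A i) x) \<longlonglongrightarrow> (indicator (\<Union> (range A)) x :: real)"
      by (rule LIMSEQ_indicator_UN)
  qed (auto simp: indicator_def)
  then show "\<Union> (range A) \<in> {A. A \<subseteq> S \<and> indicator A \<in> cl}" using A by auto
qed auto

text \<open>The multiplicative class theorem for indicators. Measurability of \<open>H\<close>
  follows since superlevel sets have indicators that are limits of continuous functions of
  \<open>h\<close>.\<close>

lemma obtain_sigma_algebra:
  obtains \<Sigma> where "space \<Sigma> = S" "\<And>h. h \<in> H \<Longrightarrow> h \<in> borel_measurable \<Sigma>"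
    "\<And>A. A \<in> sets \<Sigma> \<Longrightarrow> indicator A \<in> cl"
proof
  let ?E = "{A. A \<subseteq> S \<and> indicator A \<in> cl}"
  let ?\<Sigma> = "sigma S ?E"
  have s: "sets ?\<Sigma> = ?E"
    using sigma_algebra.sigma_sets_eq[OF sigma_algebra_cl] by (simp add: subset_eq)
  show sp: "space ?\<Sigma> = S" by (simp add: space_measure_of_conv)
  show "indicator A \<in> cl" if "A \<in> sets ?\<Sigma>" for A using that s by blast
  show "h \<in> borel_measurable ?\<Sigma>" if "h \<in> H" for h
    unfolding borel_measurable_iff_greater sp s
    using superlevel_cl[OF limit_closure.base[OF that]] by auto
qed

end

section \<open>Tree probabilities as functions on \<open>\<bbbP>\<^sub>k\<close>\<close>

text \<open>The ways to attach the trees in \<open>m\<close> to the points \<open>0, \<dots>, size m - 1\<close> of a Poisson process.\<close>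

definition labelings :: "rtree multiset \<Rightarrow> (nat \<Rightarrow> rtree) set" where
  "labelings m = {t \<in> PiE {..<size m} (\<lambda>_. UNIV). image_mset t (mset_set {..<size m}) = m}"

text \<open>The number of labelings is a multinomial coefficient, so this is the reciprocal of the
  product of the factorials of the multiplicities in \<open>m\<close>, the constant in a product of
  Poisson probabilities.\<close>

definition tree_weight :: "rtree multiset \<Rightarrow> real" where
  "tree_weight m = real (card (labelings m)) / fact (size m)"

lemma finite_labelings: "finite (labelings m)"
proof (rule finite_subset)
  show "labelings m \<subseteq> PiE {..<size m} (\<lambda>_. set_mset m)"
  proof
    fix t assume t: "t \<in> labelings m"
    have "t i \<in># m" if "i < size m" for i
    proof -
      have "t i \<in># image_mset t (mset_set {..<size m})" using that by simp
      moreover have "image_mset t (mset_set {..<size m}) = m" using t by (simp add: labelings_def)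
      ultimately show ?thesis by (simp only:)
    qed
    then show "t \<in> PiE {..<size m} (\<lambda>_. set_mset m)" using t by (auto simp: labelings_def PiE_iff)
  qed
qed (auto intro: finite_PiE)

lemma labelings_nonempty: "labelings m \<noteq> {}"
proof -
  obtain xs where xs: "mset xs = m" using ex_mset by blast
  let ?t = "restrict ((!) xs) {..<length xs}"
  have "mset_set {..<length xs} = mset [0..<length xs]" by (simp add: atLeast0LessThan)
  then have "image_mset ?t (mset_set {..<length xs}) = image_mset ?t (mset [0..<length xs])" by (simp only:)
  also have "\<dots> = image_mset ((!) xs) (mset [0..<length xs])" by (intro image_mset_cong) simp
  also have "image_mset ((!) xs) (mset [0..<length xs]) = mset (map ((!) xs) [0..<length xs])" by (rule mset_map[symmetric])
  also have "\<dots> = m" by (simp only: map_nth xs)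
  finally have "image_mset ?t (mset_set {..<length xs}) = m" .
  moreover have "length xs = size m" using xs by (simp only: size_mset[symmetric])
  ultimately have "?t \<in> labelings m" unfolding labelings_def by (intro CollectI conjI) (simp_all only: restrict_PiE_iff, simp)
  then show ?thesis by blast
qed

lemma tree_weight_pos: "0 < tree_weight m"
  unfolding tree_weight_def using finite_labelings labelings_nonempty
  by (intro divide_pos_pos) (auto simp: card_gt_0_iff)

text \<open>The product over all shapes \<open>S\<close> of the Poisson weights with means
  \<open>\<lambda>\<^sub>S\<close>. For laws arising from a kernel the means sum to the total mass,
  so the exponentials combine into one factor, and only shapes occurring in \<open>m\<close>
  contribute otherwise.\<close>

primrec tree_prob :: "real \<Rightarrow> nat \<Rightarrow> (nat \<Rightarrow> point) \<Rightarrow> rtree \<Rightarrow> real" where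
  "tree_prob c 0 \<beta> T = of_bool (T = Node {#})"
| "tree_prob c (Suc k) \<beta> T = (case T of Node m \<Rightarrow> tree_weight m *
     exp (- measure (law_at c k \<beta>) (space (law_at c k \<beta>))) *
     (\<Prod>S\<in>#m. \<integral>\<gamma>. tree_prob c k \<gamma> S \<partial>law_at c k \<beta>))"

section \<open>Measurability and bounds for tree probabilities\<close>

lemma prod_mset_measurable:
  fixes f :: "'i \<Rightarrow> 'a \<Rightarrow> real"
  assumes "\<And>i. f i \<in> borel_measurable M"
  shows "(\<lambda>x. \<Prod>i\<in>#m. f i x) \<in> borel_measurable M"
  using assms by (induction m) auto

lemma prod_mset_bounded:
  fixes f :: "'i \<Rightarrow> 'a \<Rightarrow> real"
  assumes "\<And>i. \<exists>b. \<forall>x\<in>X. 0 \<le> f i x \<and> f i x \<le> b"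
  shows "\<exists>b. \<forall>x\<in>X. 0 \<le> (\<Prod>i\<in>#m. f i x) \<and> (\<Prod>i\<in>#m. f i x) \<le> b"
proof (induction m)
  case (add i m)
  obtain b where b: "\<forall>x\<in>X. 0 \<le> (\<Prod>i\<in>#m. f i x) \<and> (\<Prod>i\<in>#m. f i x) \<le> b" using add by blast
  obtain u where u: "\<forall>x\<in>X. 0 \<le> f i x \<and> f i x \<le> u" using assms by blast
  have "0 \<le> (\<Prod>i\<in>#add_mset i m. f i x) \<and> (\<Prod>i\<in>#add_mset i m. f i x) \<le> u * b" if "x \<in> X" for x
  proof -
    have "f i x * (\<Prod>i\<in>#m. f i x) \<le> u * b" using b u that by (intro mult_mono') auto
    then show ?thesis using b u that by auto
  qed
  then show ?case by blast
qed auto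

text \<open>The mean \<open>\<lambda>\<^sub>S\<close> of the number of children whose subtree has
  shape \<open>S\<close>, as a function of the coded point.\<close>

definition tree_mean :: "real \<Rightarrow> nat \<Rightarrow> (nat \<Rightarrow> point) \<Rightarrow> rtree \<Rightarrow> real" where
  "tree_mean c k \<beta> S = (\<integral>\<gamma>. tree_prob c k \<gamma> S \<partial>law_at c k \<beta>)"

lemma measure_law_at_bounds:
  assumes "0 \<le> c" "\<beta> \<in> topspace (P_space c (Suc k))"
  shows "measure (law_at c k \<beta>) (space (law_at c k \<beta>)) \<le> c"
  using measures_leD(3)[OF law_at_measures_le[OF assms(2), of k]] assms(1)
  by (auto simp: measure_def intro: enn2real_leI)

lemma space_law_at:
  assumes "\<beta> \<in> topspace (P_space c (Suc k))"
  shows "space (law_at c k \<beta>) = topspace (P_space c k)" "sets (law_at c k \<beta>) = sets (borel_of (P_space c k))"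
    "finite_measure (law_at c k \<beta>)"
  using measures_leD(1,2)[OF law_at_measures_le[OF assms, of k]] measures_le_finite[OF law_at_measures_le[OF assms, of k]]
  by auto

lemma tree_mean_measurable_bounded:
  assumes c: "0 \<le> c"
    and m: "(\<lambda>\<beta>. tree_prob c k \<beta> S) \<in> borel_measurable (borel_of (P_space c k))"
    and b: "\<forall>\<beta>\<in>topspace (P_space c k). 0 \<le> tree_prob c k \<beta> S \<and> tree_prob c k \<beta> S \<le> b"
  shows "(\<lambda>\<beta>. tree_mean c k \<beta> S) \<in> borel_measurable (borel_of (P_space c (Suc k)))"
    and "\<exists>b. \<forall>\<beta>\<in>topspace (P_space c (Suc k)). 0 \<le> tree_mean c k \<beta> S \<and> tree_mean c k \<beta> S \<le> b"
proof -
  show "(\<lambda>\<beta>. tree_mean c k \<beta> S) \<in> borel_measurable (borel_of (P_space c (Suc k)))"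
    unfolding tree_mean_def using m b space_law_at(2)
    by (intro integral_kernel_measurable[where N = "borel_of (P_space c k)"] emeasure_law_at_measurable) auto
  have "0 \<le> tree_mean c k \<beta> S \<and> tree_mean c k \<beta> S \<le> \<bar>b\<bar> * c" if \<beta>: "\<beta> \<in> topspace (P_space c (Suc k))" for \<beta>
  proof -
    note S = space_law_at[OF \<beta>]
    interpret finite_measure "law_at c k \<beta>" by (rule S(3))
    have m': "(\<lambda>\<gamma>. tree_prob c k \<gamma> S) \<in> borel_measurable (law_at c k \<beta>)"
      using m by (simp add: measurable_cong_sets[OF S(2) refl])
    have "integrable (law_at c k \<beta>) (\<lambda>\<gamma>. tree_prob c k \<gamma> S)"
      using b m' by (intro integrable_const_bound[of _ b] AE_I2) (auto simp: S)
    then have "tree_mean c k \<beta> S \<le> (\<integral>\<gamma>. \<bar>b\<bar> \<partial>law_at c k \<beta>)"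
      unfolding tree_mean_def using b by (intro integral_mono) (auto simp: S intro: order_trans[OF _ abs_ge_self])
    also have "\<dots> \<le> \<bar>b\<bar> * c"
      using mult_left_mono[OF measure_law_at_bounds[OF c \<beta>], of "\<bar>b\<bar>"] by (simp add: mult.commute)
    finally show ?thesis unfolding tree_mean_def using b by (auto intro!: integral_nonneg_AE AE_I2 simp: S)
  qed
  then show "\<exists>b. \<forall>\<beta>\<in>topspace (P_space c (Suc k)). 0 \<le> tree_mean c k \<beta> S \<and> tree_mean c k \<beta> S \<le> b" by blast
qed

lemma exp_mass_measurable:
  "(\<lambda>\<beta>. exp (- measure (law_at c k \<beta>) (space (law_at c k \<beta>)))) \<in> borel_measurable (borel_of (P_space c (Suc k)))"
proof (rule measurable_transfer)
  show "(\<lambda>\<beta>. exp (- enn2real (emeasure (law_at c k \<beta>) (topspace (P_space c k)))))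
    \<in> borel_measurable (borel_of (P_space c (Suc k)))"
    using emeasure_law_at_measurable[OF openin_sets_borel_of[OF openin_topspace], of c k] by measurable
qed (auto simp: space_law_at measure_def)

lemma tree_prob_measurable_bounded:
  assumes c: "0 \<le> c"
  shows "(\<lambda>\<beta>. tree_prob c k \<beta> T) \<in> borel_measurable (borel_of (P_space c k)) \<and>
    (\<exists>b. \<forall>\<beta>\<in>topspace (P_space c k). 0 \<le> tree_prob c k \<beta> T \<and> tree_prob c k \<beta> T \<le> b)"
proof (induction k arbitrary: T)
  case 0
  show ?case by (auto intro!: exI[of _ 1])
next
  case (Suc k)
  have mean: "(\<lambda>\<beta>. tree_mean c k \<beta> S) \<in> borel_measurable (borel_of (P_space c (Suc k)))"
    "\<exists>b. \<forall>\<beta>\<in>topspace (P_space c (Suc k)). 0 \<le> tree_mean c k \<beta> S \<and> tree_mean c k \<beta> S \<le> b" for S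
    using tree_mean_measurable_bounded[OF c] Suc by blast+
  obtain m where T: "T = Node m" by (cases T)
  obtain b where b: "\<forall>\<beta>\<in>topspace (P_space c (Suc k)). 0 \<le> (\<Prod>S\<in>#m. tree_mean c k \<beta> S) \<and>
      (\<Prod>S\<in>#m. tree_mean c k \<beta> S) \<le> b"
    using prod_mset_bounded[of "topspace (P_space c (Suc k))" "\<lambda>S \<beta>. tree_mean c k \<beta> S" m] mean(2) by blast
  let ?e = "\<lambda>\<beta>. exp (- measure (law_at c k \<beta>) (space (law_at c k \<beta>)))"
  have eq: "tree_prob c (Suc k) \<beta> T = tree_weight m * ?e \<beta> * (\<Prod>S\<in>#m. tree_mean c k \<beta> S)" for \<beta>
    by (simp add: T tree_mean_def)
  have "0 \<le> tree_prob c (Suc k) \<beta> T \<and> tree_prob c (Suc k) \<beta> T \<le> tree_weight m * 1 * b"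
    if "\<beta> \<in> topspace (P_space c (Suc k))" for \<beta>
    unfolding eq using that b tree_weight_pos[of m]
    by (intro conjI mult_mono mult_nonneg_nonneg) (auto intro: less_imp_le)
  moreover have "(\<lambda>\<beta>. tree_prob c (Suc k) \<beta> T) \<in> borel_measurable (borel_of (P_space c (Suc k)))"
    unfolding eq using mean(1) by (intro borel_measurable_times prod_mset_measurable exp_mass_measurable) auto
  ultimately show ?case by blast
qed

lemma tree_prob_Suc:
  "tree_prob c (Suc k) \<beta> (Node m) = tree_weight m *
     exp (- measure (law_at c k \<beta>) (space (law_at c k \<beta>))) * (\<Prod>S\<in>#m. tree_mean c k \<beta> S)"
  by (simp add: tree_mean_def)

lemma tree_mean_measurable:
  "0 \<le> c \<Longrightarrow> (\<lambda>\<beta>. tree_mean c k \<beta> S) \<in> borel_measurable (borel_of (P_space c (Suc k)))"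
  using tree_mean_measurable_bounded(1) tree_prob_measurable_bounded by blast

lemma tree_mean_bounded:
  "0 \<le> c \<Longrightarrow> \<exists>b. \<forall>\<beta>\<in>topspace (P_space c (Suc k)). 0 \<le> tree_mean c k \<beta> S \<and> tree_mean c k \<beta> S \<le> b"
  using tree_mean_measurable_bounded(2) tree_prob_measurable_bounded by blast

text \<open>In the inductive step the mixture yields the moments of the family of the Poisson
  parameters \<open>tree_mean\<close>, and by the induction hypothesis these parameters generate the
  Borel sets.\<close>

lemma kernel_measurable_of_tree_prob:
  fixes \<Omega> :: "(nat \<Rightarrow> point) measure" and \<kappa> :: "(nat \<Rightarrow> point) \<Rightarrow> (nat \<Rightarrow> point) measure"
  assumes c: "0 \<le> c"
    and "\<And>\<omega>. \<omega> \<in> space \<Omega> \<Longrightarrow> finite_measure (\<kappa> \<omega>)"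
    and "\<And>\<omega>. \<omega> \<in> space \<Omega> \<Longrightarrow> sets (\<kappa> \<omega>) = sets (borel_of (P_space c k))"
    and "\<And>T. (\<lambda>\<omega>. \<integral>\<beta>. tree_prob c k \<beta> T \<partial>\<kappa> \<omega>) \<in> borel_measurable \<Omega>"
    and "A \<in> sets (borel_of (P_space c k))"
  shows "(\<lambda>\<omega>. emeasure (\<kappa> \<omega>) A) \<in> borel_measurable \<Omega>"
  using assms(2-)
proof (induction k arbitrary: \<Omega> \<kappa> A)
  case 0
  have "A \<subseteq> topspace (P_space c 0)" using sets.sets_into_space[OF 0(4)] by simp
  \<comment> \<open>The space is a single point, so only the total mass matters, and that is the
    integral of the probability of the one-vertex tree.\<close>
  then consider "A = {}" | "A = topspace (P_space c 0)" unfolding topspace_P_space_0 by blast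
  then show ?case
  proof cases
    case 2
    have "emeasure (\<kappa> \<omega>) A = ennreal (\<integral>\<beta>. tree_prob c 0 \<beta> (Node {#}) \<partial>\<kappa> \<omega>)" if "\<omega> \<in> space \<Omega>" for \<omega>
    proof -
      interpret finite_measure "\<kappa> \<omega>" by (rule 0(1)[OF that])
      show ?thesis using sets_eq_imp_space_eq[OF 0(2)[OF that]] 2 by (simp add: emeasure_eq_measure)
    qed
    moreover have "(\<lambda>\<omega>. ennreal (\<integral>\<beta>. tree_prob c 0 \<beta> (Node {#}) \<partial>\<kappa> \<omega>)) \<in> borel_measurable \<Omega>"
      using 0(3)[of "Node {#}"] by (rule measurable_compose) measurable
    ultimately show ?thesis by (rule measurable_transfer)
  qed simp
next
  case (Suc k)
  let ?S = "topspace (P_space c (Suc k))"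
  let ?N = "borel_of (P_space c (Suc k))"
  let ?h = "\<lambda>m \<beta>. \<Prod>S\<in>#m. tree_mean c k \<beta> S"
  let ?H = "range ?h"
  \<comment> \<open>The factor common to all tree probabilities; up to the constant
    \<open>tree_weight m\<close>, the probability of \<open>Node m\<close> is \<open>?h m\<close>
    times \<open>w\<close>.\<close>
  define w where "w \<beta> = exp (- measure (law_at c k \<beta>) (space (law_at c k \<beta>)))" for \<beta>
  have w: "0 < w \<beta>" "w \<beta> \<le> 1" for \<beta> by (auto simp: w_def)
  have wm [measurable]: "w \<in> borel_measurable ?N" unfolding w_def by (rule exp_mass_measurable)
  interpret multiplicative_class ?S ?H
  proof
    fix h assume "h \<in> ?H"
    then obtain m where h: "h = ?h m" by blast
    obtain b where "\<forall>\<beta>\<in>?S. 0 \<le> ?h m \<beta> \<and> ?h m \<beta> \<le> b"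
      using prod_mset_bounded[of ?S "\<lambda>S \<beta>. tree_mean c k \<beta> S" m] tree_mean_bounded[OF c] by blast
    then show "\<exists>b. \<forall>x\<in>?S. \<bar>h x\<bar> \<le> b" unfolding h by auto
  next
    fix f g assume "f \<in> ?H" "g \<in> ?H"
    then obtain m n where "f = ?h m" "g = ?h n" by blast
    \<comment> \<open>Indexing monomials by multisets turns multiplication into the sum of
      multisets.\<close>
    then have "(\<lambda>x. f x * g x) = ?h (m + n)" by simp
    then show "(\<lambda>x. f x * g x) \<in> ?H" by blast
  next
    have "(\<lambda>_. 1) = ?h {#}" by simp
    then show "(\<lambda>_. 1) \<in> ?H" by blast
  qed
  obtain \<Sigma> where \<Sigma>: "space \<Sigma> = ?S" "\<And>h. h \<in> ?H \<Longrightarrow> h \<in> borel_measurable \<Sigma>"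
    "\<And>A. A \<in> sets \<Sigma> \<Longrightarrow> indicator A \<in> cl" by (rule obtain_sigma_algebra) (rule that)
  \<comment> \<open>Here the freedom in the parameter space is used: the induction hypothesis is
    applied to \<Sigma> with the coded law as kernel. Its tree probabilities are the monomials of
    degree one, measurable by the choice of \<Sigma>.\<close>
  have law: "(\<lambda>\<beta>. emeasure (law_at c k \<beta>) B) \<in> borel_measurable \<Sigma>" if "B \<in> sets (borel_of (P_space c k))" for B
  proof (rule Suc.IH[OF _ _ _ that])
    fix T
    have "?h {#T#} \<in> borel_measurable \<Sigma>" by (rule \<Sigma>(2)) blast
    then show "(\<lambda>\<beta>. \<integral>\<gamma>. tree_prob c k \<gamma> T \<partial>law_at c k \<beta>) \<in> borel_measurable \<Sigma>" by (simp add: tree_mean_def)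
  qed (auto simp: \<Sigma>(1) space_law_at)
  \<comment> \<open>Measurability of the identity says that \<Sigma> contains every Borel set of the
    space, so all Borel indicators lie in the closure of the monomials.\<close>
  have id: "(\<lambda>\<beta>. \<beta>) \<in> measurable \<Sigma> ?N"
    using law by (intro measurable_P_space_SucI) (auto simp: \<Sigma>(1))
  have ind: "indicator B \<in> cl" if "B \<in> sets ?N" for B
  proof (rule \<Sigma>(3))
    have "B \<subseteq> ?S" using sets.sets_into_space[OF that] by simp
    then show "B \<in> sets \<Sigma>" using measurable_sets[OF id that] by (simp add: \<Sigma>(1) Int_absorb2)
  qed
  have fin: "finite_measure (\<kappa> \<omega>)" and sk: "sets (\<kappa> \<omega>) = sets ?N" and sp: "space (\<kappa> \<omega>) = ?S" if "\<omega> \<in> space \<Omega>" for \<omega>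
    using Suc.prems(1,2)[OF that] sets_eq_imp_space_eq[OF Suc.prems(2)[OF that]] by auto
  have integrable: "integrable (\<kappa> \<omega>) (\<lambda>\<beta>. f \<beta> * w \<beta>)"
    if f: "f \<in> cl" "f \<in> borel_measurable ?N" and \<omega>: "\<omega> \<in> space \<Omega>" for f \<omega>
  proof -
    interpret finite_measure "\<kappa> \<omega>" by (rule fin[OF \<omega>])
    obtain b where b: "\<forall>x\<in>?S. \<bar>f x\<bar> \<le> b" using bounded_cl[OF f(1)] by blast
    show ?thesis
    proof (rule integrable_const_bound[of _ b])
      show "AE \<beta> in \<kappa> \<omega>. norm (f \<beta> * w \<beta>) \<le> b"
      proof (rule AE_I2)
        fix \<beta> assume "\<beta> \<in> space (\<kappa> \<omega>)"
        then have "\<bar>f \<beta>\<bar> * \<bar>w \<beta>\<bar> \<le> b * 1" using b w[of \<beta>] sp[OF \<omega>] by (intro mult_mono') auto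
        then show "norm (f \<beta> * w \<beta>) \<le> b" by (simp add: abs_mult)
      qed
      show "(\<lambda>\<beta>. f \<beta> * w \<beta>) \<in> borel_measurable (\<kappa> \<omega>)"
        unfolding measurable_cong_sets[OF sk[OF \<omega>] refl] using f(2) by measurable
    qed
  qed
  \<comment> \<open>For monomials this is the assumption on tree probabilities, divided by the
    positive \<open>tree_weight m\<close>; the rules of the closure preserve it.\<close>
  have moments: "f \<in> borel_measurable ?N \<and> (\<lambda>\<omega>. \<integral>\<beta>. f \<beta> * w \<beta> \<partial>\<kappa> \<omega>) \<in> borel_measurable \<Omega>"
    if "f \<in> cl" for f
    using that
  proof (induction rule: limit_closure.induct)
    case (base h)
    then obtain m where h: "h = ?h m" by blast
    have "h \<in> borel_measurable ?N" unfolding h by (intro prod_mset_measurable tree_mean_measurable c)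
    moreover have "(\<lambda>\<beta>. h \<beta> * w \<beta>) = (\<lambda>\<beta>. inverse (tree_weight m) * tree_prob c (Suc k) \<beta> (Node m))"
      unfolding tree_prob_Suc w_def h using tree_weight_pos[of m] by (auto simp: field_simps)
    ultimately show ?case using Suc.prems(3)[of "Node m"] by simp
  next
    case (lin f g a b)
    have "(\<integral>\<beta>. (a * f \<beta> + b * g \<beta>) * w \<beta> \<partial>\<kappa> \<omega>) = a * (\<integral>\<beta>. f \<beta> * w \<beta> \<partial>\<kappa> \<omega>) + b * (\<integral>\<beta>. g \<beta> * w \<beta> \<partial>\<kappa> \<omega>)"
      if \<omega>: "\<omega> \<in> space \<Omega>" for \<omega>
    proof -
      have "(\<integral>\<beta>. (a * f \<beta> + b * g \<beta>) * w \<beta> \<partial>\<kappa> \<omega>) = (\<integral>\<beta>. a * (f \<beta> * w \<beta>) + b * (g \<beta> * w \<beta>) \<partial>\<kappa> \<omega>)"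
        by (simp add: algebra_simps)
      also have "\<dots> = a * (\<integral>\<beta>. f \<beta> * w \<beta> \<partial>\<kappa> \<omega>) + b * (\<integral>\<beta>. g \<beta> * w \<beta> \<partial>\<kappa> \<omega>)"
        using integrable[of f \<omega>] integrable[of g \<omega>] lin.hyps lin.IH \<omega> by simp
      finally show ?thesis .
    qed
    moreover have "(\<lambda>\<omega>. a * (\<integral>\<beta>. f \<beta> * w \<beta> \<partial>\<kappa> \<omega>) + b * (\<integral>\<beta>. g \<beta> * w \<beta> \<partial>\<kappa> \<omega>)) \<in> borel_measurable \<Omega>"
      using lin.IH by (intro borel_measurable_add borel_measurable_times measurable_const) auto
    ultimately have "(\<lambda>\<omega>. \<integral>\<beta>. (a * f \<beta> + b * g \<beta>) * w \<beta> \<partial>\<kappa> \<omega>) \<in> borel_measurable \<Omega>" by (rule measurable_transfer)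
    moreover have "(\<lambda>x. a * f x + b * g x) \<in> borel_measurable ?N"
      using lin.IH by (intro borel_measurable_add borel_measurable_times measurable_const) auto
    ultimately show ?case by simp
  next
    case (lim f b g)
    have gm: "g \<in> borel_measurable ?N"
      by (rule borel_measurable_LIMSEQ_real[where u = f]) (use lim.hyps lim.IH in auto)
    have "(\<lambda>n. \<integral>\<beta>. f n \<beta> * w \<beta> \<partial>\<kappa> \<omega>) \<longlonglongrightarrow> (\<integral>\<beta>. g \<beta> * w \<beta> \<partial>\<kappa> \<omega>)" if \<omega>: "\<omega> \<in> space \<Omega>" for \<omega>
    proof (rule integral_dominated_convergence[where w = "\<lambda>_. b"])
      interpret finite_measure "\<kappa> \<omega>" by (rule fin[OF \<omega>])
      show "integrable (\<kappa> \<omega>) (\<lambda>_. b)" by simp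
      show "AE \<beta> in \<kappa> \<omega>. norm (f n \<beta> * w \<beta>) \<le> b" for n
      proof (rule AE_I2)
        fix \<beta> assume "\<beta> \<in> space (\<kappa> \<omega>)"
        then have "\<bar>f n \<beta>\<bar> * \<bar>w \<beta>\<bar> \<le> b * 1" using lim.hyps(2)[of \<beta> n] w[of \<beta>] sp[OF \<omega>] by (intro mult_mono') auto
        then show "norm (f n \<beta> * w \<beta>) \<le> b" by (simp add: abs_mult)
      qed
      show "AE \<beta> in \<kappa> \<omega>. (\<lambda>n. f n \<beta> * w \<beta>) \<longlonglongrightarrow> g \<beta> * w \<beta>"
        using lim.hyps(3) sp[OF \<omega>] by (intro AE_I2 tendsto_intros) auto
      show "(\<lambda>\<beta>. g \<beta> * w \<beta>) \<in> borel_measurable (\<kappa> \<omega>)"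
        unfolding measurable_cong_sets[OF sk[OF \<omega>] refl] using gm by measurable
      show "(\<lambda>\<beta>. f n \<beta> * w \<beta>) \<in> borel_measurable (\<kappa> \<omega>)" for n
        unfolding measurable_cong_sets[OF sk[OF \<omega>] refl] using lim.IH[of n] by (intro borel_measurable_times wm) auto
    qed
    then have "(\<lambda>\<omega>. \<integral>\<beta>. g \<beta> * w \<beta> \<partial>\<kappa> \<omega>) \<in> borel_measurable \<Omega>"
      by (rule borel_measurable_LIMSEQ_real) (use lim.IH in auto)
    with gm show ?case by simp
  qed
  \<comment> \<open>Only the measure with density \<open>w\<close> is reached by the moments;
    integrating the reciprocal of \<open>w\<close> against it recovers the original kernel.\<close>
  define \<kappa>' where "\<kappa>' \<omega> = density (\<kappa> \<omega>) (\<lambda>\<beta>. ennreal (w \<beta>))" for \<omega>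
  have wk: "(\<lambda>\<beta>. ennreal (w \<beta>)) \<in> borel_measurable (\<kappa> \<omega>)" if "\<omega> \<in> space \<Omega>" for \<omega>
    unfolding measurable_cong_sets[OF sk[OF that] refl] by measurable
  have \<kappa>'m: "(\<lambda>\<omega>. emeasure (\<kappa>' \<omega>) B) \<in> borel_measurable \<Omega>" if B: "B \<in> sets ?N" for B
  proof (rule measurable_transfer)
    have im: "indicat_real B \<in> borel_measurable ?N" using B by simp
    show "(\<lambda>\<omega>. ennreal (\<integral>\<beta>. indicator B \<beta> * w \<beta> \<partial>\<kappa> \<omega>)) \<in> borel_measurable \<Omega>"
      using moments[OF ind[OF B]] by (intro measurable_compose[OF _ measurable_ennreal]) auto
    fix \<omega> assume \<omega>: "\<omega> \<in> space \<Omega>"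
    have "emeasure (\<kappa>' \<omega>) B = (\<integral>\<^sup>+ \<beta>. ennreal (w \<beta>) * indicator B \<beta> \<partial>\<kappa> \<omega>)"
      unfolding \<kappa>'_def using B sk[OF \<omega>] by (intro emeasure_density wk[OF \<omega>]) auto
    also have "\<dots> = (\<integral>\<^sup>+ \<beta>. ennreal (indicator B \<beta> * w \<beta>) \<partial>\<kappa> \<omega>)"
      by (intro nn_integral_cong) (simp add: indicator_def)
    also have "\<dots> = ennreal (\<integral>\<beta>. indicator B \<beta> * w \<beta> \<partial>\<kappa> \<omega>)"
      using w by (intro nn_integral_eq_integral integrable[OF ind[OF B] im \<omega>] AE_I2) (simp add: less_imp_le)
    finally show "emeasure (\<kappa>' \<omega>) B = ennreal (\<integral>\<beta>. indicator B \<beta> * w \<beta> \<partial>\<kappa> \<omega>)" .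
  qed
  let ?f = "\<lambda>\<beta>. ennreal (inverse (w \<beta>)) * indicator A \<beta>"
  have fm: "?f \<in> borel_measurable ?N" using Suc.prems(4) by measurable
  have "(\<lambda>\<omega>. \<integral>\<^sup>+ \<beta>. ?f \<beta> \<partial>\<kappa>' \<omega>) \<in> borel_measurable \<Omega>"
    using sk \<kappa>'m fm by (intro nn_integral_kernel_measurable[where N = ?N]) (auto simp: \<kappa>'_def)
  moreover have "emeasure (\<kappa> \<omega>) A = (\<integral>\<^sup>+ \<beta>. ?f \<beta> \<partial>\<kappa>' \<omega>)" if \<omega>: "\<omega> \<in> space \<Omega>" for \<omega>
  proof -
    have "(\<integral>\<^sup>+ \<beta>. ?f \<beta> \<partial>\<kappa>' \<omega>) = (\<integral>\<^sup>+ \<beta>. ennreal (w \<beta>) * ?f \<beta> \<partial>\<kappa> \<omega>)"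
      unfolding \<kappa>'_def using fm by (intro nn_integral_density wk[OF \<omega>]) (simp add: measurable_cong_sets[OF sk[OF \<omega>] refl])
    also have "\<dots> = (\<integral>\<^sup>+ \<beta>. indicator A \<beta> \<partial>\<kappa> \<omega>)"
    proof (rule nn_integral_cong)
      fix \<beta>
      have "ennreal (w \<beta>) * ennreal (inverse (w \<beta>)) = 1"
        using w(1)[of \<beta>] by (simp add: ennreal_mult[symmetric] less_imp_le)
      then show "ennreal (w \<beta>) * ?f \<beta> = indicator A \<beta>" by (simp add: mult.assoc[symmetric])
    qed
    also have "\<dots> = emeasure (\<kappa> \<omega>) A" using Suc.prems(4) sk[OF \<omega>] by simp
    finally show ?thesis by simp
  qed
  ultimately show ?case by (rule measurable_transfer[rotated])
qed

text \<open>The two measures are read as one kernel with two values. Over the trivial sigma-algebra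
  its tree probabilities are measurable because they are constant, and measurability of its
  evaluations then forces the two values to agree.\<close>

lemma measure_eq_of_tree_prob:
  assumes c: "0 \<le> c" and fin: "finite_measure \<alpha>" "finite_measure \<beta>"
    and s: "sets \<alpha> = sets (borel_of (P_space c k))" "sets \<beta> = sets (borel_of (P_space c k))"
    and eq: "\<And>T. (\<integral>\<gamma>. tree_prob c k \<gamma> T \<partial>\<alpha>) = (\<integral>\<gamma>. tree_prob c k \<gamma> T \<partial>\<beta>)"
  shows "\<alpha> = \<beta>"
proof (rule measure_eqI)
  fix A assume A: "A \<in> sets \<alpha>"
  \<comment> \<open>Any two distinct parameters serve. Their type is that of points because the
    induction used here applies its hypothesis to the tower's own spaces.\<close>
  define z :: "nat \<Rightarrow> point" where "z = (\<lambda>_ _. 0)"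
  define u :: "nat \<Rightarrow> point" where "u = (\<lambda>_ _. 1)"
  have zo: "u \<noteq> z" by (auto simp: z_def u_def fun_eq_iff)
  \<comment> \<open>Functions that are measurable for the trivial \<open>\<sigma>\<close>-algebra are constant.\<close>
  define \<Omega> :: "(nat \<Rightarrow> point) measure" where "\<Omega> = sigma UNIV {}"
  define \<kappa> where "\<kappa> \<omega> = (if \<omega> = z then \<alpha> else \<beta>)" for \<omega>
  have m: "(\<lambda>\<omega>. emeasure (\<kappa> \<omega>) A) \<in> borel_measurable \<Omega>"
  proof (rule kernel_measurable_of_tree_prob[OF c])
    show "(\<lambda>\<omega>. \<integral>\<gamma>. tree_prob c k \<gamma> T \<partial>\<kappa> \<omega>) \<in> borel_measurable \<Omega>" for T
      by (rule measurable_transfer[of _ _ "\<lambda>_. \<integral>\<gamma>. tree_prob c k \<gamma> T \<partial>\<alpha>"]) (auto simp: \<kappa>_def eq)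
  qed (use A s fin in \<open>auto simp: \<kappa>_def\<close>)
  have "(\<lambda>\<omega>. emeasure (\<kappa> \<omega>) A) -` {emeasure \<alpha> A} \<inter> space \<Omega> \<in> sets \<Omega>"
    by (rule measurable_sets[OF m]) simp
  moreover have "sets \<Omega> = {{}, UNIV}" by (simp add: \<Omega>_def sigma_sets_empty_eq)
  moreover have "z \<in> (\<lambda>\<omega>. emeasure (\<kappa> \<omega>) A) -` {emeasure \<alpha> A} \<inter> space \<Omega>" by (simp add: \<kappa>_def \<Omega>_def)
  ultimately have "u \<in> (\<lambda>\<omega>. emeasure (\<kappa> \<omega>) A) -` {emeasure \<alpha> A} \<inter> space \<Omega>" by auto
  then show "emeasure \<alpha> A = emeasure \<beta> A" using zo by (simp add: \<kappa>_def)
qed (use s in simp)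

section \<open>The law of the tree\<close>

text \<open>The height bound is exclusive: level 0 is empty and the one-vertex tree first appears at
  level 1.\<close>

primrec rtrees_of_height :: "nat \<Rightarrow> rtree set" where
  "rtrees_of_height 0 = {}"
| "rtrees_of_height (Suc n) = Node ` {m. set_mset m \<subseteq> rtrees_of_height n}"

lemma rtrees_of_height_mono: "n \<le> k \<Longrightarrow> rtrees_of_height n \<subseteq> rtrees_of_height k"
proof (induction n arbitrary: k)
  case (Suc n)
  then obtain j where "k = Suc j" "n \<le> j" by (cases k) auto
  then show ?case using Suc.IH[of j] by auto
qed simp

lemma countable_rtrees_of_height: "countable (rtrees_of_height n)"
proof (induction n)
  case (Suc n)
  have "{m. set_mset m \<subseteq> rtrees_of_height n} \<subseteq> mset ` lists (rtrees_of_height n)"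
  proof
    fix m assume m: "m \<in> {m. set_mset m \<subseteq> rtrees_of_height n}"
    obtain xs where "mset xs = m" using ex_mset by blast
    then show "m \<in> mset ` lists (rtrees_of_height n)" using m by (intro image_eqI[of _ _ xs]) auto
  qed
  then have "countable {m. set_mset m \<subseteq> rtrees_of_height n}"
    by (rule countable_subset) (intro countable_image countable_lists Suc)
  then show ?case by simp
qed simp

lemma rtree_has_height: "\<exists>n. T \<in> rtrees_of_height n"
proof (induction T)
  case (Node m)
  obtain h where h: "\<And>S. S \<in># m \<Longrightarrow> S \<in> rtrees_of_height (h S)" using Node by metis
  \<comment> \<open>For empty \<open>m\<close> the maximum is unspecified, but the claim is then
    vacuous.\<close>
  have "S \<in> rtrees_of_height (Max (h ` set_mset m))" if "S \<in># m" for S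
    using h[OF that] rtrees_of_height_mono[of "h S" "Max (h ` set_mset m)"] that by auto
  then have "Node m \<in> rtrees_of_height (Suc (Max (h ` set_mset m)))" by auto
  then show ?case by blast
qed

instance rtree :: countable
proof
  have "(UNIV :: rtree set) = (\<Union>n. rtrees_of_height n)" using rtree_has_height by auto
  moreover have "countable (\<Union>n. rtrees_of_height n)" by (intro countable_UN countable_rtrees_of_height countableI_type)
  ultimately have "countable (UNIV :: rtree set)" by (simp only:)
  then show "\<exists>f :: rtree \<Rightarrow> nat. inj f" unfolding countable_def .
qed

section \<open>Independent trees attached to a fixed number of types\<close>

lemma measurable_subprob_count_space:
  fixes K :: "'a \<Rightarrow> 'b::countable measure"
  assumes "\<And>x. x \<in> space M \<Longrightarrow> prob_space (K x)"
    and s: "\<And>x. x \<in> space M \<Longrightarrow> sets (K x) = UNIV"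
    and m: "\<And>b. (\<lambda>x. emeasure (K x) {b}) \<in> borel_measurable M"
  shows "K \<in> measurable M (subprob_algebra (count_space UNIV))"
proof (rule measurable_subprob_algebra)
  fix x assume "x \<in> space M"
  then show "subprob_space (K x)" using assms(1) prob_space_imp_subprob_space by blast
next
  fix x assume "x \<in> space M" then show "sets (K x) = sets (count_space UNIV)" using s by simp
next
  fix A :: "'b set"
  interpret C: sigma_finite_measure "count_space A" by (rule sigma_finite_measure_count_space_countable) simp
  have "(\<lambda>(x, b). emeasure (K x) {b}) \<in> borel_measurable (M \<Otimes>\<^sub>M count_space A)"
    unfolding measurable_pair_swap_iff[of _ M]
    by (rule measurable_pair_measure_countable1) (use m in auto)
  then have "(\<lambda>x. \<integral>\<^sup>+ b. emeasure (K x) {b} \<partial>count_space A) \<in> borel_measurable M"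
    by (rule C.borel_measurable_nn_integral[of "\<lambda>x b. emeasure (K x) {b}"])
  then show "(\<lambda>x. emeasure (K x) A) \<in> borel_measurable M"
    by (rule measurable_transfer[rotated]) (use s in \<open>auto intro!: emeasure_countable_singleton\<close>)
qed

lemma measurable_PiM_coordinate:
  "f \<in> measurable N B \<Longrightarrow> i \<in> I \<Longrightarrow> (\<lambda>y. f (y i)) \<in> measurable (\<Pi>\<^sub>M i\<in>I. N) B"
  by (rule measurable_compose[OF measurable_component_singleton[of i I "\<lambda>_. N"]])

text \<open>The inner law in the recursion of \<open>tree_ball_from\<close>, with a general kernel
  in place of the law of fixed depth.\<close>

definition forest :: "('a \<Rightarrow> rtree measure) \<Rightarrow> nat \<Rightarrow> (nat \<Rightarrow> 'a) \<Rightarrow> rtree measure" where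
  "forest K n y = distr (\<Pi>\<^sub>M i\<in>{..<n}. K (y i)) (count_space UNIV) (\<lambda>t. Node (image_mset t (mset_set {..<n})))"

locale tree_law_kernel =
  fixes M :: "'a measure" and K :: "'a \<Rightarrow> rtree measure"
  assumes prob_K: "\<And>x. x \<in> space M \<Longrightarrow> prob_space (K x)"
    and sets_K: "\<And>x. x \<in> space M \<Longrightarrow> sets (K x) = UNIV"
    and measurable_K: "\<And>T. (\<lambda>x. emeasure (K x) {T}) \<in> borel_measurable M"
begin

context
  fixes y :: "nat \<Rightarrow> 'a"
  assumes y: "\<And>i. y i \<in> space M"
begin

interpretation product_prob_space "\<lambda>i. K (y i)" UNIV
  by (intro product_prob_spaceI prob_K y)

lemma space_K [simp]: "space (K (y i)) = UNIV"
  using sets_eq_imp_space_eq[of "K (y i)" "count_space UNIV"] sets_K[OF y] by simp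

lemma singleton_product:
  assumes "t \<in> PiE {..<n} (\<lambda>_. UNIV)"
  shows "{t} \<in> sets (\<Pi>\<^sub>M i\<in>{..<n}. K (y i))"
    "emeasure (\<Pi>\<^sub>M i\<in>{..<n}. K (y i)) {t} = (\<Prod>i<n. emeasure (K (y i)) {t i})"
proof -
  have t: "{t} = PiE {..<n} (\<lambda>i. {t i})" using assms by (simp add: PiE_singleton PiE_iff)
  show "{t} \<in> sets (\<Pi>\<^sub>M i\<in>{..<n}. K (y i))"
    unfolding t by (intro sets_PiM_I_finite) (auto simp: sets_K[OF y])
  show "emeasure (\<Pi>\<^sub>M i\<in>{..<n}. K (y i)) {t} = (\<Prod>i<n. emeasure (K (y i)) {t i})"
    unfolding t by (subst emeasure_PiM) (auto simp: sets_K[OF y])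
qed

lemma vimage_forest:
  "(\<lambda>t. Node (image_mset t (mset_set {..<n}))) -` {Node m} \<inter> space (\<Pi>\<^sub>M i\<in>{..<n}. K (y i)) =
    (if size m = n then labelings m else {})"
proof -
  have "size m = n" if "image_mset t (mset_set {..<n}) = m" for t
    using arg_cong[OF that, of size] by simp
  then show ?thesis unfolding space_PiM labelings_def space_K by (cases "size m = n") auto
qed

lemma labelings_product:
  shows "labelings m \<in> sets (\<Pi>\<^sub>M i\<in>{..<size m}. K (y i))"
    "emeasure (\<Pi>\<^sub>M i\<in>{..<size m}. K (y i)) (labelings m) = (\<Sum>t\<in>labelings m. \<Prod>i<size m. emeasure (K (y i)) {t i})"
proof -
  have s: "{t} \<in> sets (\<Pi>\<^sub>M i\<in>{..<size m}. K (y i))" if "t \<in> labelings m" for t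
    using that by (intro singleton_product) (simp add: labelings_def)
  have "(\<Union>t\<in>labelings m. {t}) \<in> sets (\<Pi>\<^sub>M i\<in>{..<size m}. K (y i))"
    by (intro sets.finite_UN finite_labelings s)
  then show "labelings m \<in> sets (\<Pi>\<^sub>M i\<in>{..<size m}. K (y i))" by simp
  have "emeasure (\<Pi>\<^sub>M i\<in>{..<size m}. K (y i)) (labelings m) = (\<Sum>t\<in>labelings m. emeasure (\<Pi>\<^sub>M i\<in>{..<size m}. K (y i)) {t})"
    using s finite_labelings by (intro emeasure_eq_sum_singleton) auto
  also have "\<dots> = (\<Sum>t\<in>labelings m. \<Prod>i<size m. emeasure (K (y i)) {t i})"
    by (intro sum.cong refl singleton_product) (simp add: labelings_def)
  finally show "emeasure (\<Pi>\<^sub>M i\<in>{..<size m}. K (y i)) (labelings m) = (\<Sum>t\<in>labelings m. \<Prod>i<size m. emeasure (K (y i)) {t i})" .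
qed

text \<open>The preimage of a tree is empty or a finite set of labelings, and each labeling is a box
  of singletons.\<close>

lemma measurable_forest_map:
  "(\<lambda>t. Node (image_mset t (mset_set {..<n}))) \<in> measurable (\<Pi>\<^sub>M i\<in>{..<n}. K (y i)) (count_space UNIV)"
  unfolding measurable_count_space_eq2_countable
proof (intro conjI ballI)
  fix T :: rtree
  obtain m where T: "T = Node m" by (cases T)
  show "(\<lambda>t. Node (image_mset t (mset_set {..<n}))) -` {T} \<inter> space (\<Pi>\<^sub>M i\<in>{..<n}. K (y i)) \<in> sets (\<Pi>\<^sub>M i\<in>{..<n}. K (y i))"
    unfolding T vimage_forest using labelings_product(1)[of m] by auto
qed auto

lemma prob_space_forest: "prob_space (forest K n y)"
  unfolding forest_def
  by (intro prob_space.prob_space_distr measurable_forest_map prob_space_PiM prob_K y)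

lemma emeasure_forest:
  "emeasure (forest K n y) {Node m} =
    (if size m = n then \<Sum>t\<in>labelings m. \<Prod>i<n. emeasure (K (y i)) {t i} else 0)"
  unfolding forest_def
  by (subst emeasure_distr[OF measurable_forest_map]) (auto simp: vimage_forest labelings_product)

end

lemma forest_measurable:
  "(\<lambda>(n, y). forest K n y) \<in> measurable (count_space UNIV \<Otimes>\<^sub>M (\<Pi>\<^sub>M i\<in>UNIV. M)) (subprob_algebra (count_space UNIV))"
proof (rule measurable_pair_measure_countable1)
  fix n :: nat
  have y: "y i \<in> space M" if "y \<in> space (\<Pi>\<^sub>M i\<in>(UNIV::nat set). M)" for y i
    using that by (auto simp: space_PiM)
  have "forest K n \<in> measurable (\<Pi>\<^sub>M i\<in>UNIV. M) (subprob_algebra (count_space UNIV))"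
  proof (rule measurable_subprob_count_space)
    show "prob_space (forest K n y)" if "y \<in> space (\<Pi>\<^sub>M i\<in>UNIV. M)" for y
      using y[OF that] by (rule prob_space_forest)
    show "sets (forest K n y) = UNIV" for y by (simp add: forest_def)
    fix T :: rtree
    obtain m where T: "T = Node m" by (cases T)
    show "(\<lambda>y. emeasure (forest K n y) {T}) \<in> borel_measurable (\<Pi>\<^sub>M i\<in>UNIV. M)"
    proof (rule measurable_transfer)
      show "emeasure (forest K n y) {T} =
        (if size m = n then \<Sum>t\<in>labelings m. \<Prod>i<n. emeasure (K (y i)) {t i} else 0)"
        if "y \<in> space (\<Pi>\<^sub>M i\<in>UNIV. M)" for y
        unfolding T using y[OF that] by (rule emeasure_forest)
      have "(\<lambda>y. emeasure (K (y i)) {S}) \<in> borel_measurable (\<Pi>\<^sub>M i\<in>(UNIV::nat set). M)" for i S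
        using measurable_PiM_coordinate[OF measurable_K[of S], of i UNIV] by simp
      then show "(\<lambda>y. if size m = n then \<Sum>t\<in>labelings m. \<Prod>i<n. emeasure (K (y i)) {t i} else 0)
        \<in> borel_measurable (\<Pi>\<^sub>M i\<in>UNIV. M)"
        by (cases "size m = n") (simp_all add: borel_measurable_sum borel_measurable_prod_ennreal)
    qed
  qed
  then show "(\<lambda>y. case (n, y) of (n, y) \<Rightarrow> forest K n y) \<in> measurable (\<Pi>\<^sub>M i\<in>UNIV. M) (subprob_algebra (count_space UNIV))"
    by simp
qed simp

end

lemma prod_mset_div:
  fixes l :: "'i \<Rightarrow> real"
  assumes "d \<noteq> 0" shows "d ^ size m * (\<Prod>S\<in>#m. l S / d) = (\<Prod>S\<in>#m. l S)"
  by (induction m) (use assms in auto)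

lemma ennreal_prod_mset:
  fixes l :: "'i \<Rightarrow> real"
  assumes "\<And>S. 0 \<le> l S" shows "(\<Prod>S\<in>#m. ennreal (l S)) = ennreal (\<Prod>S\<in>#m. l S)"
proof -
  have "0 \<le> (\<Prod>S\<in>#m. l S)" for m using assms by (induction m) auto
  then show ?thesis using assms by (induction m) (auto simp: ennreal_mult)
qed

lemma labelings_prod:
  fixes g :: "rtree \<Rightarrow> 'c::comm_monoid_mult"
  assumes "t \<in> labelings m" shows "(\<Prod>i<size m. g (t i)) = (\<Prod>S\<in>#m. g S)"
proof -
  have t: "image_mset t (mset_set {..<size m}) = m" using assms by (simp add: labelings_def)
  have "(\<Prod>i<size m. g (t i)) = prod_mset (image_mset g (image_mset t (mset_set {..<size m})))"
    by (simp add: prod_unfold_prod_mset image_mset.compositionality o_def)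
  then show ?thesis unfolding t .
qed

lemma tree_weight_empty: "tree_weight {#} = 1"
proof -
  have "labelings {#} = {\<lambda>_. undefined}" by (auto simp: labelings_def)
  then show ?thesis by (simp add: tree_weight_def)
qed

text \<open>Only the first \<open>n\<close> coordinates enter, so the integral passes to the finite
  marginal, where it factors.\<close>

lemma nn_integral_PiM_prod:
  fixes f :: "nat \<Rightarrow> 'a \<Rightarrow> ennreal"
  assumes Q: "prob_space Q" and f: "\<And>i. f i \<in> borel_measurable Q"
  shows "(\<integral>\<^sup>+ y. (\<Prod>i<n. f i (y i)) \<partial>(\<Pi>\<^sub>M i\<in>UNIV. Q)) = (\<Prod>i<n. \<integral>\<^sup>+ z. f i z \<partial>Q)"
proof -
  interpret product_prob_space "\<lambda>_::nat. Q" UNIV by (intro product_prob_spaceI Q)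
  have fm: "(\<lambda>y. \<Prod>i<n. f i (y i)) \<in> borel_measurable (\<Pi>\<^sub>M i\<in>{..<n}. Q)"
  proof (rule borel_measurable_prod_ennreal)
    fix i assume "i \<in> {..<n}"
    then show "(\<lambda>y. f i (y i)) \<in> borel_measurable (\<Pi>\<^sub>M i\<in>{..<n}. Q)"
      by (rule measurable_PiM_coordinate[OF f])
  qed
  have "(\<integral>\<^sup>+ y. (\<Prod>i<n. f i (y i)) \<partial>(\<Pi>\<^sub>M i\<in>{..<n}. Q)) =
    (\<integral>\<^sup>+ y. (\<Prod>i<n. f i (y i)) \<partial>distr (\<Pi>\<^sub>M i\<in>UNIV. Q) (\<Pi>\<^sub>M i\<in>{..<n}. Q) (\<lambda>x. restrict x {..<n}))"
    by (subst distr_PiM_restrict_finite) auto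
  also have "\<dots> = (\<integral>\<^sup>+ y. (\<Prod>i<n. f i (restrict y {..<n} i)) \<partial>(\<Pi>\<^sub>M i\<in>UNIV. Q))"
    by (rule nn_integral_distr[OF measurable_restrict_subset[OF subset_UNIV]]) (simp add: fm)
  also have "\<dots> = (\<integral>\<^sup>+ y. (\<Prod>i<n. f i (y i)) \<partial>(\<Pi>\<^sub>M i\<in>UNIV. Q))" by simp
  finally show ?thesis using product_nn_integral_prod[of "{..<n}" f] f by simp
qed

section \<open>Poisson processes with independently attached trees\<close>

lemma sets_poisson_process:
  "sets (poisson_process L) = sets (count_space UNIV \<Otimes>\<^sub>M (\<Pi>\<^sub>M i\<in>UNIV. L))"
  unfolding poisson_process_def by (auto intro!: sets_pair_measure_cong sets_PiM_cong)

lemma prob_space_poisson_process: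
  assumes "space L \<noteq> {}" shows "prob_space (poisson_process L)"
proof (cases "0 < emeasure L (space L) \<and> emeasure L (space L) < \<infinity>")
  case True
  have "prob_space (uniform_measure L (space L))" using True by (intro prob_space_uniform_measure) auto
  then have "prob_space (\<Pi>\<^sub>M i\<in>(UNIV :: nat set). uniform_measure L (space L))" by (intro prob_space_PiM)
  then show ?thesis using True
    by (simp add: poisson_process_def prob_space_pair prob_space_measure_pmf)
next
  case False
  have "(SOME x. x \<in> space L) \<in> space L" using assms by (simp add: some_in_eq)
  then have "prob_space (return (count_space UNIV \<Otimes>\<^sub>M (\<Pi>\<^sub>M i\<in>UNIV. L)) (0 :: nat, \<lambda>i::nat. SOME x. x \<in> space L))"
    by (intro prob_space_return) (auto simp: space_pair_measure space_PiM)
  then show ?thesis using False unfolding poisson_process_def by (simp only: if_False)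
qed

definition poisson_tree :: "'a measure \<Rightarrow> ('a \<Rightarrow> rtree measure) \<Rightarrow> rtree measure" where
  "poisson_tree L K = poisson_process L \<bind> (\<lambda>(n, y). forest K n y)"

context tree_law_kernel
begin

context
  fixes L :: "'a measure"
  assumes sets_L: "sets L = sets M" and nonempty: "space M \<noteq> {}"
begin

lemma forest_measurable_poisson:
  "(\<lambda>(n, y). forest K n y) \<in> measurable (poisson_process L) (subprob_algebra (count_space UNIV))"
proof -
  have "sets (poisson_process L) = sets (count_space UNIV \<Otimes>\<^sub>M (\<Pi>\<^sub>M i\<in>UNIV. M))"
    unfolding sets_poisson_process by (intro sets_pair_measure_cong sets_PiM_cong sets_L refl)
  from measurable_cong_sets[OF this refl] forest_measurable show ?thesis by blast
qed

lemma space_L: "space L = space M" by (rule sets_eq_imp_space_eq[OF sets_L])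

lemma prob_space_poisson_tree: "prob_space (poisson_tree L K)"
  and sets_poisson_tree: "sets (poisson_tree L K) = UNIV"
  and emeasure_poisson_tree:
    "emeasure (poisson_tree L K) {T} = (\<integral>\<^sup>+ z. emeasure (case z of (n, y) \<Rightarrow> forest K n y) {T} \<partial>poisson_process L)"
proof -
  interpret P: prob_space "poisson_process L" using nonempty by (intro prob_space_poisson_process) (simp add: space_L)
  have "AE z in poisson_process L. prob_space (case z of (n, y) \<Rightarrow> forest K n y)"
  proof (rule AE_I2)
    fix z assume "z \<in> space (poisson_process L)"
    then have "z \<in> space (count_space UNIV \<Otimes>\<^sub>M (\<Pi>\<^sub>M i\<in>UNIV. L))"
      using sets_eq_imp_space_eq[OF sets_poisson_process, of L] by simp
    then show "prob_space (case z of (n, y) \<Rightarrow> forest K n y)"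
      by (auto simp: space_pair_measure space_PiM space_L intro!: prob_space_forest)
  qed
  then show "prob_space (poisson_tree L K)"
    unfolding poisson_tree_def by (rule P.prob_space_bind[OF _ forest_measurable_poisson])
  show "sets (poisson_tree L K) = UNIV"
    unfolding poisson_tree_def using P.not_empty
    by (subst sets_bind[where N = "count_space UNIV"]) (auto simp: forest_def)
  show "emeasure (poisson_tree L K) {T} = (\<integral>\<^sup>+ z. emeasure (case z of (n, y) \<Rightarrow> forest K n y) {T} \<partial>poisson_process L)"
    unfolding poisson_tree_def by (rule emeasure_bind[OF P.not_empty forest_measurable_poisson]) simp
qed

text \<open>Covers both zero and infinite mass: the default outcome has no points, so the tree is a
  single vertex.\<close>

lemma poisson_tree_degenerate:
  assumes "\<not> (0 < emeasure L (space L) \<and> emeasure L (space L) < \<infinity>)"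
  shows "emeasure (poisson_tree L K) {Node m} = of_bool (m = {#})"
proof -
  let ?y = "\<lambda>i::nat. SOME x. x \<in> space L"
  have y: "?y i \<in> space M" for i using nonempty by (simp add: some_in_eq space_L)
  have P: "poisson_process L = return (count_space UNIV \<Otimes>\<^sub>M (\<Pi>\<^sub>M i\<in>UNIV. L)) (0, ?y)"
    unfolding poisson_process_def using assms by (simp only: if_False)
  have "emeasure (poisson_tree L K) {Node m} = emeasure (forest K 0 ?y) {Node m}"
    unfolding emeasure_poisson_tree P
  proof (subst nn_integral_return)
    show "(0, ?y) \<in> space (count_space UNIV \<Otimes>\<^sub>M (\<Pi>\<^sub>M i\<in>UNIV. L))"
      using y by (auto simp: space_pair_measure space_PiM space_L)
    show "(\<lambda>z. emeasure (case z of (n, y) \<Rightarrow> forest K n y) {Node m}) \<in> borel_measurable (count_space UNIV \<Otimes>\<^sub>M (\<Pi>\<^sub>M i\<in>UNIV. L))"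
      using measurable_compose[OF forest_measurable_poisson measurable_emeasure_subprob_algebra[of "{Node m}"]]
      by (simp add: measurable_cong_sets[OF sets_poisson_process refl])
  qed simp
  \<comment> \<open>\<open>tree_weight_empty\<close> enters as the fact that zero points have
    exactly one labeling.\<close>
  also have "\<dots> = of_bool (m = {#})"
    unfolding emeasure_forest[OF y] using tree_weight_empty by (auto simp: tree_weight_def)
  finally show ?thesis .
qed

text \<open>The marking theorem by direct computation: only the event of \<open>size m\<close>
  points contributes, and given it every labeling has the same probability.\<close>

lemma poisson_tree_formula:
  assumes d: "emeasure L (space L) = ennreal d" "0 \<le> d"
    and l: "\<And>S. (\<integral>\<^sup>+ z. emeasure (K z) {S} \<partial>L) = ennreal (l S)" "\<And>S. 0 \<le> l S"
  shows "emeasure (poisson_tree L K) {Node m} = ennreal (tree_weight m * exp (- d) * (\<Prod>S\<in>#m. l S))"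
\<comment> \<open>Zero mass is the degenerate branch. All means vanish there, so their product is
  nonzero only for the empty multiset, in accordance with the formula.\<close>
proof (cases "d = 0")
  case True
  have "l S = 0" for S
  proof -
    have "AE z in L. False" using d True by (intro AE_I[where N = "space L"]) auto
    then have "(\<integral>\<^sup>+ z. emeasure (K z) {S} \<partial>L) = (\<integral>\<^sup>+ z. 0 \<partial>L)" by (intro nn_integral_cong_AE) auto
    then show ?thesis using l[of S] by simp
  qed
  then have "(\<Prod>S\<in>#m. l S) = of_bool (m = {#})" by (cases m) auto
  then show ?thesis using True d by (subst poisson_tree_degenerate) (auto simp: tree_weight_empty)
next
  case False
  then have d0: "0 < d" using d by simp
  define Q where "Q = uniform_measure L (space L)"
  have Q: "prob_space Q" unfolding Q_def using d d0 by (intro prob_space_uniform_measure) auto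
  interpret PQ: prob_space "\<Pi>\<^sub>M i\<in>(UNIV :: nat set). Q" by (intro prob_space_PiM Q)
  have sQ: "sets Q = sets M" by (simp add: Q_def sets_L)
  have spQ: "space Q = space M" by (rule sets_eq_imp_space_eq[OF sQ])
  have m_d: "measure L (space L) = d" using d by (simp add: measure_def)
  have P: "poisson_process L = measure_pmf (poisson_pmf d) \<Otimes>\<^sub>M (\<Pi>\<^sub>M i\<in>UNIV. Q)"
    using d d0 unfolding poisson_process_def Q_def by (simp add: m_d)
  have Km: "(\<lambda>z. emeasure (K z) {S}) \<in> borel_measurable L" "(\<lambda>z. emeasure (K z) {S}) \<in> borel_measurable Q" for S
    using measurable_K measurable_cong_sets[OF sets_L refl] measurable_cong_sets[OF sQ refl] by blast+
  have KQ: "(\<integral>\<^sup>+ z. emeasure (K z) {S} \<partial>Q) = ennreal (l S / d)" for S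
  proof -
    have "(\<integral>\<^sup>+ z. emeasure (K z) {S} \<partial>Q) = (\<integral>\<^sup>+ z. emeasure (K z) {S} * indicator (space L) z \<partial>L) / emeasure L (space L)"
      unfolding Q_def by (rule nn_integral_uniform_measure[OF Km(1)]) simp
    also have "(\<integral>\<^sup>+ z. emeasure (K z) {S} * indicator (space L) z \<partial>L) = (\<integral>\<^sup>+ z. emeasure (K z) {S} \<partial>L)"
      by (intro nn_integral_cong) auto
    also have "\<dots> / emeasure L (space L) = ennreal (l S / d)"
      unfolding l(1) d(1) by (rule divide_ennreal[OF l(2) d0])
    finally show ?thesis .
  qed
  let ?F = "\<lambda>z. emeasure (case z of (n, y) \<Rightarrow> forest K n y) {Node m}"
  have Fm: "?F \<in> borel_measurable (measure_pmf (poisson_pmf d) \<Otimes>\<^sub>M (\<Pi>\<^sub>M i\<in>UNIV. Q))"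
    using measurable_compose[OF forest_measurable_poisson measurable_emeasure_subprob_algebra[of "{Node m}"]]
    unfolding P by simp
  let ?c = "real (card (labelings m)) * (\<Prod>S\<in>#m. l S / d)"
  have c0: "0 \<le> (\<Prod>S\<in>#m. l S / d)" using l(2) d0 by (induction m) auto
  have inner: "(\<integral>\<^sup>+ y. emeasure (forest K n y) {Node m} \<partial>(\<Pi>\<^sub>M i\<in>UNIV. Q)) = ennreal ?c * indicator {size m} n" for n
  proof -
    have "(\<integral>\<^sup>+ y. emeasure (forest K n y) {Node m} \<partial>(\<Pi>\<^sub>M i\<in>UNIV. Q)) =
      (\<integral>\<^sup>+ y. (if size m = n then \<Sum>t\<in>labelings m. \<Prod>i<n. emeasure (K (y i)) {t i} else 0) \<partial>(\<Pi>\<^sub>M i\<in>UNIV. Q))"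
      by (intro nn_integral_cong emeasure_forest) (auto simp: space_PiM spQ)
    also have "\<dots> = ennreal ?c * indicator {size m} n"
    proof (cases "size m = n")
      case True
      have "(\<integral>\<^sup>+ y. (\<Sum>t\<in>labelings m. \<Prod>i<n. emeasure (K (y i)) {t i}) \<partial>(\<Pi>\<^sub>M i\<in>UNIV. Q)) =
        (\<Sum>t\<in>labelings m. \<integral>\<^sup>+ y. (\<Prod>i<n. emeasure (K (y i)) {t i}) \<partial>(\<Pi>\<^sub>M i\<in>UNIV. Q))"
        by (intro nn_integral_sum borel_measurable_prod_ennreal measurable_PiM_coordinate[OF Km(2)]) auto
      also have "\<dots> = (\<Sum>t\<in>labelings m. \<Prod>S\<in>#m. ennreal (l S / d))"
      proof (intro sum.cong refl)
        fix t assume t: "t \<in> labelings m"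
        have "(\<integral>\<^sup>+ y. (\<Prod>i<n. emeasure (K (y i)) {t i}) \<partial>(\<Pi>\<^sub>M i\<in>UNIV. Q)) = (\<Prod>i<n. \<integral>\<^sup>+ z. emeasure (K z) {t i} \<partial>Q)"
          by (rule nn_integral_PiM_prod[OF Q Km(2)])
        also have "\<dots> = (\<Prod>S\<in>#m. ennreal (l S / d))"
          using labelings_prod[OF t, of "\<lambda>S. ennreal (l S / d)"] True by (simp add: KQ)
        finally show "(\<integral>\<^sup>+ y. (\<Prod>i<n. emeasure (K (y i)) {t i}) \<partial>(\<Pi>\<^sub>M i\<in>UNIV. Q)) = (\<Prod>S\<in>#m. ennreal (l S / d))" .
      qed
      also have "\<dots> = ennreal ?c"
        using l(2) d0 c0 by (subst ennreal_prod_mset) (auto simp: ennreal_mult ennreal_of_nat_eq_real_of_nat)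
      finally show ?thesis using True by simp
    qed auto
    finally show ?thesis .
  qed
  have "emeasure (poisson_tree L K) {Node m} = (\<integral>\<^sup>+ z. ?F z \<partial>(measure_pmf (poisson_pmf d) \<Otimes>\<^sub>M (\<Pi>\<^sub>M i\<in>UNIV. Q)))"
    by (simp only: emeasure_poisson_tree P)
  also have "\<dots> = (\<integral>\<^sup>+ n. \<integral>\<^sup>+ y. ?F (n, y) \<partial>(\<Pi>\<^sub>M i\<in>UNIV. Q) \<partial>measure_pmf (poisson_pmf d))"
    by (rule PQ.nn_integral_fst[symmetric, OF Fm])
  also have "\<dots> = (\<integral>\<^sup>+ n. ennreal ?c * indicator {size m} n \<partial>measure_pmf (poisson_pmf d))"
    by (simp add: inner)
  also have "\<dots> = ennreal ?c * ennreal (pmf (poisson_pmf d) (size m))"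
    by (subst nn_integral_cmult_indicator) (auto simp: emeasure_pmf_single)
  also have "\<dots> = ennreal (?c * pmf (poisson_pmf d) (size m))"
    using c0 by (intro ennreal_mult[symmetric]) auto
  \<comment> \<open>The Poisson weight supplies a power of \<open>d\<close>, which cancels the
    normalisation of the law of the points, and a factorial, which turns the number of labelings
    into \<open>tree_weight\<close>.\<close>
  also have "?c * pmf (poisson_pmf d) (size m) = tree_weight m * exp (- d) * (d ^ size m * (\<Prod>S\<in>#m. l S / d))"
    using d0 by (simp add: tree_weight_def)
  also have "\<dots> = tree_weight m * exp (- d) * (\<Prod>S\<in>#m. l S)"
    using d0 by (subst prod_mset_div) auto
  finally show ?thesis .
qed

end

end

lemma tree_ball_from_Suc:
  "tree_ball_from M W (Suc k) x = poisson_tree (intensity M W x) (tree_ball_from M W k)"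
  by (simp add: poisson_tree_def forest_def)

declare tree_ball_from.simps(2) [simp del]

section \<open>Tree laws of a measurable kernel on a probability space\<close>

locale probability_kernel = prob_space M for M :: "'a measure" +
  fixes W :: "'a \<Rightarrow> 'a \<Rightarrow> real"
  assumes measurable_W: "(\<lambda>(x, y). W x y) \<in> borel_measurable (M \<Otimes>\<^sub>M M)"
begin

lemma measurable_W_section:
  assumes "x \<in> space M" shows "(\<lambda>y. ennreal (W x y)) \<in> borel_measurable M"
proof -
  have "(\<lambda>y. W x y) \<in> borel_measurable M"
    using measurable_compose[OF measurable_Pair1'[OF assms] measurable_W] by simp
  then show ?thesis by measurable
qed

lemma nn_integral_W_measurable:
  assumes "f \<in> borel_measurable M"
  shows "(\<lambda>x. \<integral>\<^sup>+ y. ennreal (W x y) * f y \<partial>M) \<in> borel_measurable M"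
proof (rule borel_measurable_nn_integral)
  have "(\<lambda>z. ennreal (case z of (x, y) \<Rightarrow> W x y)) \<in> borel_measurable (M \<Otimes>\<^sub>M M)"
    using measurable_W by (rule measurable_compose) (rule measurable_ennreal)
  moreover have "(\<lambda>z. f (snd z)) \<in> borel_measurable (M \<Otimes>\<^sub>M M)"
    by (rule measurable_compose[OF measurable_snd assms])
  ultimately have "(\<lambda>z. ennreal (case z of (x, y) \<Rightarrow> W x y) * f (snd z)) \<in> borel_measurable (M \<Otimes>\<^sub>M M)"
    by (rule borel_measurable_times_ennreal)
  then show "(\<lambda>(x, y). ennreal (W x y) * f y) \<in> borel_measurable (M \<Otimes>\<^sub>M M)"
    by (simp add: case_prod_beta')
qed

lemma degree_measurable: "degree M W \<in> borel_measurable M"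
  using nn_integral_W_measurable[of "\<lambda>_. 1"] by (simp add: degree_def[abs_def])

lemma sets_intensity [simp]: "sets (intensity M W x) = sets M"
  by (simp add: intensity_def)

lemma space_intensity [simp]: "space (intensity M W x) = space M"
  by (simp add: intensity_def)

lemma nn_integral_intensity:
  assumes "x \<in> space M" "f \<in> borel_measurable M"
  shows "(\<integral>\<^sup>+ y. f y \<partial>intensity M W x) = (\<integral>\<^sup>+ y. ennreal (W x y) * f y \<partial>M)"
  unfolding intensity_def by (rule nn_integral_density[OF measurable_W_section[OF assms(1)] assms(2)])

lemma emeasure_intensity_space:
  assumes "x \<in> space M" shows "emeasure (intensity M W x) (space M) = degree M W x"
proof -
  have "emeasure (intensity M W x) (space M) = (\<integral>\<^sup>+ y. 1 \<partial>intensity M W x)" by simp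
  also have "\<dots> = (\<integral>\<^sup>+ y. ennreal (W x y) * 1 \<partial>M)" by (rule nn_integral_intensity[OF assms]) simp
  finally show ?thesis by (simp add: degree_def)
qed

lemma AE_intensity:
  assumes "x \<in> space M" "AE y in M. P y" shows "AE y in intensity M W x. P y"
  unfolding intensity_def using assms(2) by (subst AE_density[OF measurable_W_section[OF assms(1)]]) auto

lemma emeasure_poisson_tree_finite_degree:
  assumes K: "tree_law_kernel M K" and x: "x \<in> space M" and d: "degree M W x < \<infinity>"
  shows "emeasure (poisson_tree (intensity M W x) K) {Node m} = ennreal (tree_weight m *
    exp (- enn2real (degree M W x)) * (\<Prod>S\<in>#m. enn2real (\<integral>\<^sup>+ y. emeasure (K y) {S} \<partial>intensity M W x)))"
proof (rule tree_law_kernel.poisson_tree_formula[OF K sets_intensity not_empty])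
  show "emeasure (intensity M W x) (space (intensity M W x)) = ennreal (enn2real (degree M W x))"
    using emeasure_intensity_space[OF x] d by simp
  fix S
  have "(\<integral>\<^sup>+ y. emeasure (K y) {S} \<partial>intensity M W x) \<le> (\<integral>\<^sup>+ y. 1 \<partial>intensity M W x)"
    using tree_law_kernel.prob_K[OF K] by (intro nn_integral_mono) (simp add: prob_space.emeasure_le_1)
  also have "\<dots> < \<infinity>" using emeasure_intensity_space[OF x] d by simp
  finally show "(\<integral>\<^sup>+ y. emeasure (K y) {S} \<partial>intensity M W x) =
    ennreal (enn2real (\<integral>\<^sup>+ y. emeasure (K y) {S} \<partial>intensity M W x))" by simp
qed auto

text \<open>Measurability in the root type is read off the explicit Poisson formula, whose
  ingredients are integrals of the previous level against \<open>W x\<close>.\<close>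

lemma tree_law_kernel_tree_ball_from: "tree_law_kernel M (tree_ball_from M W k)"
proof (induction k)
  case 0
  show ?case
  proof (rule tree_law_kernel.intro)
    fix x assume "x \<in> space M"
    show "prob_space (tree_ball_from M W 0 x)" by (simp add: prob_space_return)
  qed simp_all
next
  case (Suc k)
  let ?K = "tree_ball_from M W k"
  interpret K: tree_law_kernel M ?K by (rule Suc)
  show ?case
  proof (rule tree_law_kernel.intro)
    fix x assume x: "x \<in> space M"
    show "prob_space (tree_ball_from M W (Suc k) x)" "sets (tree_ball_from M W (Suc k) x) = UNIV"
      unfolding tree_ball_from_Suc
      using K.prob_space_poisson_tree[OF sets_intensity not_empty] K.sets_poisson_tree[OF sets_intensity not_empty] by auto
  next
    fix T :: rtree
    obtain m where T: "T = Node m" by (cases T)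
    let ?I = "\<lambda>x S. \<integral>\<^sup>+ y. ennreal (W x y) * emeasure (?K y) {S} \<partial>M"
    show "(\<lambda>x. emeasure (tree_ball_from M W (Suc k) x) {T}) \<in> borel_measurable M"
    proof (rule measurable_transfer)
      fix x assume x: "x \<in> space M"
      \<comment> \<open>Types of infinite degree get the default process without points, hence the
        separate case.\<close>
      show "emeasure (tree_ball_from M W (Suc k) x) {T} = (if degree M W x < \<infinity>
        then ennreal (tree_weight m * exp (- enn2real (degree M W x)) * (\<Prod>S\<in>#m. enn2real (?I x S)))
        else of_bool (m = {#}))"
      proof (cases "degree M W x < \<infinity>")
        case True
        have "(\<integral>\<^sup>+ y. emeasure (?K y) {S} \<partial>intensity M W x) = ?I x S" for S
          by (rule nn_integral_intensity[OF x K.measurable_K])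
        with emeasure_poisson_tree_finite_degree[OF Suc x True, of m] True show ?thesis
          unfolding tree_ball_from_Suc T by (simp only: if_True)
      next
        case False
        then show ?thesis unfolding tree_ball_from_Suc T
          using K.poisson_tree_degenerate[OF sets_intensity[of x] not_empty, of m] emeasure_intensity_space[OF x]
          by simp
      qed
    next
      have "(\<lambda>x. enn2real (?I x S)) \<in> borel_measurable M" for S
        using nn_integral_W_measurable[OF K.measurable_K[of S]] by (rule borel_measurable_enn2real)
      then have p: "(\<lambda>x. \<Prod>S\<in>#m. enn2real (?I x S)) \<in> borel_measurable M"
        by (rule prod_mset_measurable)
      have "(\<lambda>x. if degree M W x < \<infinity> then ennreal (a * exp (- enn2real (degree M W x)) * f x) else b)
        \<in> borel_measurable M" if [measurable]: "f \<in> borel_measurable M" for f :: "'a \<Rightarrow> real" and a b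
        using degree_measurable by measurable
      from this[OF p] show "(\<lambda>x. if degree M W x < \<infinity>
        then ennreal (tree_weight m * exp (- enn2real (degree M W x)) * (\<Prod>S\<in>#m. enn2real (?I x S)))
        else of_bool (m = {#})) \<in> borel_measurable M" .
    qed
  qed
qed

lemma tree_ball_from_measurable: "tree_ball_from M W k \<in> measurable M (subprob_algebra (count_space UNIV))"
proof -
  interpret K: tree_law_kernel M "tree_ball_from M W k" by (rule tree_law_kernel_tree_ball_from)
  show ?thesis by (rule measurable_subprob_count_space) (use K.prob_K K.sets_K K.measurable_K in auto)
qed

lemma emeasure_tree_ball:
  "emeasure (tree_ball M W k) {T} = (\<integral>\<^sup>+ x. emeasure (tree_ball_from M W k x) {T} \<partial>M)"
  unfolding tree_ball_def by (rule emeasure_bind[OF not_empty tree_ball_from_measurable]) simp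

lemma sets_tree_ball: "sets (tree_ball M W k) = UNIV"
proof -
  interpret K: tree_law_kernel M "tree_ball_from M W k" by (rule tree_law_kernel_tree_ball_from)
  show ?thesis unfolding tree_ball_def
    using sets_bind[of M "tree_ball_from M W k" "count_space UNIV"] not_empty by (simp add: K.sets_K)
qed

section \<open>The effect of capping the degrees\<close>

lemma probability_kernel_cap_degree: "probability_kernel M (cap_degree c M W)"
proof
  have "(\<lambda>z. if degree M W (fst z) \<le> ennreal c then (case z of (x, y) \<Rightarrow> W x y) else 0) \<in> borel_measurable (M \<Otimes>\<^sub>M M)"
    using measurable_W degree_measurable by measurable
  then show "(\<lambda>(x, y). cap_degree c M W x y) \<in> borel_measurable (M \<Otimes>\<^sub>M M)"
    by (rule measurable_transfer[rotated]) (auto simp: cap_degree_def)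
qed

lemma degree_cap_degree: "degree M (cap_degree c M W) x \<le> ennreal c"
  by (cases "degree M W x \<le> ennreal c") (simp_all add: degree_def cap_degree_def)

text \<open>Types of degree at most \<open>c\<close> keep their intensity, which is absolutely
  continuous with respect to \<open>M\<close>; so almost every child again has such a type, and the
  induction on depth never sees the others. The root type is drawn from \<open>M\<close> as
  well.\<close>

lemma tree_ball_cap_degree:
  assumes c: "AE x in M. degree M W x \<le> ennreal c"
  shows "tree_ball M (cap_degree c M W) k = tree_ball M W k"
proof -
  let ?W = "cap_degree c M W"
  interpret C: probability_kernel M ?W by (rule probability_kernel_cap_degree)
  have eq: "emeasure (tree_ball_from M ?W k x) {T} = emeasure (tree_ball_from M W k x) {T}"
    if "x \<in> space M" "degree M W x \<le> ennreal c" for x T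
    using that
  proof (induction k arbitrary: x T)
    case (Suc k)
    obtain m where T: "T = Node m" by (cases T)
    have "?W x = W x" using Suc.prems(2) by (simp add: cap_degree_def fun_eq_iff)
    then have I: "intensity M ?W x = intensity M W x" and D: "degree M ?W x = degree M W x"
      by (simp_all add: intensity_def degree_def)
    have d: "degree M W x < \<infinity>" using Suc.prems(2) by (simp add: order.strict_trans1)
    have "(\<integral>\<^sup>+ y. emeasure (tree_ball_from M ?W k y) {S} \<partial>intensity M W x) =
      (\<integral>\<^sup>+ y. emeasure (tree_ball_from M W k y) {S} \<partial>intensity M W x)" for S
    proof (intro nn_integral_cong_AE AE_intensity Suc.prems(1))
      show "AE y in M. emeasure (tree_ball_from M ?W k y) {S} = emeasure (tree_ball_from M W k y) {S}"
        using c AE_space by eventually_elim (rule Suc.IH)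
    qed
    then show ?case
      using emeasure_poisson_tree_finite_degree[OF tree_law_kernel_tree_ball_from Suc.prems(1) d, of k m]
        C.emeasure_poisson_tree_finite_degree[OF C.tree_law_kernel_tree_ball_from Suc.prems(1), of k m] d
      unfolding tree_ball_from_Suc T I D by simp
  qed simp
  show ?thesis
  proof (rule measure_eqI_countable[where A = UNIV])
    fix T
    show "emeasure (tree_ball M ?W k) {T} = emeasure (tree_ball M W k) {T}"
      unfolding emeasure_tree_ball C.emeasure_tree_ball
    proof (rule nn_integral_cong_AE)
      show "AE x in M. emeasure (tree_ball_from M ?W k x) {T} = emeasure (tree_ball_from M W k x) {T}"
        using c AE_space by eventually_elim (rule eq)
    qed
  qed (auto simp: sets_tree_ball C.sets_tree_ball)
qed

end

section \<open>The canonical map into \<open>\<bbbP>\<^sub>k\<close>\<close>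

lemma i_map_outside: "k < i \<Longrightarrow> i_map c M W k x i = undefined"
  by (induction k) auto

lemma i_map_below: "j \<le> k \<Longrightarrow> i_map c M W k x j = i_map c M W j x j"
  by (induction k) (auto simp: le_Suc_eq)

lemma i_map_restrict:
  assumes "j \<le> k" shows "restrict (i_map c M W k x) {..j} = i_map c M W j x"
proof
  fix i
  show "restrict (i_map c M W k x) {..j} i = i_map c M W j x i"
    using assms i_map_below[of i k c M W x] i_map_below[of i j c M W x] i_map_outside[of j i c M W x]
    by (cases "i \<le> j") auto
qed


text \<open>The bound is imposed at every type: \<open>decode\<close> is known to invert
  \<open>encode\<close> only on measures of mass at most \<open>c\<close>, so every value of
  \<open>i_map\<close> has to code such a measure.\<close>

locale capped_kernel = probability_kernel M W for M :: "'a measure" and W :: "'a \<Rightarrow> 'a \<Rightarrow> real" +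
  fixes c :: real
  assumes c: "0 \<le> c" and degree_le: "\<And>x. x \<in> space M \<Longrightarrow> degree M W x \<le> ennreal c"
begin

abbreviation "\<iota> \<equiv> i_map c M W"

definition child_law :: "nat \<Rightarrow> 'a \<Rightarrow> (nat \<Rightarrow> point) measure" where
  "child_law k x = distr (intensity M W x) (borel_of (P_space c k)) (\<iota> k)"

lemma measurable_intensity: "f \<in> measurable M N \<Longrightarrow> f \<in> measurable (intensity M W x) N"
  by (simp add: measurable_cong_sets[OF sets_intensity refl])

lemma child_law_measures_le:
  assumes m: "\<iota> k \<in> measurable M (borel_of (P_space c k))" and x: "x \<in> space M"
  shows "child_law k x \<in> measures_le c (P_space c k)"
proof -
  have "emeasure (child_law k x) (space (child_law k x)) = emeasure (intensity M W x) (\<iota> k -` topspace (P_space c k) \<inter> space M)"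
    unfolding child_law_def using measurable_intensity[OF m] sets.top[of "borel_of (P_space c k)"]
    by (simp add: emeasure_distr)
  also have "\<dots> \<le> emeasure (intensity M W x) (space M)" by (rule emeasure_mono) auto
  also have "\<dots> \<le> ennreal c" using degree_le[OF x] by (simp add: emeasure_intensity_space[OF x])
  finally show ?thesis by (simp add: measures_le_def child_law_def)
qed

text \<open>Stated conditionally because the induction that proves measurability of
  \<open>\<iota>\<close> itself relies on it at lower levels.\<close>

lemma law_at_\<iota>_if_measurable:
  assumes m: "\<iota> j \<in> measurable M (borel_of (P_space c j))" and x: "x \<in> space M" and j: "j < k"
  shows "law_at c j (\<iota> k x) = child_law j x"
proof -
  have "\<iota> k x (Suc j) = encode c (P_space c j) (child_law j x)"
    using i_map_below[of "Suc j" k c M W x] j by (simp add: child_law_def)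
  then show ?thesis
    unfolding law_at_def
    by (simp add: decode_encode[OF real_generated_P_space child_law_measures_le[OF m x]])
qed

lemma child_law_consistent:
  assumes "\<iota> (Suc j) \<in> measurable M (borel_of (P_space c (Suc j)))"
  shows "child_law j x = distr (child_law (Suc j) x) (borel_of (P_space c j)) (\<lambda>\<beta>. restrict \<beta> {..j})"
proof -
  have "distr (child_law (Suc j) x) (borel_of (P_space c j)) (\<lambda>\<beta>. restrict \<beta> {..j}) =
    distr (intensity M W x) (borel_of (P_space c j)) ((\<lambda>\<beta>. restrict \<beta> {..j}) \<circ> \<iota> (Suc j))"
    unfolding child_law_def
    by (rule distr_distr[OF measurable_restrict_P_space measurable_intensity[OF assms]]) simp
  also have "(\<lambda>\<beta>. restrict \<beta> {..j}) \<circ> \<iota> (Suc j) = \<iota> j"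
    by (rule ext) (simp only: o_apply i_map_restrict[OF le_SucI[OF order_refl]])
  finally show ?thesis by (simp only: child_law_def[of j])
qed

text \<open>Membership in \<open>P_space\<close> has to be obtained along with measurability:
  consistency of the laws is a composition of image measures, which requires measurable maps at the
  lower levels.\<close>

lemma \<iota>_measurable: "\<iota> k \<in> measurable M (borel_of (P_space c k))"
proof (induction k rule: less_induct)
  case (less k)
  show ?case
  proof (cases k)
    case 0
    have "(\<lambda>_. restrict (\<lambda>_. star) {..0}) \<in> measurable M (borel_of (P_space c 0))"
      by (rule measurable_const) (simp add: topspace_P_space_0)
    moreover have "\<iota> 0 = (\<lambda>_. restrict (\<lambda>_. star) {..0})" by (rule ext) simp
    ultimately show ?thesis unfolding 0 by (simp only:)
  next
    case (Suc h)
    have m: "\<iota> j \<in> measurable M (borel_of (P_space c j))" if "j \<le> h" for j using less[of j] that Suc by simp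
    have law: "law_at c j (\<iota> (Suc h) x) = child_law j x" if "x \<in> space M" "j \<le> h" for x j
      by (rule law_at_\<iota>_if_measurable[OF m[OF that(2)] that(1)]) (use that(2) in simp)
    have top: "\<iota> (Suc h) x \<in> topspace (P_space c (Suc h))" if x: "x \<in> space M" for x
      unfolding topspace_P_space
    proof (intro conjI allI impI)
      show "\<iota> (Suc h) x \<in> PiE {..Suc h} (\<lambda>i. topspace (L_space c i))"
      proof (rule PiE_I)
        fix i assume i: "i \<in> {..Suc h}"
        show "\<iota> (Suc h) x i \<in> topspace (L_space c i)"
        proof (cases "i \<le> h")
          case True
          have "\<iota> h x \<in> topspace (P_space c h)" using measurable_space[OF m[OF order_refl] x] by simp
          then show ?thesis using True unfolding topspace_P_space by auto
        next
          case False
          then have i: "i = Suc h" using i by simp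
          have "\<iota> (Suc h) x i = encode c (P_space c h) (child_law h x)" by (simp add: i child_law_def)
          then show ?thesis
            unfolding i L_space.simps topspace_coded_measures[OF real_generated_P_space]
            using child_law_measures_le[OF m[OF order_refl] x] by simp
        qed
      next
        fix i assume "i \<notin> {..Suc h}"
        then show "\<iota> (Suc h) x i = undefined" by (intro i_map_outside) simp
      qed
      fix j assume j: "Suc j < Suc h"
      show "law_at c j (\<iota> (Suc h) x) =
        distr (law_at c (Suc j) (\<iota> (Suc h) x)) (borel_of (P_space c j)) (\<lambda>\<beta>. restrict \<beta> {..j})"
        using law[OF x, of j] law[OF x, of "Suc j"] child_law_consistent[OF m[of "Suc j"], of x] j by simp
    qed
    show ?thesis
      unfolding Suc
    \<comment> \<open>Only the top law is left to check. Its value at \<open>A\<close> is the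
      integral of \<open>W x\<close> over the preimage of \<open>A\<close>, measurable in
      \<open>x\<close> by joint measurability of \<open>W\<close>.\<close>
    proof (rule measurable_P_space_SucI[OF top])
      fix A assume A: "A \<in> sets (borel_of (P_space c h))"
      let ?B = "\<iota> h -` A \<inter> space M"
      have B: "?B \<in> sets M" by (rule measurable_sets[OF m[OF order_refl] A])
      show "(\<lambda>x. emeasure (law_at c h (\<iota> (Suc h) x)) A) \<in> borel_measurable M"
      proof (rule measurable_transfer)
        show "(\<lambda>x. \<integral>\<^sup>+ y. ennreal (W x y) * indicator ?B y \<partial>M) \<in> borel_measurable M"
          by (rule nn_integral_W_measurable) (use B in simp)
        fix x assume x: "x \<in> space M"
        have "emeasure (law_at c h (\<iota> (Suc h) x)) A = emeasure (intensity M W x) ?B"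
          using A measurable_intensity[OF m[OF order_refl]]
          by (simp only: law[OF x order_refl]) (simp add: child_law_def emeasure_distr)
        also have "\<dots> = (\<integral>\<^sup>+ y. indicator ?B y \<partial>intensity M W x)" using B by simp
        also have "\<dots> = (\<integral>\<^sup>+ y. ennreal (W x y) * indicator ?B y \<partial>M)"
          by (rule nn_integral_intensity[OF x]) (use B in simp)
        finally show "emeasure (law_at c h (\<iota> (Suc h) x)) A = (\<integral>\<^sup>+ y. ennreal (W x y) * indicator ?B y \<partial>M)" .
      qed
    qed
  qed
qed

lemma law_at_\<iota>: "x \<in> space M \<Longrightarrow> j < k \<Longrightarrow> law_at c j (\<iota> k x) = child_law j x"
  by (rule law_at_\<iota>_if_measurable[OF \<iota>_measurable])

lemma \<iota>_topspace: "x \<in> space M \<Longrightarrow> \<iota> k x \<in> topspace (P_space c k)"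
  using measurable_space[OF \<iota>_measurable] by simp

text \<open>The forward direction: by change of variables along \<open>\<iota> k\<close>, the
  parameters of the marking theorem are the mass and the integrals of the law coded in
  \<open>\<iota> (Suc k) x\<close>, exactly as in the recursion of \<open>tree_prob\<close>.\<close>

lemma emeasure_tree_ball_from:
  "x \<in> space M \<Longrightarrow> emeasure (tree_ball_from M W k x) {T} = ennreal (tree_prob c k (\<iota> k x) T)"
proof (induction k arbitrary: x T)
  case 0
  show ?case by (auto simp: indicator_def)
next
  case (Suc k)
  obtain m where T: "T = Node m" by (cases T)
  note x = Suc.prems
  note law = law_at_\<iota>[OF x lessI[of k]]
  note mi = measurable_intensity[OF \<iota>_measurable]
  let ?d = "measure (law_at c k (\<iota> (Suc k) x)) (space (law_at c k (\<iota> (Suc k) x)))"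
  interpret finite_measure "child_law k x"
    by (rule measures_le_finite[OF child_law_measures_le[OF \<iota>_measurable x]])
  note S = measures_leD[OF child_law_measures_le[OF \<iota>_measurable x, of k]]
  show ?case
    unfolding tree_ball_from_Suc T tree_prob_Suc
  proof (rule tree_law_kernel.poisson_tree_formula[OF tree_law_kernel_tree_ball_from sets_intensity not_empty])
    have "emeasure (intensity M W x) (space (intensity M W x)) = emeasure (child_law k x) (space (child_law k x))"
    proof -
      have "\<iota> k -` topspace (P_space c k) \<inter> space M = space M" using \<iota>_topspace by auto
      then show ?thesis unfolding child_law_def using mi sets.top[of "borel_of (P_space c k)"]
        by (simp add: emeasure_distr)
    qed
    then show "emeasure (intensity M W x) (space (intensity M W x)) = ennreal ?d"
      unfolding law by (simp only: emeasure_eq_measure)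
    fix S'
    obtain b where b: "\<forall>\<beta>\<in>topspace (P_space c k). 0 \<le> tree_prob c k \<beta> S' \<and> tree_prob c k \<beta> S' \<le> b"
      and tm: "(\<lambda>\<beta>. tree_prob c k \<beta> S') \<in> borel_measurable (borel_of (P_space c k))"
      using tree_prob_measurable_bounded[OF c, of k S'] by blast
    have int: "integrable (child_law k x) (\<lambda>\<beta>. tree_prob c k \<beta> S')"
      using b tm by (intro integrable_const_bound[of _ b] AE_I2) (auto simp: S measurable_cong_sets[OF S(1) refl])
    have nn: "AE \<beta> in child_law k x. 0 \<le> tree_prob c k \<beta> S'"
      using b by (intro AE_I2) (auto simp: S)
    have "(\<integral>\<^sup>+ y. emeasure (tree_ball_from M W k y) {S'} \<partial>intensity M W x) =
      (\<integral>\<^sup>+ y. ennreal (tree_prob c k (\<iota> k y) S') \<partial>intensity M W x)"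
      by (intro nn_integral_cong Suc.IH) simp
    also have "\<dots> = (\<integral>\<^sup>+ \<beta>. ennreal (tree_prob c k \<beta> S') \<partial>child_law k x)"
      unfolding child_law_def using tm by (intro nn_integral_distr[OF mi, symmetric]) simp
    also have "\<dots> = ennreal (\<integral>\<beta>. tree_prob c k \<beta> S' \<partial>child_law k x)"
      by (rule nn_integral_eq_integral[OF int nn])
    finally show "(\<integral>\<^sup>+ y. emeasure (tree_ball_from M W k y) {S'} \<partial>intensity M W x) = ennreal (tree_mean c k (\<iota> (Suc k) x) S')"
      unfolding tree_mean_def law .
    show "0 \<le> tree_mean c k (\<iota> (Suc k) x) S'"
      using tree_mean_bounded[OF c] \<iota>_topspace[OF x] by blast
  qed simp
qed

text \<open>The marginal on \<open>P_space c k\<close> of the law of \<open>i_limit\<close>, as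
  \<open>distr_restrict_i_limit\<close> confirms.\<close>

definition \<nu> :: "nat \<Rightarrow> (nat \<Rightarrow> point) measure" where
  "\<nu> k = distr M (borel_of (P_space c k)) (\<iota> k)"

lemma prob_space_\<nu>: "prob_space (\<nu> k)"
  unfolding \<nu>_def by (rule prob_space_distr[OF \<iota>_measurable])

lemma emeasure_tree_ball_\<nu>:
  "emeasure (tree_ball M W k) {T} = ennreal (\<integral>\<beta>. tree_prob c k \<beta> T \<partial>\<nu> k)"
proof -
  interpret N: prob_space "\<nu> k" by (rule prob_space_\<nu>)
  obtain b where b: "\<forall>\<beta>\<in>topspace (P_space c k). 0 \<le> tree_prob c k \<beta> T \<and> tree_prob c k \<beta> T \<le> b"
    and tm: "(\<lambda>\<beta>. tree_prob c k \<beta> T) \<in> borel_measurable (borel_of (P_space c k))"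
    using tree_prob_measurable_bounded[OF c, of k T] by blast
  have "emeasure (tree_ball M W k) {T} = (\<integral>\<^sup>+ x. ennreal (tree_prob c k (\<iota> k x) T) \<partial>M)"
    unfolding emeasure_tree_ball by (intro nn_integral_cong emeasure_tree_ball_from)
  also have "\<dots> = (\<integral>\<^sup>+ \<beta>. ennreal (tree_prob c k \<beta> T) \<partial>\<nu> k)"
    unfolding \<nu>_def using tm by (intro nn_integral_distr[OF \<iota>_measurable, symmetric]) simp
  also have "\<dots> = ennreal (\<integral>\<beta>. tree_prob c k \<beta> T \<partial>\<nu> k)"
  proof (rule nn_integral_eq_integral)
    show "AE \<beta> in \<nu> k. 0 \<le> tree_prob c k \<beta> T" using b by (intro AE_I2) (auto simp: \<nu>_def)
    show "integrable (\<nu> k) (\<lambda>\<beta>. tree_prob c k \<beta> T)"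
      using b tm by (intro N.integrable_const_bound[of _ b] AE_I2) (auto simp: \<nu>_def)
  qed
  finally show ?thesis .
qed

lemma integral_tree_prob_nonneg: "0 \<le> (\<integral>\<beta>. tree_prob c k \<beta> T \<partial>\<nu> k)"
  using tree_prob_measurable_bounded[OF c, of k T]
  by (intro integral_nonneg_AE AE_I2) (auto simp: \<nu>_def)

end

text \<open>The equivalence holds separately for each radius: tree probabilities are integrals
  against \<open>\<nu> k\<close>, and by \<open>measure_eq_of_tree_prob\<close> these integrals
  determine \<open>\<nu> k\<close>.\<close>

lemma tree_ball_eq_iff:
  assumes "capped_kernel M U c" "capped_kernel N W c"
  shows "tree_ball M U k = tree_ball N W k \<longleftrightarrow> capped_kernel.\<nu> M U c k = capped_kernel.\<nu> N W c k"
proof -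
  interpret U: capped_kernel M U c by fact
  interpret W: capped_kernel N W c by fact
  show ?thesis
  proof
    assume eq: "tree_ball M U k = tree_ball N W k"
    show "U.\<nu> k = W.\<nu> k"
    proof (rule measure_eq_of_tree_prob[OF U.c])
      show "finite_measure (U.\<nu> k)" "finite_measure (W.\<nu> k)"
        using U.prob_space_\<nu> W.prob_space_\<nu> prob_space.finite_measure by blast+
      show "(\<integral>\<gamma>. tree_prob c k \<gamma> T \<partial>U.\<nu> k) = (\<integral>\<gamma>. tree_prob c k \<gamma> T \<partial>W.\<nu> k)" for T
        using U.emeasure_tree_ball_\<nu>[of k T] W.emeasure_tree_ball_\<nu>[of k T] eq
          U.integral_tree_prob_nonneg[of k T] W.integral_tree_prob_nonneg[of k T] by simp
    qed (simp_all add: U.\<nu>_def W.\<nu>_def)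
  next
    assume "U.\<nu> k = W.\<nu> k"
    then show "tree_ball M U k = tree_ball N W k"
      by (intro measure_eqI_countable[where A = UNIV])
        (auto simp: U.sets_tree_ball W.sets_tree_ball U.emeasure_tree_ball_\<nu> W.emeasure_tree_ball_\<nu>)
  qed
qed

section \<open>The inverse limit\<close>

lemma topspace_P_limit:
  "\<alpha> \<in> topspace (P_limit c) \<longleftrightarrow> (\<forall>i. \<alpha> i \<in> topspace (L_space c i)) \<and>
    (\<forall>j. law_at c j \<alpha> = distr (law_at c (Suc j) \<alpha>) (borel_of (P_space c j)) (\<lambda>\<beta>. restrict \<beta> {..j}))"
proof -
  have "(\<forall>k\<ge>1. Q k) \<longleftrightarrow> (\<forall>j. Q (Suc j))" for Q
    by (metis One_nat_def Suc_le_mono le0 not0_implies_Suc not_one_le_zero)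
  then show ?thesis
    unfolding P_limit_def topspace_subtopology topspace_product_topology law_at_def by auto
qed

lemma measurable_P_limit_iff:
  "f \<in> measurable \<Omega> (borel_of (P_limit c)) \<longleftrightarrow>
    (\<forall>x\<in>space \<Omega>. f x \<in> topspace (P_limit c)) \<and>
    (\<forall>i. (\<lambda>x. f x i) \<in> measurable \<Omega> (borel_of (L_space c i)))"
  by (subst measurable_borel_of_product_iff[of UNIV "L_space c", OF real_generated_L_space P_limit_def]) auto

lemma measurable_restrict_P_limit:
  "(\<lambda>\<alpha>. restrict \<alpha> {..k}) \<in> measurable (borel_of (P_limit c)) (borel_of (P_space c k))"
  unfolding measurable_P_space_iff
proof (intro conjI ballI allI impI)
  fix \<alpha> assume "\<alpha> \<in> space (borel_of (P_limit c))"
  then have \<alpha>: "\<forall>i. \<alpha> i \<in> topspace (L_space c i)"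
    "\<forall>j. law_at c j \<alpha> = distr (law_at c (Suc j) \<alpha>) (borel_of (P_space c j)) (\<lambda>\<beta>. restrict \<beta> {..j})"
    unfolding space_borel_of topspace_P_limit by blast+
  show "restrict \<alpha> {..k} \<in> topspace (P_space c k)"
    unfolding topspace_P_space
  proof (intro conjI allI impI)
    show "restrict \<alpha> {..k} \<in> PiE {..k} (\<lambda>i. topspace (L_space c i))" using \<alpha>(1) by simp
    fix j assume "Suc j < k"
    then have "law_at c j (restrict \<alpha> {..k}) = law_at c j \<alpha>"
      "law_at c (Suc j) (restrict \<alpha> {..k}) = law_at c (Suc j) \<alpha>" by (simp_all add: law_at_def)
    with spec[OF \<alpha>(2), of j] show "law_at c j (restrict \<alpha> {..k}) =
      distr (law_at c (Suc j) (restrict \<alpha> {..k})) (borel_of (P_space c j)) (\<lambda>\<beta>. restrict \<beta> {..j})"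
      by (simp only:)
  qed
next
  fix i assume "i \<le> k"
  then show "(\<lambda>\<alpha>. restrict \<alpha> {..k} i) \<in> measurable (borel_of (P_limit c)) (borel_of (L_space c i))"
    using measurable_ident[of "borel_of (P_limit c)"] unfolding id_def measurable_P_limit_iff by simp
qed

text \<open>The cylinder sets over the finite levels are stable under intersection and generate the
  Borel sets of the limit.\<close>

lemma measure_eq_P_limit:
  assumes s: "sets \<mu>1 = sets (borel_of (P_limit c))" "sets \<mu>2 = sets (borel_of (P_limit c))"
    and fin: "finite_measure \<mu>1"
    and eq: "\<And>k. distr \<mu>1 (borel_of (P_space c k)) (\<lambda>\<alpha>. restrict \<alpha> {..k}) =
      distr \<mu>2 (borel_of (P_space c k)) (\<lambda>\<alpha>. restrict \<alpha> {..k})"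
  shows "\<mu>1 = \<mu>2"
proof -
  let ?S = "topspace (P_limit c)"
  let ?\<rho> = "\<lambda>k \<alpha>. restrict \<alpha> {..k}"
  define E where "E = {?\<rho> k -` A \<inter> ?S | k A. A \<in> sets (borel_of (P_space c k))}"
  have E_Pow: "E \<subseteq> Pow ?S" by (auto simp: E_def)
  \<comment> \<open>A cylinder over one level is also a cylinder over each higher level, so two
    cylinders can be intersected on a common one.\<close>
  have lift: "\<exists>B\<in>sets (borel_of (P_space c n)). ?\<rho> k -` A \<inter> ?S = ?\<rho> n -` B \<inter> ?S"
    if "A \<in> sets (borel_of (P_space c k))" "k \<le> n" for k n A
  proof
    let ?B = "?\<rho> k -` A \<inter> topspace (P_space c n)"
    show "?B \<in> sets (borel_of (P_space c n))"
      using measurable_sets[OF measurable_restrict_P_space[OF that(2)] that(1)] by simp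
    have "min n k = k" using that(2) by simp
    moreover have "?\<rho> n \<alpha> \<in> topspace (P_space c n)" if "\<alpha> \<in> ?S" for \<alpha>
      using measurable_space[OF measurable_restrict_P_limit, of \<alpha> c n] that by simp
    ultimately show "?\<rho> k -` A \<inter> ?S = ?\<rho> n -` ?B \<inter> ?S" by auto
  qed
  have stable: "Int_stable E"
  proof (rule Int_stableI)
    fix a b assume "a \<in> E" "b \<in> E"
    then obtain k A h B where ab: "a = ?\<rho> k -` A \<inter> ?S" "A \<in> sets (borel_of (P_space c k))"
      "b = ?\<rho> h -` B \<inter> ?S" "B \<in> sets (borel_of (P_space c h))" by (auto simp: E_def)
    obtain A' B' where "A' \<in> sets (borel_of (P_space c (max k h)))" "a = ?\<rho> (max k h) -` A' \<inter> ?S"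
      "B' \<in> sets (borel_of (P_space c (max k h)))" "b = ?\<rho> (max k h) -` B' \<inter> ?S"
      using lift[OF ab(2), of "max k h"] lift[OF ab(4), of "max k h"] ab(1,3) by auto
    then have "a \<inter> b = ?\<rho> (max k h) -` (A' \<inter> B') \<inter> ?S" "A' \<inter> B' \<in> sets (borel_of (P_space c (max k h)))" by auto
    then show "a \<inter> b \<in> E" unfolding E_def by blast
  qed
  have top: "?S \<in> E"
  proof -
    have "?S = ?\<rho> 0 -` topspace (P_space c 0) \<inter> ?S"
      using measurable_space[OF measurable_restrict_P_limit, of _ c 0] by auto
    then show ?thesis unfolding E_def using openin_sets_borel_of[OF openin_topspace, of "P_space c 0"] by blast
  qed
  have E_sets: "E \<subseteq> sets (borel_of (P_limit c))"
    using measurable_sets[OF measurable_restrict_P_limit] by (auto simp: E_def)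
  have "sets (borel_of (P_limit c)) \<subseteq> sigma_sets ?S E"
  proof
    fix A assume A: "A \<in> sets (borel_of (P_limit c))"
    have \<rho>: "?\<rho> k \<in> measurable (sigma ?S E) (borel_of (P_space c k))" for k
    proof (rule measurableI)
      show "?\<rho> k \<alpha> \<in> space (borel_of (P_space c k))" if "\<alpha> \<in> space (sigma ?S E)" for \<alpha>
        using measurable_space[OF measurable_restrict_P_limit, of \<alpha> c k] that by (simp add: space_measure_of_conv)
      show "?\<rho> k -` B \<inter> space (sigma ?S E) \<in> sets (sigma ?S E)" if "B \<in> sets (borel_of (P_space c k))" for B
      proof -
        have "?\<rho> k -` B \<inter> ?S \<in> E" using that by (auto simp: E_def)
        then show ?thesis using E_Pow by (simp add: space_measure_of_conv)
      qed
    qed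
    \<comment> \<open>Each coordinate factors through a finite level, so the identity from the
      cylinder sigma-algebra to the Borel one is measurable.\<close>
    have "(\<lambda>\<alpha>. \<alpha>) \<in> measurable (sigma ?S E) (borel_of (P_limit c))"
      unfolding measurable_P_limit_iff
    proof (intro conjI ballI allI)
      fix i
      show "(\<lambda>\<alpha>. \<alpha> i) \<in> measurable (sigma ?S E) (borel_of (L_space c i))"
        using measurable_compose[OF \<rho>[of i] measurable_P_space_coordinate[OF order_refl]] by simp
    qed (simp add: space_measure_of_conv)
    from measurable_sets[OF this A] have "A \<inter> ?S \<in> sigma_sets ?S E"
      using E_Pow by (simp add: space_measure_of_conv)
    moreover have "A \<subseteq> ?S" using sets.sets_into_space[OF A] by simp
    ultimately show "A \<in> sigma_sets ?S E" by (simp add: Int_absorb2)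
  qed
  moreover have "sigma_sets ?S E \<subseteq> sets (borel_of (P_limit c))"
    using sets.sigma_sets_subset[OF E_sets] by simp
  ultimately have sE: "sets (borel_of (P_limit c)) = sigma_sets ?S E" by blast
  have m: "?\<rho> k \<in> measurable \<mu>1 (borel_of (P_space c k))" "?\<rho> k \<in> measurable \<mu>2 (borel_of (P_space c k))" for k
    using measurable_restrict_P_limit by (simp_all add: measurable_cong_sets[OF s(1) refl] measurable_cong_sets[OF s(2) refl])
  have sp: "space \<mu>1 = ?S" "space \<mu>2 = ?S"
    using sets_eq_imp_space_eq[OF s(1)] sets_eq_imp_space_eq[OF s(2)] by auto
  show ?thesis
  proof (rule measure_eqI_generator_eq[OF stable E_Pow, where A = "\<lambda>_. ?S"])
    fix X assume "X \<in> E"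
    then obtain k A where X: "X = ?\<rho> k -` A \<inter> ?S" "A \<in> sets (borel_of (P_space c k))" by (auto simp: E_def)
    show "emeasure \<mu>1 X = emeasure \<mu>2 X"
      using arg_cong[OF eq[of k], of "\<lambda>\<mu>. emeasure \<mu> A"] X m by (simp add: emeasure_distr sp)
  next
    show "emeasure \<mu>1 ?S \<noteq> \<infinity>" using finite_measure.emeasure_finite[OF fin] by simp
  qed (use s sE top in auto)
qed

context capped_kernel
begin

lemma i_limit_measurable: "i_limit c M W \<in> measurable M (borel_of (P_limit c))"
  unfolding measurable_P_limit_iff
proof (intro conjI ballI allI)
  fix x assume x: "x \<in> space M"
  have "i_limit c M W x i \<in> topspace (L_space c i)" for i
    using \<iota>_topspace[OF x, of i] unfolding topspace_P_space i_limit_def by auto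
  moreover have law: "law_at c j (i_limit c M W x) = child_law j x" for j
    using law_at_\<iota>[OF x lessI[of j]] by (simp only: law_at_def i_limit_def)
  have "law_at c j (i_limit c M W x) =
    distr (law_at c (Suc j) (i_limit c M W x)) (borel_of (P_space c j)) (\<lambda>\<beta>. restrict \<beta> {..j})" for j
    unfolding law by (rule child_law_consistent[OF \<iota>_measurable])
  ultimately show "i_limit c M W x \<in> topspace (P_limit c)"
    unfolding topspace_P_limit by blast
next
  fix i
  show "(\<lambda>x. i_limit c M W x i) \<in> measurable M (borel_of (L_space c i))"
    unfolding i_limit_def
    by (rule measurable_compose[OF \<iota>_measurable measurable_P_space_coordinate[OF order_refl]])
qed

lemma distr_restrict_i_limit:
  "distr (distr M (borel_of (P_limit c)) (i_limit c M W)) (borel_of (P_space c k)) (\<lambda>\<alpha>. restrict \<alpha> {..k}) = \<nu> k"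
proof -
  have "restrict (i_limit c M W x) {..k} = \<iota> k x" for x
  proof
    fix i show "restrict (i_limit c M W x) {..k} i = \<iota> k x i"
      using i_map_below[of i k c M W x] i_map_outside[of k i c M W x] by (cases "i \<le> k") (auto simp: i_limit_def)
  qed
  then have "(\<lambda>\<alpha>. restrict \<alpha> {..k}) \<circ> i_limit c M W = \<iota> k" by (simp add: fun_eq_iff)
  then show ?thesis
    unfolding \<nu>_def by (subst distr_distr[OF measurable_restrict_P_limit i_limit_measurable]) simp
qed

end

lemma distr_i_limit_eq_iff:
  assumes "capped_kernel M U c" "capped_kernel N W c"
  shows "distr M (borel_of (P_limit c)) (i_limit c M U) = distr N (borel_of (P_limit c)) (i_limit c N W) \<longleftrightarrow>
    (\<forall>k. capped_kernel.\<nu> M U c k = capped_kernel.\<nu> N W c k)"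
proof -
  interpret U: capped_kernel M U c by fact
  interpret W: capped_kernel N W c by fact
  show ?thesis
  proof
    assume "distr M (borel_of (P_limit c)) (i_limit c M U) = distr N (borel_of (P_limit c)) (i_limit c N W)"
    then show "\<forall>k. U.\<nu> k = W.\<nu> k"
      by (intro allI) (simp only: U.distr_restrict_i_limit[symmetric] W.distr_restrict_i_limit[symmetric])
  next
    assume "\<forall>k. U.\<nu> k = W.\<nu> k"
    then have "distr (distr M (borel_of (P_limit c)) (i_limit c M U)) (borel_of (P_space c k)) (\<lambda>\<alpha>. restrict \<alpha> {..k}) =
      distr (distr N (borel_of (P_limit c)) (i_limit c N W)) (borel_of (P_space c k)) (\<lambda>\<alpha>. restrict \<alpha> {..k})" for k
      unfolding U.distr_restrict_i_limit W.distr_restrict_i_limit by blast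
    then show "distr M (borel_of (P_limit c)) (i_limit c M U) = distr N (borel_of (P_limit c)) (i_limit c N W)"
      by (rule measure_eq_P_limit[OF sets_distr sets_distr
            prob_space.axioms(1)[OF U.prob_space_distr[OF U.i_limit_measurable]]])
  qed
qed

lemma bounded_degree_akernel_probability_kernel:
  assumes "bounded_degree_akernel M W" shows "probability_kernel M W"
  using assms unfolding bounded_degree_akernel_def akernel_def ground_space_def
  by (auto intro!: probability_kernel.intro probability_kernel_axioms.intro)

lemma AE_degree_le:
  assumes "max_degree M W \<le> ennreal c" shows "AE x in M. degree M W x \<le> ennreal c"
  using esssup_AE[of "degree M W" M] assms unfolding max_degree_def by (auto elim: eventually_mono)

theorem theorem1p5:
  fixes M :: "'a measure" and U :: "'a \<Rightarrow> 'a \<Rightarrow> real"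
    and N :: "'b measure" and W :: "'b \<Rightarrow> 'b \<Rightarrow> real"
    and c :: real
  assumes "bounded_degree_akernel M U" and "bounded_degree_akernel N W"
    and "0 < c" and "max_degree M U \<le> ennreal c" and "max_degree N W \<le> ennreal c"
  shows "same_tree_distribution M U N W \<longleftrightarrow> fractionally_isomorphic c M U N W"
proof -
  interpret U: probability_kernel M U by (rule bounded_degree_akernel_probability_kernel) fact
  interpret W: probability_kernel N W by (rule bounded_degree_akernel_probability_kernel) fact
  \<comment> \<open>\<open>nu\<close> is defined through the capped kernel, to which the
    level-by-level results apply.\<close>
  have U': "capped_kernel M (cap_degree c M U) c"
    using U.probability_kernel_cap_degree[of c] U.degree_cap_degree[of c] \<open>0 < c\<close>
    by (intro capped_kernel.intro capped_kernel_axioms.intro) auto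
  have W': "capped_kernel N (cap_degree c N W) c"
    using W.probability_kernel_cap_degree[of c] W.degree_cap_degree[of c] \<open>0 < c\<close>
    by (intro capped_kernel.intro capped_kernel_axioms.intro) auto
  have "same_tree_distribution M U N W \<longleftrightarrow>
    (\<forall>k. tree_ball M (cap_degree c M U) k = tree_ball N (cap_degree c N W) k)"
    unfolding same_tree_distribution_def
    using U.tree_ball_cap_degree[OF AE_degree_le[OF assms(4)]] W.tree_ball_cap_degree[OF AE_degree_le[OF assms(5)]]
    by simp
  \<comment> \<open>Equality of balls of radius \<open>k\<close> is equality of the level
    \<open>k\<close> marginals, and all marginals together determine the law on the inverse
    limit.\<close>
  also have "\<dots> \<longleftrightarrow> fractionally_isomorphic c M U N W"
    unfolding tree_ball_eq_iff[OF U' W'] fractionally_isomorphic_def nu_def distr_i_limit_eq_iff[OF U' W'] ..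
  finally show ?thesis .
qed

end
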